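(* Let $\lambda=(\lambda_1\ge\lambda_2\ge\dots\ge\lambda_n)\in\mathbb R^n$ be a dominant weight and let $p_\lambda\in Z_{t^\lambda}(\mathbf K_{>0})$ be the unique positive critical point of $\mathcal W_{t^\lambda}$. For a reduced expression $\mathbf i$ of $w_0$, let $(m'_\alpha)_{\alpha\in R_+}\in(\mathbf K_{>0})^{R_+}$ be the coordinates of $p_\lambda$ in the ideal chart for $\mathbf i$, that is $\psi_{\mathbf i}(t^\lambda,(m'_\alpha)_{\alpha\in R_+})=p_\lambda$, and let $p^{\mathrm{trop}}_{\lambda,\boldsymbol\mu'}=(\mathrm{Val}_{\mathbf K}(m'_\alpha))_{\alpha\in R_+}\in\mathbb R^{R_+}$. Then the tropical critical point $p^{\mathrm{trop}}_{\lambda,\boldsymbol\mu'}\in\mathbb R^{R_+}$ is independent of the choice of reduced expression $\mathbf i$ for $w_0$.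
   Context: Let $\mathbf K$ be the field of generalised Puiseux series: series $c(t)=\sum_k c_{\mu_k}t^{\mu_k}$ with $c_{\mu_k}\in\mathbb C$ and real, strictly increasing exponents $\mu_0<\mu_1<\cdots$ which are finite in number or tend to $+\infty$. $\mathbf K_{>0}$ is the set of nonzero series whose lowest order coefficient is in $\mathbb R_{>0}$, and $\mathrm{Val}_{\mathbf K}(c(t))$ is the lowest exponent with non-zero coefficient. Let $n\ge2$, $N=\binom n2$. In $GL_n(\mathbf K)$ let $B,B_-$ be the upper/lower triangular matrices, $U\subset B$ the unipotent upper triangular matrices, $T$ the diagonal matrices. $\phi_i:SL_2\to GL_n$ embeds a $2\times 2$ matrix in rows and columns $i,i+1$; $\mathbf y_i(z)=\phi_i\begin{pmatrix}1&0\\ z&1\end{pmatrix}$, $\bar s_i=\phi_i\begin{pmatrix}0&-1\\1&0\end{pmatrix}$, and $\bar w_0=\bar s_{i_1}\cdots\bar s_{i_N}$ for any reduced expression $w_0=s_{i_1}\cdots s_{i_N}$ of the longest element of $S_n$. $Z=B_-\cap B\bar w_0B$. Each $b\in Z$ is uniquely $b=u_1d\bar w_0u_2$ with $u_1,u_2\in U$, $d\in T$; put $\mathrm{hw}(b)=d$ and $\mathcal W(b)=\chi(u_1)+\chi(u_2)$ where $\chi(u)=\sum_{i=1}^{n-1}u_{i,i+1}$. For $\lambda\in\mathbb R^n$, $t^\lambda=\mathrm{diag}(t^{\lambda_1},\dots,t^{\lambda_n})$, $Z_{t^\lambda}(\mathbf K)=\{b\in Z:\mathrm{hw}(b)=t^\lambda\}$,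 and $\mathcal W_{t^\lambda}$ is the restriction of $\mathcal W$ to $Z_{t^\lambda}(\mathbf K)$. $R_+=\{\alpha_{ij}=\epsilon_i-\epsilon_j\mid 1\le i<j\le n\}$, $\alpha_i=\alpha_{i,i+1}$. A reduced expression $\mathbf i=(i_1,\dots,i_N)$ of $w_0$ orders $R_+$ by $\alpha^{\mathbf i}_1=\alpha_{i_1}$, $\alpha^{\mathbf i}_j=s_{i_1}\cdots s_{i_{j-1}}\alpha_{i_j}$. The ideal chart for $\mathbf i$ is $$\psi_{\mathbf i}(d,\boldsymbol m')=\mathbf y_{i_1}\Big(\tfrac1{m'_{\alpha^{\mathbf i}_1}}\Big)\cdots\mathbf y_{i_N}\Big(\tfrac1{m'_{\alpha^{\mathbf i}_N}}\Big)\,t_R(d,\boldsymbol m'),\qquad \boldsymbol m'=(m'_\alpha)_{\alpha\in R_+},$$ where $t_R(d,\boldsymbol m')$ is the diagonal matrix with $(n-j+1)$-th diagonal entry $d_j\prod_{l=1}^{j-1}m'_{\alpha_{lj}}\big/\prod_{l=j+1}^{n}m'_{\alpha_{jl}}$, $j=1,\dots,n$. One has $\mathrm{hw}(\psi_{\mathbf i}(d,\boldsymbol m'))=d$. The totally positive part $Z_{t^\lambda}(\mathbf K_{>0})$ is the (bijective) image of $(\mathbf K_{>0})^{R_+}$ under $\boldsymbol m'\mapsto\psi_{\mathbf i}(t^\lambda,\boldsymbol m')$; it does not depend on $\mathbf i$. It is known (Judd, Judd–Rietsch) that for every dominant $\lambda\in\mathbb R^n$ the function $\mathcal W_{t^\lambda}$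 has exactly one critical point $p_\lambda$ in $Z_{t^\lambda}(\mathbf K_{>0})$. *)

theory Defs
  imports
    "Jordan_Normal_Form.Matrix"
    "HOL-Combinatorics.Transposition"
    "HOL-Library.FuncSet"
    Complex_Main
begin

section \<open>The field of generalised Puiseux series\<close>

definition puiseux_exponents :: "real set \<Rightarrow> bool" where
  "puiseux_exponents S \<longleftrightarrow>
     finite S \<or> (\<exists>\<mu>::nat \<Rightarrow> real. strict_mono \<mu> \<and> filterlim \<mu> at_top sequentially \<and> S = range \<mu>)"

lemma puiseux_exponents_iff: "puiseux_exponents S \<longleftrightarrow> (\<forall>B. finite (S \<inter> {..B}))"
proof
  assume "puiseux_exponents S"
  then consider "finite S"
    | \<mu> :: "nat \<Rightarrow> real" where "filterlim \<mu> at_top sequentially" "S = range \<mu>"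
    unfolding puiseux_exponents_def by blast
  then show "\<forall>B. finite (S \<inter> {..B})"
  proof cases
    case 1
    then show ?thesis by simp
  next
    case (2 \<mu>)
    show ?thesis
    proof
      fix B
      have "eventually (\<lambda>k. \<mu> k > B) sequentially"
        using 2(1) by (simp add: filterlim_at_top_dense)
      then obtain M where M: "\<And>k. k \<ge> M \<Longrightarrow> \<mu> k > B"
        unfolding eventually_sequentially by blast
      have "S \<inter> {..B} \<subseteq> \<mu> ` {..<M}"
        using 2(2) M by (force simp: not_less[symmetric])
      then show "finite (S \<inter> {..B})"
        using finite_subset by blast
    qed
  qed
next
  assume fin: "\<forall>B. finite (S \<inter> {..B})"
  have fin': "finite (S \<inter> {..<B})" for B
    by (rule finite_subset[OF _ fin[rule_format, of B]]) auto
  show "puiseux_exponents S"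
  proof (cases "finite S")
    case True
    then show ?thesis by (simp add: puiseux_exponents_def)
  next
    case False
    have next_ex: "\<exists>y\<in>S. x < y \<and> S \<inter> {..<y} = S \<inter> {..x}" for x
    proof -
      obtain s where s: "s \<in> S" "x < s"
        using False fin by (metis Int_absorb2 atMost_iff not_le subsetI)
      let ?T = "S \<inter> {x<..s}"
      have T: "finite ?T" "?T \<noteq> {}"
        using s by (auto intro: finite_subset[OF _ fin[rule_format, of s]])
      define y where "y = Min ?T"
      have y: "y \<in> ?T" "\<And>z. z \<in> ?T \<Longrightarrow> y \<le> z"
        using T by (auto simp: y_def simp del: Int_iff intro: Min_in)
      have "z \<le> x" if "z \<in> S" "z < y" for z
        using y(2)[of z] y(1) that by force
      then have "S \<inter> {..<y} = S \<inter> {..x}"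
        using y(1) by force
      then show ?thesis using y(1) by auto
    qed
    have "\<exists>f. \<forall>n. (f n \<in> S \<and> card (S \<inter> {..<f n}) = n) \<and> f n < f (Suc n)"
    proof (rule dependent_nat_choice)
      obtain s where s: "s \<in> S" using False by fastforce
      let ?m = "Min (S \<inter> {..s})"
      have T: "finite (S \<inter> {..s})" "S \<inter> {..s} \<noteq> {}" using fin s by auto
      have m: "?m \<in> S \<inter> {..s}" using Min_in[OF T] .
      have "S \<inter> {..<?m} = {}"
      proof (rule ccontr)
        assume "S \<inter> {..<?m} \<noteq> {}"
        then obtain z where z: "z \<in> S" "z < ?m" by auto
        then have "z \<in> S \<inter> {..s}" using m by auto
        then have "?m \<le> z" using T(1) by (intro Min_le)
        then show False using z by simp
      qed
      then show "\<exists>x. x \<in> S \<and> card (S \<inter> {..<x}) = 0" using m by auto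
    next
      fix x n assume x: "x \<in> S \<and> card (S \<inter> {..<x}) = n"
      obtain y where y: "y \<in> S" "x < y" "S \<inter> {..<y} = S \<inter> {..x}" using next_ex by blast
      have "S \<inter> {..x} = insert x (S \<inter> {..<x})" using x by auto
      then have "card (S \<inter> {..<y}) = Suc n" using y(3) x fin' by simp
      then show "\<exists>y. (y \<in> S \<and> card (S \<inter> {..<y}) = Suc n) \<and> x < y" using y by blast
    qed
    then obtain \<mu> where mem: "\<And>n. \<mu> n \<in> S" and crd: "\<And>n. card (S \<inter> {..<\<mu> n}) = n"
      and step: "\<And>n. \<mu> n < \<mu> (Suc n)" by blast
    have "strict_mono \<mu>" using step by (simp add: strict_mono_Suc_iff)
    moreover have "filterlim \<mu> at_top sequentially"
      unfolding filterlim_at_top_dense eventually_sequentially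
    proof (intro allI exI impI)
      fix B n assume n: "Suc (card (S \<inter> {..B})) \<le> n"
      show "B < \<mu> n"
      proof (rule ccontr)
        assume "\<not> B < \<mu> n"
        then have "S \<inter> {..<\<mu> n} \<subseteq> S \<inter> {..B}" by auto
        from card_mono[OF fin[rule_format] this] show False using n crd[of n] by simp
      qed
    qed
    moreover have "S = range \<mu>"
    proof
      show "range \<mu> \<subseteq> S" using mem by auto
      show "S \<subseteq> range \<mu>"
      proof
        fix s assume s: "s \<in> S"
        let ?k = "card (S \<inter> {..<s})"
        have "\<not> s < \<mu> ?k"
        proof
          assume "s < \<mu> ?k"
          then have "S \<inter> {..<s} \<subset> S \<inter> {..<\<mu> ?k}" using s by force
          from psubset_card_mono[OF fin' this] show False using crd by simp
        qed
        moreover have "\<not> \<mu> ?k < s"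
        proof
          assume "\<mu> ?k < s"
          then have "S \<inter> {..<\<mu> ?k} \<subset> S \<inter> {..<s}" using mem[of ?k] by force
          from psubset_card_mono[OF fin' this] show False using crd by simp
        qed
        ultimately have "s = \<mu> ?k" by simp
        then show "s \<in> range \<mu>" by blast
      qed
    qed
    ultimately show ?thesis unfolding puiseux_exponents_def by blast
  qed
qed

typedef puiseux = "{c :: real \<Rightarrow> complex. puiseux_exponents {e. c e \<noteq> 0}}"
  morphisms pcoeff Abs_puiseux
  by (rule exI[of _ "\<lambda>_. 0"]) (simp add: puiseux_exponents_def)

setup_lifting type_definition_puiseux

lemma puiseux_eqI: "(\<And>e. pcoeff a e = pcoeff b e) \<Longrightarrow> a = b"
  by (metis ext pcoeff_inject)

lemma finite_pcoeff: "finite {e. pcoeff a e \<noteq> 0 \<and> e \<le> B}"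
proof -
  have "finite ({e. pcoeff a e \<noteq> 0} \<inter> {..B})"
    using pcoeff[of a] by (simp add: puiseux_exponents_iff)
  moreover have "{e. pcoeff a e \<noteq> 0} \<inter> {..B} = {e. pcoeff a e \<noteq> 0 \<and> e \<le> B}" by auto
  ultimately show ?thesis by simp
qed

lemma puiseux_exponentsI:
  assumes "\<And>B. finite {e. c e \<noteq> 0 \<and> e \<le> B}"
  shows "puiseux_exponents {e. c e \<noteq> 0}"
proof -
  have "{e. c e \<noteq> 0} \<inter> {..B} = {e. c e \<noteq> 0 \<and> e \<le> B}" for B by auto
  with assms show ?thesis by (simp add: puiseux_exponents_iff)
qed

lemma puiseux_exponents_fun_iff:
  "puiseux_exponents {e. c e \<noteq> (0::complex)} \<longleftrightarrow> (\<forall>B. finite {e. c e \<noteq> 0 \<and> e \<le> B})"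
proof -
  have "{e. c e \<noteq> 0} \<inter> {..B} = {e. c e \<noteq> 0 \<and> e \<le> B}" for B by auto
  then show ?thesis by (simp add: puiseux_exponents_iff)
qed

lemma pcoeff_lower_bound: "\<exists>L. \<forall>e. pcoeff a e \<noteq> 0 \<longrightarrow> L \<le> e"
proof (cases "\<exists>x. pcoeff a x \<noteq> 0")
  case True
  then obtain x where x: "pcoeff a x \<noteq> 0" by blast
  let ?S = "{e. pcoeff a e \<noteq> 0 \<and> e \<le> x}"
  have "Min ?S \<le> e" if e: "pcoeff a e \<noteq> 0" for e
  proof (cases "e \<le> x")
    case True
    then show ?thesis using finite_pcoeff[of a x] e by (intro Min_le) auto
  next
    case False
    have "Min ?S \<le> x" using finite_pcoeff[of a x] x by (intro Min_le) auto
    then show ?thesis using False by simp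
  qed
  then show ?thesis by blast
qed auto

lemma finite_puiseux_product: "finite {x. pcoeff a x \<noteq> 0 \<and> pcoeff b (e - x) \<noteq> 0}"
proof -
  obtain L where L: "\<And>e. pcoeff b e \<noteq> 0 \<Longrightarrow> L \<le> e" using pcoeff_lower_bound by blast
  have "{x. pcoeff a x \<noteq> 0 \<and> pcoeff b (e - x) \<noteq> 0} \<subseteq> {x. pcoeff a x \<noteq> 0 \<and> x \<le> e - L}"
    using L by force
  then show ?thesis using finite_pcoeff finite_subset by blast
qed

instantiation puiseux :: comm_ring_1
begin

lift_definition zero_puiseux :: puiseux is "\<lambda>_. 0"
  by (simp add: puiseux_exponents_def)

lift_definition one_puiseux :: puiseux is "\<lambda>e. if e = 0 then 1 else 0"
  by (simp add: puiseux_exponents_def)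

lift_definition plus_puiseux :: "puiseux \<Rightarrow> puiseux \<Rightarrow> puiseux" is "\<lambda>a b e. a e + b e"
proof -
  fix a b :: "real \<Rightarrow> complex"
  assume "puiseux_exponents {e. a e \<noteq> 0}" "puiseux_exponents {e. b e \<noteq> 0}"
  then have *: "finite ({e. a e \<noteq> 0 \<and> e \<le> B} \<union> {e. b e \<noteq> 0 \<and> e \<le> B})" for B
    by (simp add: puiseux_exponents_fun_iff)
  show "puiseux_exponents {e. a e + b e \<noteq> 0}"
    by (rule puiseux_exponentsI, rule finite_subset[OF _ *]) auto
qed

lift_definition uminus_puiseux :: "puiseux \<Rightarrow> puiseux" is "\<lambda>a e. - a e"
  by simp

definition minus_puiseux :: "puiseux \<Rightarrow> puiseux \<Rightarrow> puiseux" where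
  "minus_puiseux a b = a + - b"

lift_definition times_puiseux :: "puiseux \<Rightarrow> puiseux \<Rightarrow> puiseux" is
  "\<lambda>a b e. \<Sum>x | a x \<noteq> 0 \<and> b (e - x) \<noteq> 0. a x * b (e - x)"
proof -
  fix a b :: "real \<Rightarrow> complex"
  assume ab: "puiseux_exponents {e. a e \<noteq> 0}" "puiseux_exponents {e. b e \<noteq> 0}"
  define a' b' where "a' = Abs_puiseux a" and "b' = Abs_puiseux b"
  have [simp]: "pcoeff a' = a" "pcoeff b' = b"
    using ab by (auto simp: a'_def b'_def Abs_puiseux_inverse)
  obtain L where L: "\<And>e. a e \<noteq> 0 \<Longrightarrow> L \<le> e" using pcoeff_lower_bound[of a'] by auto
  obtain M where M: "\<And>e. b e \<noteq> 0 \<Longrightarrow> M \<le> e" using pcoeff_lower_bound[of b'] by auto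
  show "puiseux_exponents {e. (\<Sum>x | a x \<noteq> 0 \<and> b (e - x) \<noteq> 0. a x * b (e - x)) \<noteq> 0}"
  proof (rule puiseux_exponentsI)
    fix B
    let ?X = "{x. a x \<noteq> 0 \<and> x \<le> B - M}" and ?Y = "{x. b x \<noteq> 0 \<and> x \<le> B - L}"
    have fin: "finite ((\<lambda>(x, y). x + y) ` (?X \<times> ?Y))"
      using ab by (auto simp: puiseux_exponents_fun_iff)
    show "finite {e. (\<Sum>x | a x \<noteq> 0 \<and> b (e - x) \<noteq> 0. a x * b (e - x)) \<noteq> 0 \<and> e \<le> B}"
    proof (rule finite_subset[OF _ fin], rule)
      fix e assume "e \<in> {e. (\<Sum>x | a x \<noteq> 0 \<and> b (e - x) \<noteq> 0. a x * b (e - x)) \<noteq> 0 \<and> e \<le> B}"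
      then obtain x where x: "a x \<noteq> 0" "b (e - x) \<noteq> 0" "e \<le> B"
        by (auto elim!: sum.not_neutral_contains_not_neutral)
      have "(x, e - x) \<in> ?X \<times> ?Y" using x L[OF x(1)] M[OF x(2)] by auto
      then show "e \<in> (\<lambda>(x, y). x + y) ` (?X \<times> ?Y)" by force
    qed
  qed
qed

lemma pcoeff_times:
  assumes "finite A" "\<And>x. pcoeff a x \<noteq> 0 \<Longrightarrow> pcoeff b (e - x) \<noteq> 0 \<Longrightarrow> x \<in> A"
  shows "pcoeff (a * b) e = (\<Sum>x\<in>A. pcoeff a x * pcoeff b (e - x))"
  unfolding times_puiseux.rep_eq
  by (rule sum.mono_neutral_left) (use assms in auto)

lemma pcoeff_times':
  assumes "finite A" "\<And>x. pcoeff b x \<noteq> 0 \<Longrightarrow> pcoeff a (e - x) \<noteq> 0 \<Longrightarrow> x \<in> A"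
  shows "pcoeff (a * b) e = (\<Sum>x\<in>A. pcoeff a (e - x) * pcoeff b x)"
proof -
  have inj: "inj_on (\<lambda>x. e - x) A" by (auto simp: inj_on_def)
  have "pcoeff (a * b) e = (\<Sum>x\<in>(\<lambda>x. e - x) ` A. pcoeff a x * pcoeff b (e - x))"
  proof (rule pcoeff_times)
    fix x assume x: "pcoeff a x \<noteq> 0" "pcoeff b (e - x) \<noteq> 0"
    then have "e - x \<in> A" using assms(2)[of "e - x"] by simp
    then show "x \<in> (\<lambda>x. e - x) ` A" by (intro image_eqI[of _ _ "e - x"]) auto
  qed (use assms in auto)
  then show ?thesis by (simp add: sum.reindex[OF inj])
qed

instance
proof
  fix a b c :: puiseux
  show "a + b + c = a + (b + c)" "a + b = b + a" "0 + a = a" "- a + a = 0" "a - b = a + - b"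
    by (auto intro!: puiseux_eqI
        simp: plus_puiseux.rep_eq zero_puiseux.rep_eq uminus_puiseux.rep_eq minus_puiseux_def)
  show "(0::puiseux) \<noteq> 1"
    by transfer (metis one_neq_zero)
  show "a * b = b * a"
  proof (rule puiseux_eqI)
    fix e
    show "pcoeff (a * b) e = pcoeff (b * a) e"
      unfolding times_puiseux.rep_eq[of b a] by (subst pcoeff_times'[OF finite_puiseux_product[of b a e]]) (auto simp: mult.commute)
  qed
  show "1 * a = a"
    by (rule puiseux_eqI, subst pcoeff_times[of "{0}"])
      (auto simp: one_puiseux.rep_eq split: if_splits)
  show "(a + b) * c = a * c + b * c"
  proof (rule puiseux_eqI)
    fix e
    let ?A = "{x. pcoeff a x \<noteq> 0 \<and> pcoeff c (e - x) \<noteq> 0} \<union> {x. pcoeff b x \<noteq> 0 \<and> pcoeff c (e - x) \<noteq> 0}"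
    have A: "finite ?A" using finite_puiseux_product by blast
    have "pcoeff ((a + b) * c) e = (\<Sum>x\<in>?A. pcoeff (a + b) x * pcoeff c (e - x))"
      by (rule pcoeff_times[OF A]) (auto simp: plus_puiseux.rep_eq)
    moreover have "pcoeff (a * c) e = (\<Sum>x\<in>?A. pcoeff a x * pcoeff c (e - x))"
      by (rule pcoeff_times[OF A]) auto
    moreover have "pcoeff (b * c) e = (\<Sum>x\<in>?A. pcoeff b x * pcoeff c (e - x))"
      by (rule pcoeff_times[OF A]) auto
    ultimately show "pcoeff ((a + b) * c) e = pcoeff (a * c + b * c) e"
      by (simp add: plus_puiseux.rep_eq distrib_right sum.distrib)
  qed
  show "a * b * c = a * (b * c)"
  proof (rule puiseux_eqI)
    fix e
    obtain La where La: "\<And>e. pcoeff a e \<noteq> 0 \<Longrightarrow> La \<le> e" using pcoeff_lower_bound by blast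
    obtain Lb where Lb: "\<And>e. pcoeff b e \<noteq> 0 \<Longrightarrow> Lb \<le> e" using pcoeff_lower_bound by blast
    obtain Lc where Lc: "\<And>e. pcoeff c e \<noteq> 0 \<Longrightarrow> Lc \<le> e" using pcoeff_lower_bound by blast
    define A where "A = {x. pcoeff a x \<noteq> 0 \<and> x \<le> e - Lb - Lc}"
    define C where "C = {x. pcoeff c x \<noteq> 0 \<and> x \<le> e - La - Lb}"
    have fin: "finite A" "finite C" by (auto simp: A_def C_def finite_pcoeff)
    have ab: "La + Lb \<le> x" if nz: "pcoeff (a * b) x \<noteq> 0" for x
    proof -
      obtain y where "pcoeff a y \<noteq> 0" "pcoeff b (x - y) \<noteq> 0"
        using nz unfolding times_puiseux.rep_eq
        by (auto elim!: sum.not_neutral_contains_not_neutral)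
      then show ?thesis using La[of y] Lb[of "x - y"] by simp
    qed
    have bc: "Lb + Lc \<le> x" if nz: "pcoeff (b * c) x \<noteq> 0" for x
    proof -
      obtain y where "pcoeff b y \<noteq> 0" "pcoeff c (x - y) \<noteq> 0"
        using nz unfolding times_puiseux.rep_eq
        by (auto elim!: sum.not_neutral_contains_not_neutral)
      then show ?thesis using Lb[of y] Lc[of "x - y"] by simp
    qed
    have "pcoeff (a * b * c) e = (\<Sum>z\<in>C. pcoeff (a * b) (e - z) * pcoeff c z)"
      by (rule pcoeff_times'[OF fin(2)]) (use ab in \<open>force simp: C_def\<close>)
    also have "\<dots> = (\<Sum>z\<in>C. (\<Sum>x\<in>A. pcoeff a x * pcoeff b (e - z - x)) * pcoeff c z)"
    proof (rule sum.cong[OF refl])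
      fix z assume "z \<in> C"
      then have z: "Lc \<le> z" using Lc by (simp add: C_def)
      have "pcoeff (a * b) (e - z) = (\<Sum>x\<in>A. pcoeff a x * pcoeff b (e - z - x))"
      proof (rule pcoeff_times[OF fin(1)])
        fix x assume "pcoeff a x \<noteq> 0" "pcoeff b (e - z - x) \<noteq> 0"
        then show "x \<in> A" using Lb[of "e - z - x"] z by (simp add: A_def)
      qed
      then show "pcoeff (a * b) (e - z) * pcoeff c z
          = (\<Sum>x\<in>A. pcoeff a x * pcoeff b (e - z - x)) * pcoeff c z" by simp
    qed
    also have "\<dots> = (\<Sum>x\<in>A. pcoeff a x * (\<Sum>z\<in>C. pcoeff b (e - x - z) * pcoeff c z))"
      by (simp add: sum_distrib_left sum_distrib_right sum.swap[of _ A C] algebra_simps)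
    also have "\<dots> = (\<Sum>x\<in>A. pcoeff a x * pcoeff (b * c) (e - x))"
    proof (rule sum.cong[OF refl])
      fix x assume "x \<in> A"
      then have x: "La \<le> x" using La by (simp add: A_def)
      have "pcoeff (b * c) (e - x) = (\<Sum>z\<in>C. pcoeff b (e - x - z) * pcoeff c z)"
      proof (rule pcoeff_times'[OF fin(2)])
        fix z assume "pcoeff c z \<noteq> 0" "pcoeff b (e - x - z) \<noteq> 0"
        then show "z \<in> C" using Lb[of "e - x - z"] x by (simp add: C_def)
      qed
      then show "pcoeff a x * (\<Sum>z\<in>C. pcoeff b (e - x - z) * pcoeff c z)
          = pcoeff a x * pcoeff (b * c) (e - x)" by simp
    qed
    also have "\<dots> = pcoeff (a * (b * c)) e"
      by (rule pcoeff_times[OF fin(1), symmetric]) (use bc in \<open>force simp: A_def\<close>)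
    finally show "pcoeff (a * b * c) e = pcoeff (a * (b * c)) e" .
  qed
qed

end

lemma pcoeff_minus: "pcoeff (a - b) e = pcoeff a e - pcoeff b e"
  unfolding minus_puiseux_def plus_puiseux.rep_eq uminus_puiseux.rep_eq by simp

lift_definition pmonom :: "complex \<Rightarrow> real \<Rightarrow> puiseux" is "\<lambda>z \<mu> e. if e = \<mu> then z else 0"
  by (simp add: puiseux_exponents_def)

definition puiseux_val :: "puiseux \<Rightarrow> real" where
  "puiseux_val c = (LEAST e. pcoeff c e \<noteq> 0)"

definition puiseux_pos :: "puiseux set" where
  "puiseux_pos = {c. c \<noteq> 0 \<and> (\<exists>r>0. pcoeff c (puiseux_val c) = complex_of_real r)}"

lemma puiseux_val:
  assumes "c \<noteq> 0"
  shows pcoeff_puiseux_val: "pcoeff c (puiseux_val c) \<noteq> 0"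
    and puiseux_val_le: "pcoeff c e \<noteq> 0 \<Longrightarrow> puiseux_val c \<le> e"
proof -
  obtain x where x: "pcoeff c x \<noteq> 0"
    using assms by (metis puiseux_eqI zero_puiseux.rep_eq)
  let ?S = "{e. pcoeff c e \<noteq> 0 \<and> e \<le> x}"
  have S: "finite ?S" "?S \<noteq> {}" using finite_pcoeff x by auto
  have min: "pcoeff c (Min ?S) \<noteq> 0" "Min ?S \<le> x" using Min_in[OF S] by auto
  have le: "Min ?S \<le> e" if "pcoeff c e \<noteq> 0" for e
  proof (cases "e \<le> x")
    case True
    then show ?thesis using that S by (intro Min_le) auto
  qed (use min in auto)
  have "puiseux_val c = Min ?S"
    unfolding puiseux_val_def by (rule Least_equality) (use min le in auto)
  then show "pcoeff c (puiseux_val c) \<noteq> 0" "pcoeff c e \<noteq> 0 \<Longrightarrow> puiseux_val c \<le> e"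
    using min le by auto
qed

lemma pcoeff_pmonom_times: "pcoeff (pmonom z \<mu> * a) e = z * pcoeff a (e - \<mu>)"
  by (subst pcoeff_times[of "{\<mu>}"]) (auto simp: pmonom.rep_eq split: if_splits)

text \<open>The geometric series inverts a series with constant term \<open>1\<close> and no negative exponents.\<close>

lemma puiseux_geometric:
  assumes x: "\<And>e. pcoeff x e \<noteq> 0 \<Longrightarrow> e > 0"
  shows "\<exists>y. (1 - x) * y = 1"
proof -
  obtain \<delta> where \<delta>: "\<delta> > 0" "\<And>e. pcoeff x e \<noteq> 0 \<Longrightarrow> \<delta> \<le> e"
  proof (cases "x = 0")
    case True
    then show ?thesis using that[of 1] by (simp add: zero_puiseux.rep_eq)
  next
    case False
    then show ?thesis
      using that[of "puiseux_val x"] puiseux_val[OF False] x by blast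
  qed
  have pow: "real k * \<delta> \<le> e" if "pcoeff (x ^ k) e \<noteq> 0" for k e
    using that
  proof (induction k arbitrary: e)
    case 0
    then show ?case by (simp add: one_puiseux.rep_eq split: if_splits)
  next
    case (Suc k)
    then obtain z where "pcoeff x z \<noteq> 0" "pcoeff (x ^ k) (e - z) \<noteq> 0"
      unfolding power_Suc times_puiseux.rep_eq
      by (auto elim!: sum.not_neutral_contains_not_neutral)
    then show ?case using \<delta>(2)[of z] Suc.IH[of "e - z"] by (simp add: algebra_simps)
  qed
  have pcoeff_sum: "pcoeff (\<Sum>i\<in>I. f i) e = (\<Sum>i\<in>I. pcoeff (f i) e)" for I :: "nat set" and f e
    by (induction I rule: infinite_finite_induct)
      (auto simp: zero_puiseux.rep_eq plus_puiseux.rep_eq)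
  define S where "S n = (\<Sum>k<n. x ^ k)" for n
  define N where "N e = nat \<lceil>e / \<delta>\<rceil> + 1" for e
  have N: "e < real k * \<delta>" if "k \<ge> N e" for e k
  proof -
    have "e / \<delta> < real (N e)" unfolding N_def by linarith
    also have "\<dots> \<le> real k" using that by simp
    finally show ?thesis using \<delta>(1) by (simp add: divide_simps)
  qed
  have N_mono: "N a \<le> N b" if "a \<le> b" for a b
    unfolding N_def using that \<delta>(1)
    by (intro add_mono nat_mono ceiling_mono divide_right_mono) auto
  have S_stable: "pcoeff (S n) e = pcoeff (S (N e)) e" if "n \<ge> N e" for n e
    unfolding S_def pcoeff_sum
  proof (rule sum.mono_neutral_right)
    show "\<forall>i\<in>{..<n} - {..<N e}. pcoeff (x ^ i) e = 0"
    proof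
      fix i assume "i \<in> {..<n} - {..<N e}"
      then have "e < real i * \<delta>" using N[of e i] by simp
      then show "pcoeff (x ^ i) e = 0" using pow[of i e] by force
    qed
  qed (use that in auto)
  define y where "y = Abs_puiseux (\<lambda>e. pcoeff (S (N e)) e)"
  have "puiseux_exponents {e. pcoeff (S (N e)) e \<noteq> 0}"
  proof (rule puiseux_exponentsI)
    fix B
    have eq: "pcoeff (S (N e)) e = pcoeff (S (N B)) e" if "e \<le> B" for e
    proof -
      have "N e \<le> N B" by (rule N_mono[OF that])
      then show ?thesis by (rule S_stable[symmetric])
    qed
    have "{e. pcoeff (S (N e)) e \<noteq> 0 \<and> e \<le> B} \<subseteq> {e. pcoeff (S (N B)) e \<noteq> 0 \<and> e \<le> B}"
      using eq by auto
    then show "finite {e. pcoeff (S (N e)) e \<noteq> 0 \<and> e \<le> B}"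
      using finite_pcoeff finite_subset by blast
  qed
  then have y: "pcoeff y e = pcoeff (S (N e)) e" for e
    by (simp add: y_def Abs_puiseux_inverse)
  have tele: "(1 - x) * S n = 1 - x ^ n" for n
    unfolding S_def by (simp add: one_diff_power_eq)
  have "pcoeff ((1 - x) * y) e = pcoeff 1 e" for e
  proof -
    have nn: "0 \<le> z" if "pcoeff (1 - x) z \<noteq> 0" for z
      using that x[of z] by (force simp: pcoeff_minus
          one_puiseux.rep_eq split: if_splits)
    let ?A = "{z. pcoeff (1 - x) z \<noteq> 0 \<and> pcoeff y (e - z) \<noteq> 0}
       \<union> {z. pcoeff (1 - x) z \<noteq> 0 \<and> pcoeff (S (N e)) (e - z) \<noteq> 0}"
    have A: "finite ?A" using finite_puiseux_product by blast
    have "pcoeff ((1 - x) * y) e = (\<Sum>z\<in>?A. pcoeff (1 - x) z * pcoeff y (e - z))"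
      by (rule pcoeff_times[OF A]) auto
    also have "\<dots> = (\<Sum>z\<in>?A. pcoeff (1 - x) z * pcoeff (S (N e)) (e - z))"
    proof (rule sum.cong[OF refl])
      fix z assume "z \<in> ?A"
      then have "0 \<le> z" using nn by auto
      then have "N (e - z) \<le> N e" by (intro N_mono) simp
      then show "pcoeff (1 - x) z * pcoeff y (e - z) = pcoeff (1 - x) z * pcoeff (S (N e)) (e - z)"
        using S_stable[of "e - z" "N e"] by (simp only: y)
    qed
    also have "\<dots> = pcoeff ((1 - x) * S (N e)) e"
      by (rule pcoeff_times[OF A, symmetric]) auto
    also have "\<dots> = pcoeff 1 e - pcoeff (x ^ N e) e"
      by (simp add: tele pcoeff_minus)
    also have "pcoeff (x ^ N e) e = 0" using pow[of "N e" e] N[of e "N e"] by force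
    finally show ?thesis by simp
  qed
  then have "(1 - x) * y = 1" by (rule puiseux_eqI)
  then show ?thesis ..
qed

lemma puiseux_inverse_exists:
  assumes "(c::puiseux) \<noteq> 0"
  shows "\<exists>d. c * d = 1"
proof -
  define v z where "v = puiseux_val c" and "z = pcoeff c v"
  have z: "z \<noteq> 0" using pcoeff_puiseux_val[OF assms] by (simp add: z_def v_def)
  let ?m = "pmonom (1 / z) (- v)"
  have "e > 0" if "pcoeff (1 - ?m * c) e \<noteq> 0" for e
  proof (rule ccontr)
    assume "\<not> e > 0"
    then consider "e = 0" | "e < 0" by linarith
    then have "pcoeff (1 - ?m * c) e = 0"
    proof cases
      case 1
      then show ?thesis using z
        by (simp add: pcoeff_minus
            pcoeff_pmonom_times one_puiseux.rep_eq flip: z_def)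
    next
      case 2
      then have "pcoeff c (e + v) = 0" 
        using puiseux_val_le[OF assms, of "e + v"] by (cases "pcoeff c (e + v) = 0") (auto simp: v_def)
      then show ?thesis using 2
        by (simp add: pcoeff_minus
            pcoeff_pmonom_times one_puiseux.rep_eq)
    qed
    then show False using that by simp
  qed
  from puiseux_geometric[OF this] obtain y where "(1 - (1 - ?m * c)) * y = 1" by blast
  then have "c * (?m * y) = 1" by (simp add: algebra_simps)
  then show ?thesis by blast
qed

instantiation puiseux :: field
begin

definition inverse_puiseux :: "puiseux \<Rightarrow> puiseux" where
  "inverse_puiseux c = (if c = 0 then 0 else (SOME d. c * d = 1))"

definition divide_puiseux :: "puiseux \<Rightarrow> puiseux \<Rightarrow> puiseux" where
  "divide_puiseux a b = a * inverse b"

instance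
proof
  fix a b :: puiseux
  show "inverse a * a = 1" if "a \<noteq> 0"
    using someI_ex[OF puiseux_inverse_exists[OF that]] that
    by (simp add: inverse_puiseux_def mult.commute)
qed (auto simp: inverse_puiseux_def divide_puiseux_def)

end


section \<open>Dual numbers\<close>

text \<open>The ring \<open>R[\<epsilon>]/(\<epsilon>\<^sup>2)\<close>; \<open>Dual a b\<close> stands for \<open>a + b\<epsilon>\<close>.\<close>

datatype 'a dual_num = Dual (dual_re: 'a) (dual_eps: 'a)

instantiation dual_num :: (comm_ring_1) comm_ring_1
begin

definition "0 = Dual 0 0"
definition "1 = Dual 1 0"
definition "x + y = Dual (dual_re x + dual_re y) (dual_eps x + dual_eps y)"
definition "- x = Dual (- dual_re x) (- dual_eps x)"
definition "x - y = Dual (dual_re x - dual_re y) (dual_eps x - dual_eps y)"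
definition "x * y = Dual (dual_re x * dual_re y) (dual_re x * dual_eps y + dual_eps x * dual_re y)"

instance
  by standard
    (auto simp: zero_dual_num_def one_dual_num_def plus_dual_num_def uminus_dual_num_def
      minus_dual_num_def times_dual_num_def algebra_simps)

end


section \<open>Matrix groups\<close>

text \<open>Rows, columns and simple reflections are numbered from \<open>0\<close>, so simple reflections are
  indexed by \<open>i\<close> with \<open>Suc i < n\<close>. The groups below are defined over an arbitrary commutative ring
  because they are needed both over a field \<open>K\<close> and over \<open>K[\<epsilon>]\<close>.\<close>

definition GL :: "nat \<Rightarrow> 'a::comm_ring_1 mat set" where
  "GL n = {A \<in> carrier_mat n n. invertible_mat A}"

definition borel_up :: "nat \<Rightarrow> 'a::comm_ring_1 mat set" where
  "borel_up n = {A \<in> GL n. upper_triangular A}"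

definition borel_low :: "nat \<Rightarrow> 'a::comm_ring_1 mat set" where
  "borel_low n = {A \<in> GL n. upper_triangular (transpose_mat A)}"

definition unipotent_up :: "nat \<Rightarrow> 'a::comm_ring_1 mat set" where
  "unipotent_up n = {A \<in> borel_up n. \<forall>i<n. A $$ (i, i) = 1}"

definition torus :: "nat \<Rightarrow> 'a::comm_ring_1 mat set" where
  "torus n = {A \<in> GL n. diagonal_mat A}"

definition sl2_embed :: "nat \<Rightarrow> nat \<Rightarrow> 'a::comm_ring_1 mat \<Rightarrow> 'a mat" where
  "sl2_embed n i A = mat n n (\<lambda>(r, s).
     if r \<in> {i, Suc i} \<and> s \<in> {i, Suc i} then A $$ (r - i, s - i) else if r = s then 1 else 0)"

definition y_mat :: "nat \<Rightarrow> nat \<Rightarrow> 'a::comm_ring_1 \<Rightarrow> 'a mat" where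
  "y_mat n i z = sl2_embed n i (mat_of_rows_list 2 [[1, 0], [z, 1]])"

definition s_bar :: "nat \<Rightarrow> nat \<Rightarrow> 'a::comm_ring_1 mat" where
  "s_bar n i = sl2_embed n i (mat_of_rows_list 2 [[0, -1], [1, 0]])"

definition mat_prod :: "nat \<Rightarrow> 'a::comm_ring_1 mat list \<Rightarrow> 'a mat" where
  "mat_prod n As = foldr (*) As (1\<^sub>m n)"


section \<open>Reduced expressions and positive roots\<close>

definition word_perm :: "nat list \<Rightarrow> nat \<Rightarrow> nat" where
  "word_perm iw = foldr (\<lambda>i w. transpose i (Suc i) \<circ> w) iw id"

definition simple_word :: "nat \<Rightarrow> nat list \<Rightarrow> bool" where
  "simple_word n iw \<longleftrightarrow> (\<forall>i\<in>set iw. Suc i < n)"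

definition reduced_word :: "nat \<Rightarrow> nat list \<Rightarrow> bool" where
  "reduced_word n iw \<longleftrightarrow> simple_word n iw \<and>
     (\<forall>jw. simple_word n jw \<and> word_perm jw = word_perm iw \<longrightarrow> length iw \<le> length jw)"

definition longest_perm :: "nat \<Rightarrow> nat \<Rightarrow> nat" where
  "longest_perm n k = (if k < n then n - 1 - k else k)"

definition reduced_w0 :: "nat \<Rightarrow> nat list \<Rightarrow> bool" where
  "reduced_w0 n iw \<longleftrightarrow> reduced_word n iw \<and> word_perm iw = longest_perm n"

text \<open>The pair \<open>(i, j)\<close> with \<open>i < j < n\<close> encodes the positive root \<open>\<epsilon>\<^sub>i - \<epsilon>\<^sub>j\<close>, on which a permutation
  \<open>w\<close> acts by \<open>(i, j) \<mapsto> (w i, w j)\<close>.\<close>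

definition pos_roots :: "nat \<Rightarrow> (nat \<times> nat) set" where
  "pos_roots n = {(i, j). i < j \<and> j < n}"

definition word_root :: "nat list \<Rightarrow> nat \<Rightarrow> nat \<times> nat" where
  "word_root iw k = (let w = word_perm (take k iw) in (w (iw ! k), w (Suc (iw ! k))))"


section \<open>The variety \<open>Z\<close>, the highest weight map and the superpotential\<close>

text \<open>The product of the \<open>s_bar n i\<close> along a reduced expression of the longest element does not
  depend on that expression.\<close>

definition w0_bar :: "nat \<Rightarrow> 'a::comm_ring_1 mat" where
  "w0_bar n = mat_prod n (map (s_bar n) (SOME iw. reduced_w0 n iw))"

definition Z_var :: "nat \<Rightarrow> 'a::comm_ring_1 mat set" where
  "Z_var n = borel_low n \<inter> {x * w0_bar n * y |x y. x \<in> borel_up n \<and> y \<in> borel_up n}"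

definition Z_factors :: "nat \<Rightarrow> 'a::comm_ring_1 mat \<Rightarrow> 'a mat \<Rightarrow> 'a mat \<Rightarrow> 'a mat \<Rightarrow> bool" where
  "Z_factors n b u1 d u2 \<longleftrightarrow> u1 \<in> unipotent_up n \<and> d \<in> torus n \<and> u2 \<in> unipotent_up n \<and>
     b = u1 * d * w0_bar n * u2"

definition superchar :: "nat \<Rightarrow> 'a::comm_ring_1 mat \<Rightarrow> 'a" where
  "superchar n u = (\<Sum>i<n - 1. u $$ (i, Suc i))"

definition hw :: "nat \<Rightarrow> 'a::comm_ring_1 mat \<Rightarrow> 'a mat" where
  "hw n b = (THE d. \<exists>u1 u2. Z_factors n b u1 d u2)"

definition superpotential :: "nat \<Rightarrow> 'a::comm_ring_1 mat \<Rightarrow> 'a" where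
  "superpotential n b = (THE w. \<exists>u1 d u2. Z_factors n b u1 d u2 \<and> w = superchar n u1 + superchar n u2)"

definition Z_fibre :: "nat \<Rightarrow> 'a::comm_ring_1 mat \<Rightarrow> 'a mat set" where
  "Z_fibre n d = {b \<in> Z_var n. hw n b = d}"

text \<open>Tangent vectors of \<open>Z_fibre n d\<close> at \<open>b\<close> are the points of \<open>Z_fibre n d\<close> with coordinates in
  \<open>K[\<epsilon>]\<close> that reduce to \<open>b\<close> modulo \<open>\<epsilon>\<close>. The differential of the superpotential at \<open>b\<close> sends such a
  point to the \<open>\<epsilon>\<close>-part of the value of the superpotential there, and \<open>b\<close> is a critical point iff
  this differential vanishes.\<close>

definition tangent_vectors :: "nat \<Rightarrow> 'a::field mat \<Rightarrow> 'a mat \<Rightarrow> 'a dual_num mat set" where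
  "tangent_vectors n d b =
     {b' \<in> Z_fibre n (map_mat (\<lambda>x. Dual x 0) d). map_mat dual_re b' = b}"

definition critical_points :: "nat \<Rightarrow> 'a::field mat \<Rightarrow> 'a mat set" where
  "critical_points n d =
     {b \<in> Z_fibre n d. \<forall>b'\<in>tangent_vectors n d b. dual_eps (superpotential n b') = 0}"


section \<open>Ideal coordinates and the totally positive part\<close>

text \<open>For the diagonal entry in row \<open>r\<close> put \<open>j = n - 1 - r\<close>.\<close>

definition t_R :: "nat \<Rightarrow> 'a::field mat \<Rightarrow> (nat \<times> nat \<Rightarrow> 'a) \<Rightarrow> 'a mat" where
  "t_R n d m = mat_diag n (\<lambda>r. let j = n - 1 - r in
     d $$ (j, j) * (\<Prod>l<j. m (l, j)) / (\<Prod>l\<in>{j<..<n}. m (j, l)))"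

definition ideal_chart ::
  "nat \<Rightarrow> nat list \<Rightarrow> 'a::field mat \<Rightarrow> (nat \<times> nat \<Rightarrow> 'a) \<Rightarrow> 'a mat" where
  "ideal_chart n iw d m =
     mat_prod n (map (\<lambda>k. y_mat n (iw ! k) (1 / m (word_root iw k))) [0..<length iw]) * t_R n d m"

definition t_pow :: "nat \<Rightarrow> (nat \<Rightarrow> real) \<Rightarrow> puiseux mat" where
  "t_pow n lam = mat_diag n (\<lambda>i. pmonom 1 (lam i))"

text \<open>The image of the totally positive points under the ideal chart is the same for all reduced
  expressions.\<close>

definition Z_pos :: "nat \<Rightarrow> (nat \<Rightarrow> real) \<Rightarrow> puiseux mat set" where
  "Z_pos n lam = {ideal_chart n iw (t_pow n lam) m |iw m.
     reduced_w0 n iw \<and> m \<in> pos_roots n \<rightarrow>\<^sub>E puiseux_pos}"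

definition trop_point :: "nat \<Rightarrow> (nat \<times> nat \<Rightarrow> puiseux) \<Rightarrow> nat \<times> nat \<Rightarrow> real" where
  "trop_point n m = (\<lambda>\<alpha>\<in>pos_roots n. puiseux_val (m \<alpha>))"

end

theory Submission
  imports Defs
begin

text \<open>
  Write \<open>p = u\<^sub>1 d w\<^sub>0 u\<^sub>2\<close>. Evaluating the superpotential on the tangent vectors of \<open>p\<close> over the
  dual numbers turns criticality into the vanishing of a trace pairing, which says that
  \<open>u\<^sub>2\<^sup>-\<^sup>1 (F + E - h) u\<^sub>2 = F\<close> for the lower shift matrix \<open>F\<close>, \<open>E = (d w\<^sub>0)\<^sup>-\<^sup>1 F d w\<^sub>0\<close> and some
  diagonal \<open>h\<close>. Then \<open>p F p\<^sup>-\<^sup>1\<close> agrees with \<open>F\<close> below the diagonal and is strictly lower triangular, so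
  \<open>p\<close> commutes with \<open>F\<close>: it is a Toeplitz matrix.

  For the reduced expression \<open>(s\<^sub>0 \<cdots> s\<^bsub>n-2\<^esub>)(s\<^sub>0 \<cdots> s\<^bsub>n-3\<^esub>) \<cdots> s\<^sub>0\<close> the coordinates of a Toeplitz matrix
  satisfy subtraction-free relations, whose tropicalisation says that the valuation at a positive
  root \<open>\<alpha>\<close> is the minimum of the valuations of the inverse coordinates at the simple roots occurring
  in \<open>\<alpha>\<close>. A function \<open>g\<close> on positive roots of this shape satisfies
  \<open>g(\<alpha> + \<beta>) = min (g \<alpha>) (g \<beta>)\<close>, and for such \<open>g\<close> the tropical braid move, which replaces
  \<open>(a, b, c)\<close> by \<open>(b + c - min a c, min a c, a + b - min a c)\<close>, merely permutes the values
  \<open>(g \<alpha>, g (\<alpha> + \<beta>), g \<beta>)\<close>. Since any two reduced expressions of the longest element are related by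
  braid moves, the valuations attached to the roots are the same for all of them.
\<close>

section \<open>Reduced words and braid moves\<close>

abbreviation sw :: "nat \<Rightarrow> nat \<Rightarrow> nat" where "sw i \<equiv> transpose i (Suc i)"

lemma word_perm_Nil [simp]: "word_perm [] = id"
  and word_perm_Cons [simp]: "word_perm (i # iw) = sw i \<circ> word_perm iw"
  by (simp_all add: word_perm_def)

lemma word_perm_append: "word_perm (iw @ jw) = word_perm iw \<circ> word_perm jw"
  by (induction iw) (simp_all add: o_assoc)

lemma sw_sw_comp [simp]: "sw i \<circ> (sw i \<circ> f) = f"
  by (simp add: o_assoc)

text \<open>The roots of a word as a list peeled from the left, whereas \<open>word_root\<close>
  needs the permutation of a prefix. Induction on the word can thus pass to the tail.\<close>

fun word_roots :: "nat list \<Rightarrow> (nat \<times> nat) list" where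
  "word_roots [] = []"
| "word_roots (i # iw) = (i, Suc i) # map (map_prod (sw i) (sw i)) (word_roots iw)"

lemma length_word_roots [simp]: "length (word_roots iw) = length iw"
  by (induction iw) auto

lemma word_root_eq_nth: "k < length iw \<Longrightarrow> word_root iw k = word_roots iw ! k"
proof (induction iw arbitrary: k)
  case (Cons i iw)
  show ?case
  proof (cases k)
    case (Suc l)
    with Cons have "word_root iw l = word_roots iw ! l" by simp
    then have "word_roots iw ! l = (word_perm (take l iw) (iw ! l), word_perm (take l iw) (Suc (iw ! l)))"
      by (simp add: word_root_def Let_def)
    with Suc Cons.prems show ?thesis by (simp add: word_root_def Let_def)
  qed (simp add: word_root_def)
qed simp

lemma word_perm_rev_inverse: "word_perm (rev iw) \<circ> word_perm iw = id"
  by (induction iw) (simp_all add: word_perm_append o_assoc[symmetric])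

lemma word_perm_inverse_rev: "word_perm iw \<circ> word_perm (rev iw) = id"
  using word_perm_rev_inverse[of "rev iw"] by simp

lemma word_perm_rev_cong:
  assumes "word_perm iw = word_perm jw"
  shows "word_perm (rev iw) = word_perm (rev jw)"
  by (metis assms comp_assoc comp_id id_comp word_perm_inverse_rev word_perm_rev_inverse)

lemma inj_word_perm: "inj (word_perm iw)"
  by (metis inj_on_id inj_on_imageI2 word_perm_rev_inverse)

lemma word_perm_rev_Cons [simp]: "word_perm (rev (i # iw)) = word_perm (rev iw) \<circ> sw i"
  by (simp add: word_perm_append)

section \<open>Inversions and the exchange condition\<close>

lemma sw_less: "x < y \<Longrightarrow> (x, y) \<noteq> (i, Suc i) \<Longrightarrow> sw i x < sw i y"
  by (auto simp: transpose_def)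

text \<open>The only ordered pair that \<open>sw i\<close> reverses is \<open>(i, Suc i)\<close>. An
  inversion of the inverse permutation, which is \<open>word_perm (rev iw)\<close>, is therefore
  this simple root or gives an inversion for the tail.\<close>

lemma inversion_in_word_roots:
  assumes "x < y" "word_perm (rev iw) y < word_perm (rev iw) x"
  shows "(x, y) \<in> set (word_roots iw)"
  using assms
proof (induction iw arbitrary: x y)
  case (Cons i iw)
  show ?case
  proof (cases "(x, y) = (i, Suc i)")
    case False
    then have "(sw i x, sw i y) \<in> set (word_roots iw)"
      using Cons sw_less by (simp del: rev.simps)
    then have "map_prod (sw i) (sw i) (sw i x, sw i y) \<in> set (word_roots (i # iw))"
      by (metis image_eqI list.set_intros(2) list.set_map word_roots.simps(2))
    then show ?thesis by simp
  qed simp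
qed simp

text \<open>Strong exchange: deleting the letter at which the root \<open>(x, y)\<close> occurs
  multiplies the permutation by the reflection in that root. Conjugating the reflection by
  \<open>sw i\<close> carries the claim from the tail to the whole word.\<close>

lemma word_roots_conj:
  assumes "(x, y) \<in> set (word_roots iw)"
  shows "\<exists>jw. Suc (length jw) = length iw \<and> set jw \<subseteq> set iw \<and>
    word_perm jw = transpose x y \<circ> word_perm iw"
  using assms
proof (induction iw arbitrary: x y)
  case (Cons i iw)
  show ?case
  proof (cases "(x, y) = (i, Suc i)")
    case True
    then show ?thesis by (intro exI[of _ iw]) auto
  next
    case False
    with Cons.prems obtain a b where ab: "(a, b) \<in> set (word_roots iw)" "x = sw i a" "y = sw i b"
      by auto
    from Cons.IH[OF ab(1)] obtain jw where jw: "Suc (length jw) = length iw" "set jw \<subseteq> set iw"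
      "word_perm jw = transpose a b \<circ> word_perm iw" by blast
    have "transpose x y \<circ> sw i = sw i \<circ> transpose a b"
      unfolding ab(2,3) by (auto simp: fun_eq_iff transpose_def)
    then have "word_perm (i # jw) = transpose x y \<circ> word_perm (i # iw)"
      by (simp add: jw(3) o_assoc)
    with jw show ?thesis by (intro exI[of _ "i # jw"]) auto
  qed
qed simp

lemma simple_word_Nil [simp]: "simple_word n []"
  and simple_word_Cons [simp]: "simple_word n (i # iw) \<longleftrightarrow> Suc i < n \<and> simple_word n iw"
  by (auto simp: simple_word_def)

lemma reduced_wordD:
  "reduced_word n iw \<Longrightarrow> simple_word n jw \<Longrightarrow> word_perm jw = word_perm iw \<Longrightarrow> length iw \<le> length jw"
  by (simp add: reduced_word_def)

lemma reduced_word_simple: "reduced_word n iw \<Longrightarrow> simple_word n iw"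
  by (simp add: reduced_word_def)

lemma reduced_word_length_cong:
  "reduced_word n iw \<Longrightarrow> reduced_word n jw \<Longrightarrow> word_perm iw = word_perm jw \<Longrightarrow> length iw = length jw"
  by (metis le_antisym reduced_word_def)

lemma reduced_word_transfer:
  "reduced_word n iw \<Longrightarrow> simple_word n jw \<Longrightarrow> word_perm jw = word_perm iw \<Longrightarrow>
    length jw = length iw \<Longrightarrow> reduced_word n jw"
  by (simp add: reduced_word_def)

lemma reduced_word_ConsD: "reduced_word n (i # iw) \<Longrightarrow> reduced_word n iw"
  unfolding reduced_word_def by (metis Suc_le_mono length_Cons simple_word_Cons word_perm_Cons)

text \<open>Otherwise strong exchange would spell the permutation of \<open>i # iw\<close> with two
  letters fewer.\<close>

lemma reduced_word_Cons_ascent: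
  assumes "reduced_word n (i # iw)"
  shows "(i, Suc i) \<notin> set (word_roots iw)"
proof
  assume "(i, Suc i) \<in> set (word_roots iw)"
  from word_roots_conj[OF this] obtain jw where jw: "Suc (length jw) = length iw" "set jw \<subseteq> set iw"
    "word_perm jw = sw i \<circ> word_perm iw" by blast
  have "simple_word n jw" using jw(2) assms by (auto simp: reduced_word_def simple_word_def)
  from reduced_wordD[OF assms this] jw show False by simp
qed

text \<open>The descent puts the simple root among the roots of the word; strong exchange deletes
  one letter there, and prefixing \<open>i\<close> restores both the permutation and the
  length.\<close>

lemma reduced_word_exchange:
  assumes red: "reduced_word n iw" and "Suc i < n"
    and desc: "word_perm (rev iw) (Suc i) < word_perm (rev iw) i"
  shows "\<exists>jw. reduced_word n (i # jw) \<and> word_perm (i # jw) = word_perm iw"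
proof -
  have "(i, Suc i) \<in> set (word_roots iw)"
    using desc by (intro inversion_in_word_roots) auto
  from word_roots_conj[OF this] obtain jw where jw: "Suc (length jw) = length iw" "set jw \<subseteq> set iw"
    "word_perm jw = sw i \<circ> word_perm iw" by blast
  then have perm: "word_perm (i # jw) = word_perm iw" by simp
  have "simple_word n (i # jw)" using jw(2) assms by (auto simp: reduced_word_def simple_word_def)
  with perm jw(1) red show ?thesis
    by (intro exI[of _ jw] conjI reduced_word_transfer[OF red]) simp_all
qed

lemma reduced_word_head_descent:
  assumes "reduced_word n (i # iw)"
  shows "word_perm (rev (i # iw)) (Suc i) < word_perm (rev (i # iw)) i"
proof -
  have "\<not> word_perm (rev iw) (Suc i) < word_perm (rev iw) i"
    using reduced_word_Cons_ascent[OF assms] inversion_in_word_roots[of i "Suc i" iw] by auto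
  moreover have "word_perm (rev iw) (Suc i) \<noteq> word_perm (rev iw) i"
    using inj_word_perm[of "rev iw"] by (metis inj_eq n_not_Suc_n)
  ultimately show ?thesis by (simp del: rev.simps)
qed

text \<open>\<open>far\<close> and \<open>near\<close> act at the front of a word with an arbitrary
  tail, and \<open>Cons\<close> moves them inside. Both are closed under exchanging \<open>i\<close>
  and \<open>j\<close>, so the relation is symmetric without a rule for it.\<close>

inductive braid_eq :: "nat list \<Rightarrow> nat list \<Rightarrow> bool" where
  refl: "braid_eq iw iw"
| trans: "braid_eq iw jw \<Longrightarrow> braid_eq jw kw \<Longrightarrow> braid_eq iw kw"
| Cons: "braid_eq iw jw \<Longrightarrow> braid_eq (i # iw) (i # jw)"
| far: "Suc i < j \<or> Suc j < i \<Longrightarrow> braid_eq (i # j # iw) (j # i # iw)"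
| near: "j = Suc i \<or> i = Suc j \<Longrightarrow> braid_eq (i # j # i # iw) (j # i # j # iw)"

text \<open>Matsumoto's theorem. The first letters \<open>i\<close> and \<open>j\<close> of the two
  words are both left descents, so the permutation has reduced words that begin with
  \<open>i # j\<close> and \<open>j # i\<close> or, for neighbours, with \<open>i # j # i\<close>
  and \<open>j # i # j\<close>, and continue alike. A braid move joins these two, and the induction
  hypothesis joins each to the given word with the same first letter.\<close>

theorem reduced_words_braid_eq:
  assumes "reduced_word n iw" "reduced_word n jw" "word_perm iw = word_perm jw"
  shows "braid_eq iw jw"
  using assms
proof (induction "length iw" arbitrary: iw jw rule: less_induct)
  case less
  note len = reduced_word_length_cong[OF less.prems]
  show ?case
  proof (cases iw)
    case Nil
    then show ?thesis using len by (simp add: braid_eq.refl)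
  next
    case i: (Cons i iw')
    with len obtain j jw' where j: "jw = j # jw'" by (cases jw) auto
    have red': "reduced_word n iw'" "reduced_word n jw'"
      using less.prems reduced_word_ConsD unfolding i j by blast+
    define u where "u = word_perm (rev iw)"
    have u': "word_perm (rev iw') = u \<circ> sw i"
      by (simp add: u_def i word_perm_append o_assoc[symmetric])
    have desc_i: "u (Suc i) < u i"
      using reduced_word_head_descent less.prems(1) unfolding u_def i by blast
    have desc_j: "u (Suc j) < u j"
      using reduced_word_head_descent less.prems(2) unfolding u_def word_perm_rev_cong[OF less.prems(3)] j
      by blast
    have sj: "Suc j < n" and si: "Suc i < n"
      using reduced_word_simple[OF less.prems(1)] reduced_word_simple[OF less.prems(2)]
      unfolding i j by simp_all
    have IH: "braid_eq vw ww" if "reduced_word n vw" "reduced_word n ww"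
      "word_perm vw = word_perm ww" "length vw < length iw" for vw ww
      using less.hyps[OF that(4)] that(1-3) by blast
    consider "i = j" | "Suc i < j \<or> Suc j < i" | "j = Suc i \<or> i = Suc j" by linarith
    then show ?thesis
    proof cases
      case 1
      have "word_perm iw' = word_perm jw'"
        using less.prems(3) unfolding i j 1 by (metis sw_sw_comp word_perm_Cons)
      then show ?thesis using IH[OF red'] unfolding i j 1 by (simp add: braid_eq.Cons)
    next
      case 2
      have "word_perm (rev iw') (Suc j) < word_perm (rev iw') j"
        using 2 desc_j unfolding u' by (auto simp: transpose_def)
      from reduced_word_exchange[OF red'(1) sj this] obtain k where
        k: "reduced_word n (j # k)" "word_perm (j # k) = word_perm iw'" by blast
      have lk: "length iw' = Suc (length k)"
        using reduced_word_length_cong[OF k(1) red'(1) k(2)] by simp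
      have perm_ij: "sw i \<circ> sw j = sw j \<circ> sw i"
        using 2 by (auto simp: fun_eq_iff transpose_def)
      have e1: "braid_eq iw (i # j # k)"
        unfolding i by (intro braid_eq.Cons IH red' k) (simp_all add: k(2)[symmetric] i)
      have p: "word_perm (j # i # k) = word_perm iw"
      proof -
        have "word_perm (j # i # k) = sw i \<circ> word_perm (j # k)"
          by (simp add: o_assoc perm_ij)
        then show ?thesis unfolding k(2) i by simp
      qed
      have r: "reduced_word n (j # i # k)"
        by (rule reduced_word_transfer[OF less.prems(1)])
          (use p lk reduced_word_simple[OF k(1)] si in \<open>auto simp: i\<close>)
      have "word_perm (i # k) = word_perm jw'"
        using p unfolding less.prems(3) j by (metis sw_sw_comp word_perm_Cons)
      then have "braid_eq (j # i # k) jw"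
        unfolding j by (intro braid_eq.Cons IH red' reduced_word_ConsD[OF r]) (simp_all add: i lk)
      with e1 braid_eq.far[OF 2] show ?thesis by (meson braid_eq.trans)
    next
      case 3
      have d3: "word_perm (rev iw') (Suc j) < word_perm (rev iw') j"
        using 3 desc_i desc_j unfolding u' by (auto simp: transpose_def)
      from reduced_word_exchange[OF red'(1) sj this] obtain k where
        k: "reduced_word n (j # k)" "word_perm (j # k) = word_perm iw'" by blast
      note redk = reduced_word_ConsD[OF k(1)]
      have "word_perm (rev k) = word_perm (rev iw') \<circ> sw j"
        using word_perm_rev_cong[OF k(2)] by (metis comp_assoc comp_id transpose_comp_involutory word_perm_rev_Cons)
      \<comment> \<open>\<open>u\<close> is decreasing on the three neighbouring positions, so
        \<open>i\<close> is again a descent after \<open>i\<close> and \<open>j\<close> have been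
        removed.\<close>
      then have "word_perm (rev k) (Suc i) < word_perm (rev k) i"
        using 3 desc_i desc_j unfolding u' by (auto simp: transpose_def)
      from reduced_word_exchange[OF redk si this] obtain l where
        l: "reduced_word n (i # l)" "word_perm (i # l) = word_perm k" by blast
      have lk: "length iw' = Suc (length k)"
        using reduced_word_length_cong[OF k(1) red'(1) k(2)] by simp
      have ll: "length k = Suc (length l)"
        using reduced_word_length_cong[OF l(1) redk l(2)] by simp
      have e1: "braid_eq iw (i # j # k)"
        unfolding i by (intro braid_eq.Cons IH red' k) (simp_all add: k(2)[symmetric] i)
      have e2: "braid_eq (i # j # k) (i # j # i # l)"
        by (intro braid_eq.Cons IH redk l) (simp_all add: l(2)[symmetric] i lk)
      have perm_ij: "sw i \<circ> sw j \<circ> sw i = sw j \<circ> sw i \<circ> sw j"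
        using 3 by (auto simp: fun_eq_iff transpose_def)
      have p: "word_perm (j # i # j # l) = word_perm iw"
      proof -
        have "word_perm (j # i # j # l) = sw i \<circ> (sw j \<circ> word_perm (i # l))"
          by (simp add: o_assoc perm_ij)
        then show ?thesis unfolding l(2) i using k(2) by simp
      qed
      have r: "reduced_word n (j # i # j # l)"
        by (rule reduced_word_transfer[OF less.prems(1)])
          (use p lk ll reduced_word_simple[OF l(1)] si sj in \<open>auto simp: i\<close>)
      have "word_perm (i # j # l) = word_perm jw'"
        using p unfolding less.prems(3) j by (metis sw_sw_comp word_perm_Cons)
      then have "braid_eq (j # i # j # l) jw"
        unfolding j by (intro braid_eq.Cons IH red' reduced_word_ConsD[OF r]) (simp_all add: i lk ll)
      with e1 e2 braid_eq.near[OF 3] show ?thesis by (meson braid_eq.trans)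
    qed
  qed
qed

section \<open>Valuations and braid moves of positive parameters\<close>

lemma puiseux_valI:
  assumes "pcoeff c v \<noteq> 0" "\<And>e. e < v \<Longrightarrow> pcoeff c e = 0"
  shows "c \<noteq> 0" "puiseux_val c = v"
proof -
  show "c \<noteq> 0" using assms(1) by (auto simp: zero_puiseux.rep_eq)
  from puiseux_val[OF this] assms show "puiseux_val c = v"
    by (metis linorder_not_less order_le_less)
qed

lemma pcoeff_below_val: "e < puiseux_val c \<Longrightarrow> pcoeff c e = 0"
  by (metis linorder_not_less puiseux_val_le zero_puiseux.rep_eq)

text \<open>Only the two leading terms meet at this exponent: in any other pair with the same sum,
  one exponent lies below its valuation.\<close>

lemma pcoeff_mult_val:
  "pcoeff (a * b) (puiseux_val a + puiseux_val b) = pcoeff a (puiseux_val a) * pcoeff b (puiseux_val b)"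
proof -
  have "x = puiseux_val a" if "pcoeff a x \<noteq> 0" "pcoeff b (puiseux_val a + puiseux_val b - x) \<noteq> 0" for x
    using that pcoeff_below_val[of x a] pcoeff_below_val[of "puiseux_val a + puiseux_val b - x" b]
    by force
  then show ?thesis by (subst pcoeff_times[of "{puiseux_val a}"]) auto
qed

lemma pcoeff_mult_below:
  assumes "e < puiseux_val a + puiseux_val b"
  shows "pcoeff (a * b) e = 0"
proof -
  have "pcoeff b (e - x) = 0" if "pcoeff a x \<noteq> 0" for x
    using that pcoeff_below_val[of x a] assms by (intro pcoeff_below_val) force
  then show ?thesis by (subst pcoeff_times[of "{}"]) auto
qed

lemma puiseux_val_mult:
  assumes "a \<noteq> 0" "b \<noteq> 0"
  shows "puiseux_val (a * b) = puiseux_val a + puiseux_val b"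
  using assms by (intro puiseux_valI) (auto simp: pcoeff_mult_val pcoeff_puiseux_val pcoeff_mult_below)

lemma puiseux_pos_nonzero: "c \<in> puiseux_pos \<Longrightarrow> c \<noteq> 0"
  by (simp add: puiseux_pos_def)

lemma puiseux_pos_mult: "a \<in> puiseux_pos \<Longrightarrow> b \<in> puiseux_pos \<Longrightarrow> a * b \<in> puiseux_pos"
  unfolding puiseux_pos_def
  by (auto simp: puiseux_val_mult pcoeff_mult_val) (metis mult_pos_pos of_real_mult)

lemma puiseux_val_one [simp]: "puiseux_val 1 = 0"
  by (rule puiseux_valI) (auto simp: one_puiseux.rep_eq)

lemma puiseux_pos_one: "1 \<in> puiseux_pos"
  by (auto simp: puiseux_pos_def one_puiseux.rep_eq intro!: exI[of _ 1])

lemma puiseux_val_inverse: "a \<noteq> 0 \<Longrightarrow> puiseux_val (inverse a) = - puiseux_val a"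
  using puiseux_val_mult[of a "inverse a"] by simp

lemma puiseux_val_divide: "a \<noteq> 0 \<Longrightarrow> b \<noteq> 0 \<Longrightarrow> puiseux_val (a / b) = puiseux_val a - puiseux_val b"
  by (simp add: divide_inverse puiseux_val_mult puiseux_val_inverse)

lemma puiseux_pos_inverse:
  assumes "a \<in> puiseux_pos"
  shows "inverse a \<in> puiseux_pos"
proof -
  have a: "a \<noteq> 0" using assms by (rule puiseux_pos_nonzero)
  obtain r where r: "r > 0" "pcoeff a (puiseux_val a) = complex_of_real r"
    using assms by (auto simp: puiseux_pos_def)
  have "complex_of_real r * pcoeff (inverse a) (puiseux_val (inverse a)) = 1"
    using pcoeff_mult_val[of a "inverse a"] a by (simp add: r puiseux_val_inverse one_puiseux.rep_eq)
  then have "pcoeff (inverse a) (puiseux_val (inverse a)) = complex_of_real (1 / r)"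
    using r(1) by (simp add: field_simps)
  then show ?thesis using a r(1) by (auto simp: puiseux_pos_def intro!: exI[of _ "1 / r"])
qed

lemma puiseux_pos_divide: "a \<in> puiseux_pos \<Longrightarrow> b \<in> puiseux_pos \<Longrightarrow> a / b \<in> puiseux_pos"
  by (simp add: divide_inverse puiseux_pos_mult puiseux_pos_inverse)

text \<open>Positive leading coefficients cannot cancel, whether or not the valuations agree. This
  turns subtraction-free identities into min-plus identities.\<close>

lemma
  assumes "a \<in> puiseux_pos" "b \<in> puiseux_pos"
  shows puiseux_val_add_pos: "puiseux_val (a + b) = min (puiseux_val a) (puiseux_val b)" (is ?A)
    and puiseux_pos_add: "a + b \<in> puiseux_pos" (is ?B)
proof -
  let ?v = "min (puiseux_val a) (puiseux_val b)"
  obtain r s where r: "r > 0" "pcoeff a (puiseux_val a) = complex_of_real r"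
    and s: "s > 0" "pcoeff b (puiseux_val b) = complex_of_real s"
    using assms by (auto simp: puiseux_pos_def)
  have "\<exists>q>0. pcoeff (a + b) ?v = complex_of_real q"
  proof (cases "puiseux_val a" "puiseux_val b" rule: linorder_cases)
    case equal
    then show ?thesis using r s by (auto simp: plus_puiseux.rep_eq intro!: exI[of _ "r + s"])
  qed (use r s in \<open>auto simp: plus_puiseux.rep_eq pcoeff_below_val\<close>)
  then obtain q where q: "q > 0" "pcoeff (a + b) ?v = complex_of_real q" by blast
  have *: "a + b \<noteq> 0" "puiseux_val (a + b) = ?v"
    using q puiseux_valI[of "a + b" ?v] by (auto simp: plus_puiseux.rep_eq pcoeff_below_val)
  then show ?A ?B using q by (auto simp: puiseux_pos_def)
qed

lemma
  assumes "finite I" "\<And>i. i \<in> I \<Longrightarrow> f i \<in> puiseux_pos"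
  shows puiseux_pos_prod: "prod f I \<in> puiseux_pos" (is ?A)
    and puiseux_val_prod: "puiseux_val (prod f I) = (\<Sum>i\<in>I. puiseux_val (f i))" (is ?B)
proof -
  have "?A \<and> ?B" using assms
    by (induction I) (auto simp: puiseux_pos_one puiseux_pos_mult puiseux_val_mult puiseux_pos_nonzero)
  then show ?A ?B by auto
qed

section \<open>Products of the one-parameter lower unipotent matrices\<close>

lemma mult_mat_index:
  assumes "A \<in> carrier_mat l m" "B \<in> carrier_mat m n" "i < l" "j < n"
  shows "(A * B) $$ (i, j) = (\<Sum>k<m. A $$ (i, k) * B $$ (k, j))"
  using assms by (auto simp: scalar_prod_def atLeast0LessThan intro: sum.cong)

lemma y_mat_carrier [simp]: "y_mat n i z \<in> carrier_mat n n"
  by (simp add: y_mat_def sl2_embed_def)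

lemma y_mat_dim [simp]: "dim_row (y_mat n i z) = n" "dim_col (y_mat n i z) = n"
  by (simp_all add: y_mat_def sl2_embed_def)

lemma y_mat_index:
  "r < n \<Longrightarrow> s < n \<Longrightarrow> y_mat n i z $$ (r, s) = of_bool (r = s) + (if r = Suc i \<and> s = i then z else 0)"
  by (auto simp: y_mat_def sl2_embed_def mat_of_rows_list_def)

lemma y_mat_mult_index:
  assumes "Suc i < n" "A \<in> carrier_mat n n" "r < n" "s < n"
  shows "(y_mat n i z * A) $$ (r, s) = A $$ (r, s) + (if r = Suc i then z * A $$ (i, s) else 0)"
proof -
  have "(y_mat n i z * A) $$ (r, s) = (\<Sum>k<n. y_mat n i z $$ (r, k) * A $$ (k, s))"
    by (rule mult_mat_index) (use assms in auto)
  also have "\<dots> = (\<Sum>k<n. of_bool (r = k) * A $$ (k, s)) + (\<Sum>k<n. of_bool (i = k) * (if r = Suc i then z * A $$ (k, s) else 0))"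
    unfolding sum.distrib[symmetric] using assms
    by (intro sum.cong) (auto simp: y_mat_index algebra_simps)
  also have "\<dots> = A $$ (r, s) + (if r = Suc i then z * A $$ (i, s) else 0)"
    using assms by (simp add: of_bool_def if_distribR if_distrib[of "\<lambda>x. x * _"] cong: if_cong)
  finally show ?thesis .
qed

definition y_word :: "nat \<Rightarrow> nat list \<Rightarrow> 'a::comm_ring_1 list \<Rightarrow> 'a mat" where
  "y_word n iw as = mat_prod n (map2 (y_mat n) iw as)"

lemma y_word_Nil [simp]: "y_word n [] [] = 1\<^sub>m n"
  and y_word_Cons [simp]: "y_word n (i # iw) (a # as) = y_mat n i a * y_word n iw as"
  by (simp_all add: y_word_def mat_prod_def)

lemma y_word_carrier [simp]: "y_word n iw as \<in> carrier_mat n n"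
proof -
  have "foldr (*) As (1\<^sub>m n) \<in> carrier_mat n n" if "set As \<subseteq> carrier_mat n n" for As :: "'a mat list"
    using that by (induction As) auto
  moreover have "set (map2 (y_mat n) iw as) \<subseteq> carrier_mat n n" by auto
  ultimately show ?thesis unfolding y_word_def mat_prod_def .
qed

lemma y_mat_far:
  assumes "Suc i < j \<or> Suc j < i" "Suc i < n" "Suc j < n" "A \<in> carrier_mat n n"
  shows "y_mat n i a * (y_mat n j b * A) = y_mat n j b * (y_mat n i a * A)"
proof -
  have C: "y_mat n k z * A \<in> carrier_mat n n" for k z
    using assms(4) y_mat_carrier by (metis mult_carrier_mat)
  show ?thesis
  proof (rule eq_matI)
    fix r s assume "r < dim_row (y_mat n j b * (y_mat n i a * A))" "s < dim_col (y_mat n j b * (y_mat n i a * A))"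
    then have rs: "r < n" "s < n" using C y_mat_carrier[of n j b] assms(4) by auto
    show "(y_mat n i a * (y_mat n j b * A)) $$ (r, s) = (y_mat n j b * (y_mat n i a * A)) $$ (r, s)"
      using rs assms C by (auto simp: y_mat_mult_index simp del: index_mult_mat(1))
  qed (use assms(4) y_mat_carrier in auto)
qed

text \<open>With the middle parameter written as \<open>q * (a + c)\<close>, the rank two transition
  formula has no denominators and can be checked entry by entry. \<open>y_mat_near\<close> sets
  \<open>q = b / (a + c)\<close>.\<close>

lemma y_mat_near_aux:
  fixes a q c :: "'a::comm_ring_1"
  assumes "j = Suc i \<or> i = Suc j" "Suc i < n" "Suc j < n" "A \<in> carrier_mat n n"
  shows "y_mat n i a * (y_mat n j (q * (a + c)) * (y_mat n i c * A)) =
    y_mat n j (q * c) * (y_mat n i (a + c) * (y_mat n j (q * a) * A))" (is "?L = ?R")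
proof -
  have C: "y_mat n k z * M \<in> carrier_mat n n" if "M \<in> carrier_mat n n" for k z and M :: "'a mat"
    using that y_mat_carrier by (metis mult_carrier_mat)
  note C' = C[OF C[OF assms(4)]] C[OF assms(4)]
  show ?thesis
  proof (rule eq_matI)
    fix r s assume "r < dim_row ?R" "s < dim_col ?R"
    then have rs: "r < n" "s < n" using assms(4) by auto
    show "?L $$ (r, s) = ?R $$ (r, s)"
      using assms(1)
    proof
      assume j: "j = Suc i"
      show ?thesis
        using rs assms(2-4) C' unfolding j by (simp add: y_mat_mult_index algebra_simps del: index_mult_mat(1))
    next
      assume i: "i = Suc j"
      show ?thesis
        using rs assms(2-4) C' unfolding i by (simp add: y_mat_mult_index algebra_simps del: index_mult_mat(1))
    qed
  qed (use assms(4) in auto)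
qed

lemma y_mat_near:
  fixes a b c :: "'a::field"
  assumes "j = Suc i \<or> i = Suc j" "Suc i < n" "Suc j < n" "A \<in> carrier_mat n n" "a + c \<noteq> 0"
  shows "y_mat n i a * (y_mat n j b * (y_mat n i c * A)) =
    y_mat n j (b * c / (a + c)) * (y_mat n i (a + c) * (y_mat n j (a * b / (a + c)) * A))"
  using y_mat_near_aux[OF assms(1-4), of a "b / (a + c)" c] assms(5) by (simp add: mult.commute)

section \<open>Valuations under braid moves\<close>

lemma braid_eq_simple: "braid_eq iw jw \<Longrightarrow> simple_word n iw \<longleftrightarrow> simple_word n jw"
  by (induction rule: braid_eq.induct) auto

lemma braid_eq_roots: "braid_eq iw jw \<Longrightarrow> set (word_roots iw) = set (word_roots jw)"
proof (induction rule: braid_eq.induct)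
  case (far i j iw)
  then have "map_prod (sw i) (sw i) \<circ> map_prod (sw j) (sw j) = map_prod (sw j) (sw j) \<circ> map_prod (sw i) (sw i)"
    by (auto simp: fun_eq_iff transpose_def)
  with far show ?case by (auto simp: image_comp)
next
  case (near j i iw)
  then have "map_prod (sw i) (sw i) \<circ> (map_prod (sw j) (sw j) \<circ> map_prod (sw i) (sw i)) =
      map_prod (sw j) (sw j) \<circ> (map_prod (sw i) (sw i) \<circ> map_prod (sw j) (sw j))"
    by (auto simp: fun_eq_iff transpose_def)
  with near show ?case by (auto simp: image_comp)
qed auto

text \<open>The pair \<open>(x, z)\<close> is the sum of the roots \<open>(x, y)\<close> and
  \<open>(y, z)\<close>. The condition is relative to a set \<open>R\<close> so that, after a
  reflection, it passes from the roots of a word to those of its tail.\<close>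

definition min_closed_on :: "(nat \<times> nat) set \<Rightarrow> (nat \<times> nat \<Rightarrow> real) \<Rightarrow> bool" where
  "min_closed_on R g \<longleftrightarrow> (\<forall>x y z. (x, y) \<in> R \<longrightarrow> (y, z) \<in> R \<longrightarrow> (x, z) \<in> R \<longrightarrow>
     g (x, z) = min (g (x, y)) (g (y, z)))"

text \<open>The list \<open>bs\<close> is fixed before \<open>g\<close>, and \<open>g\<close> is
  arbitrary because prefixing a letter \<open>i\<close> replaces it on the tail by its composite
  with \<open>sw i\<close>. The equivalence allows going back from a word with known valuations to
  the original one.\<close>

lemma braid_transport:
  assumes "braid_eq iw jw" "simple_word n iw" "length as = length iw" "set as \<subseteq> puiseux_pos"
  shows "\<exists>bs. length bs = length jw \<and> set bs \<subseteq> puiseux_pos \<and> y_word n iw as = y_word n jw bs \<and>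
    (\<forall>g. min_closed_on (set (word_roots iw)) g \<longrightarrow>
      (map puiseux_val as = map g (word_roots iw) \<longleftrightarrow> map puiseux_val bs = map g (word_roots jw)))"
  using assms
proof (induction arbitrary: as rule: braid_eq.induct)
  case (refl iw)
  then show ?case by blast
next
  case (trans iw jw kw)
  from trans.IH(1)[OF trans.prems] obtain bs where bs: "length bs = length jw" "set bs \<subseteq> puiseux_pos"
    "y_word n iw as = y_word n jw bs"
    "\<And>g. min_closed_on (set (word_roots iw)) g \<Longrightarrow>
      (map puiseux_val as = map g (word_roots iw) \<longleftrightarrow> map puiseux_val bs = map g (word_roots jw))"
    by blast
  have "simple_word n jw" using braid_eq_simple trans by blast
  from trans.IH(2)[OF this bs(1,2)] obtain cs where "length cs = length kw" "set cs \<subseteq> puiseux_pos"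
    "y_word n jw bs = y_word n kw cs"
    "\<And>g. min_closed_on (set (word_roots jw)) g \<Longrightarrow>
      (map puiseux_val bs = map g (word_roots jw) \<longleftrightarrow> map puiseux_val cs = map g (word_roots kw))"
    by blast
  then show ?case using bs braid_eq_roots[OF trans.hyps(1)] by (intro exI[of _ cs]) simp
next
  case (Cons iw jw i)
  from Cons.prems obtain a as' where as: "as = a # as'" by (cases as) auto
  have "simple_word n iw" "length as' = length iw" "set as' \<subseteq> puiseux_pos"
    using Cons.prems as by auto
  from Cons.IH[OF this] obtain bs where bs: "length bs = length jw" "set bs \<subseteq> puiseux_pos"
    "y_word n iw as' = y_word n jw bs"
    "\<And>g. min_closed_on (set (word_roots iw)) g \<Longrightarrow>
      (map puiseux_val as' = map g (word_roots iw) \<longleftrightarrow> map puiseux_val bs = map g (word_roots jw))"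
    by blast
  have "map puiseux_val as = map g (word_roots (i # iw)) \<longleftrightarrow>
      map puiseux_val (a # bs) = map g (word_roots (i # jw))"
    if g: "min_closed_on (set (word_roots (i # iw))) g" for g
  proof -
    have mem: "(sw i x, sw i y) \<in> set (word_roots (i # iw))" if "(x, y) \<in> set (word_roots iw)" for x y
      using that by force
    have "min_closed_on (set (word_roots iw)) (g \<circ> map_prod (sw i) (sw i))"
      using g unfolding min_closed_on_def by (simp del: word_roots.simps) (meson mem)
    from bs(4)[OF this] show ?thesis by (simp add: as o_def)
  qed
  then show ?case using bs(1-3) Cons.prems(3) unfolding as by (intro exI[of _ "a # bs"]) (auto simp del: word_roots.simps)
next
  case (far i j iw)
  from far.prems obtain a b as' where as: "as = a # b # as'"
    by (metis Suc_length_conv)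
  have com: "sw j \<circ> sw i = sw i \<circ> sw j"
    using far(1) by (auto simp: fun_eq_iff transpose_def)
  have roots: "word_roots (p # q # iw) = (p, Suc p) # (sw p q, sw p (Suc q)) #
      map (map_prod (sw p \<circ> sw q) (sw p \<circ> sw q)) (word_roots iw)" for p q
    by (simp add: map_prod.comp)
  have fix_roots: "sw i j = j" "sw i (Suc j) = Suc j" "sw j i = i" "sw j (Suc i) = Suc i"
    using far(1) by auto
  have "y_word n (i # j # iw) as = y_word n (j # i # iw) (b # a # as')"
    unfolding as y_word_Cons by (rule y_mat_far) (use far in auto)
  moreover have "map puiseux_val as = map g (word_roots (i # j # iw)) \<longleftrightarrow>
      map puiseux_val (b # a # as') = map g (word_roots (j # i # iw))" for g
    unfolding as roots com fix_roots by auto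
  ultimately show ?case using far.prems unfolding as
    by (intro exI[of _ "b # a # as'"]) (auto simp del: word_roots.simps)
next
  case (near j i iw)
  from near.prems obtain a b c as' where as: "as = a # b # c # as'"
    by (metis Suc_length_conv)
  have pos: "a \<in> puiseux_pos" "b \<in> puiseux_pos" "c \<in> puiseux_pos" "a + c \<in> puiseux_pos"
    using near.prems as puiseux_pos_add by auto
  note nz = pos[THEN puiseux_pos_nonzero]
  \<comment> \<open>The parameters of \<open>y_mat_near\<close>, which are subtraction-free in the
    old ones and hence positive.\<close>
  define bs where "bs = b * c / (a + c) # (a + c) # a * b / (a + c) # as'"
  let ?m = "\<lambda>i. map_prod (sw i) (sw i)"
  have com: "?m j \<circ> (?m i \<circ> ?m j) = ?m i \<circ> (?m j \<circ> ?m i)"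
    using near(1) by (auto simp: fun_eq_iff transpose_def)
  have roots: "word_roots (p # q # p # iw) = (p, Suc p) # (sw p q, sw p (Suc q)) #
      (sw p (sw q p), sw p (sw q (Suc p))) # map (?m p \<circ> (?m q \<circ> ?m p)) (word_roots iw)" for p q
    by (simp add: map_prod.comp o_assoc)
  \<comment> \<open>The move lists the three roots of a rank two subsystem in reverse order; \<beta>
    is the sum of the other two and stands in the middle in both words.\<close>
  obtain \<alpha> \<beta> \<gamma> where
    ri: "word_roots (i # j # i # iw) = \<alpha> # \<beta> # \<gamma> # map (?m i \<circ> (?m j \<circ> ?m i)) (word_roots iw)" and
    rj: "word_roots (j # i # j # iw) = \<gamma> # \<beta> # \<alpha> # map (?m i \<circ> (?m j \<circ> ?m i)) (word_roots iw)" and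
    g: "\<And>g. min_closed_on (set (word_roots (i # j # i # iw))) g \<Longrightarrow> g \<beta> = min (g \<alpha>) (g \<gamma>)"
    using near(1)
  proof
    assume j: "j = Suc i"
    show thesis
    proof (rule that[of "(i, Suc i)" "(i, Suc (Suc i))" "(Suc i, Suc (Suc i))"])
      fix g assume "min_closed_on (set (word_roots (i # j # i # iw))) g"
      moreover have "{(i, Suc i), (i, Suc (Suc i)), (Suc i, Suc (Suc i))} \<subseteq> set (word_roots (i # j # i # iw))"
        unfolding j by (auto simp: transpose_def)
      ultimately show "g (i, Suc (Suc i)) = min (g (i, Suc i)) (g (Suc i, Suc (Suc i)))"
        unfolding min_closed_on_def by blast
    qed (unfold roots com, simp_all add: j)
  next
    assume i: "i = Suc j"
    show thesis
    proof (rule that[of "(Suc j, Suc (Suc j))" "(j, Suc (Suc j))" "(j, Suc j)"])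
      fix g assume "min_closed_on (set (word_roots (i # j # i # iw))) g"
      moreover have "{(j, Suc j), (j, Suc (Suc j)), (Suc j, Suc (Suc j))} \<subseteq> set (word_roots (i # j # i # iw))"
        unfolding i by (auto simp: transpose_def)
      ultimately show "g (j, Suc (Suc j)) = min (g (Suc j, Suc (Suc j))) (g (j, Suc j))"
        unfolding min_closed_on_def by (subst min.commute) blast
    qed (unfold roots com, simp_all add: i)
  qed
  have "y_word n (i # j # i # iw) as = y_word n (j # i # j # iw) bs"
    unfolding as bs_def y_word_Cons by (rule y_mat_near) (use near nz in auto)
  \<comment> \<open>If the valuations of \<open>a\<close>, \<open>b\<close>, \<open>c\<close> are
    the values of \<open>g\<close>, then \<open>b\<close> and \<open>a + c\<close> have the same
    valuation, and the new valuations are those of \<open>c\<close>, \<open>b\<close>,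
    \<open>a\<close>, which fits the reversed roots. Conversely, the minimum of the two outer new
    valuations is the valuation of \<open>b\<close>.\<close>
  moreover have "map puiseux_val as = map g (word_roots (i # j # i # iw)) \<longleftrightarrow>
      map puiseux_val bs = map g (word_roots (j # i # j # iw))"
    if "min_closed_on (set (word_roots (i # j # i # iw))) g" for g
    using g[OF that] unfolding ri rj as bs_def
    by (auto simp: puiseux_val_divide puiseux_val_mult puiseux_val_add_pos nz pos min_def split: if_splits)
  moreover have "set bs \<subseteq> puiseux_pos"
    using near.prems pos unfolding as bs_def by (auto intro: puiseux_pos_divide puiseux_pos_mult)
  ultimately show ?case using near.prems unfolding as
    by (intro exI[of _ bs]) (auto simp: bs_def simp del: word_roots.simps)
qed

section \<open>The standard reduced word\<close>

primrec std_word :: "nat \<Rightarrow> nat list" where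
  "std_word 0 = []"
| "std_word (Suc k) = [0..<k] @ std_word k"

lemma word_roots_append:
  "word_roots (iw @ jw) = word_roots iw @ map (map_prod (word_perm iw) (word_perm iw)) (word_roots jw)"
  by (induction iw) (auto simp: map_prod.id map_prod.comp)

lemma word_perm_upt: "word_perm [0..<k] x = (if x < k then Suc x else if x = k then 0 else x)"
  by (induction k arbitrary: x) (auto simp: word_perm_append transpose_def)

lemma word_roots_upt: "word_roots [0..<k] = map (\<lambda>j. (0, Suc j)) [0..<k]"
  by (induction k) (auto simp: word_roots_append word_perm_upt)

lemma set_word_roots_std_subset: "set (word_roots (std_word k)) \<subseteq> pos_roots k"
  by (induction k) (auto simp: word_roots_append word_roots_upt word_perm_upt pos_roots_def)

text \<open>The block \<open>[0..<k]\<close> acts as a cycle that sends each \<open>x < k\<close> to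
  \<open>Suc x\<close>, and the roots of \<open>std_word k\<close> only involve indices below
  \<open>k\<close>.\<close>

lemma word_roots_std_Suc:
  "word_roots (std_word (Suc k)) = map (\<lambda>j. (0, Suc j)) [0..<k] @ map (map_prod Suc Suc) (word_roots (std_word k))"
  using set_word_roots_std_subset[of k]
  by (auto simp: word_roots_append word_roots_upt word_perm_upt pos_roots_def)

lemma distinct_word_roots_std: "distinct (word_roots (std_word k))"
  by (induction k) (auto simp: word_roots_std_Suc distinct_map inj_on_def simp del: std_word.simps(2))

lemma simple_word_std: "simple_word n (std_word n)"
proof -
  have "k \<le> n \<Longrightarrow> simple_word n (std_word k)" for k
    by (induction k) (auto simp: simple_word_def)
  then show ?thesis by simp
qed

lemma word_perm_std: "word_perm (std_word n) = longest_perm n"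
  by (induction n) (auto simp: fun_eq_iff word_perm_append word_perm_upt longest_perm_def)

text \<open>The longest permutation is an involution that reverses every pair below
  \<open>n\<close>, so each positive root is an inversion.\<close>

lemma pos_roots_subset_word_roots:
  assumes "word_perm iw = longest_perm n"
  shows "pos_roots n \<subseteq> set (word_roots iw)"
proof -
  have "longest_perm n \<circ> longest_perm n = id" by (auto simp: longest_perm_def)
  then have "word_perm (rev iw) = longest_perm n"
    using word_perm_rev_inverse[of iw] unfolding assms by (metis comp_assoc comp_id id_comp)
  then show ?thesis by (auto simp: pos_roots_def longest_perm_def intro!: inversion_in_word_roots)
qed

lemma set_word_roots_std: "set (word_roots (std_word n)) = pos_roots n"
  using set_word_roots_std_subset pos_roots_subset_word_roots word_perm_std by blast

text \<open>Every word for the longest element has all positive roots among its roots, hence at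
  least that many letters. The standard word attains this bound since its roots are
  distinct.\<close>

lemma reduced_w0_std: "reduced_w0 n (std_word n)"
  unfolding reduced_w0_def reduced_word_def
proof (intro conjI allI impI simple_word_std word_perm_std)
  fix jw assume "simple_word n jw \<and> word_perm jw = word_perm (std_word n)"
  then have "pos_roots n \<subseteq> set (word_roots jw)"
    by (intro pos_roots_subset_word_roots) (simp add: word_perm_std)
  then have "card (pos_roots n) \<le> card (set (word_roots jw))" by (intro card_mono) auto
  also have "\<dots> \<le> length jw" using card_length[of "word_roots jw"] by simp
  finally show "length (std_word n) \<le> length jw"
    using distinct_card[OF distinct_word_roots_std[of n]] by (simp add: set_word_roots_std)
qed

section \<open>Matrix entries of the product along the standard word\<close>

lemma y_word_append:
  "length as = length iw \<Longrightarrow> y_word n (iw @ jw) (as @ bs) = y_word n iw as * y_word n jw bs"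
proof (induction iw arbitrary: as)
  case (Cons i iw)
  then obtain a as' where as: "as = a # as'" by (cases as) auto
  with Cons have IH: "y_word n (iw @ jw) (as' @ bs) = y_word n iw as' * y_word n jw bs" by simp
  show ?case unfolding as append_Cons y_word_Cons IH
    by (rule assoc_mult_mat[symmetric, of _ n n _ n _ n]) simp_all
qed (simp add: left_mult_one_mat[OF y_word_carrier])

text \<open>The block is lower bidiagonal: its factors act on \<open>A\<close> from the last to the
  first, so each row receives a multiple of the row above before that row has changed.\<close>

lemma y_word_upt_mult_index:
  assumes "k < n" "A \<in> carrier_mat n n" "r < n" "s < n"
  shows "(y_word n [0..<k] (map c [0..<k]) * A) $$ (r, s) =
    A $$ (r, s) + (if 0 < r \<and> r \<le> k then c (r - 1) * A $$ (r - 1, s) else 0)"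
  using assms
proof (induction k arbitrary: A)
  case 0
  then show ?case by (auto simp: left_mult_one_mat[OF 0(2)])
next
  case (Suc k)
  let ?B = "y_mat n k (c k) * A"
  have B: "?B \<in> carrier_mat n n" using Suc.prems(2) y_mat_carrier by (metis mult_carrier_mat)
  have "y_word n [0..<Suc k] (map c [0..<Suc k]) * A = y_word n [0..<k] (map c [0..<k]) * (y_word n [k] [c k] * A)"
    using Suc.prems(2) by (simp add: y_word_append assoc_mult_mat[of _ n n _ n _ n] right_mult_one_mat[OF y_mat_carrier])
  also have "y_word n [k] [c k] * A = ?B" by (simp add: right_mult_one_mat[OF y_mat_carrier])
  finally have eq: "(y_word n [0..<Suc k] (map c [0..<Suc k]) * A) = y_word n [0..<k] (map c [0..<k]) * ?B" .
  show ?case unfolding eq using Suc.prems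
    by (subst Suc.IH[OF _ B]) (auto simp: y_mat_mult_index le_Suc_eq simp del: index_mult_mat(1))
qed

text \<open>The length index \<open>k\<close> is kept apart from the size \<open>n\<close>, so that
  the tail left after removing a block is again of this form, with parameters read at shifted
  roots.\<close>

definition std_mat :: "nat \<Rightarrow> nat \<Rightarrow> (nat \<times> nat \<Rightarrow> 'a::comm_ring_1) \<Rightarrow> 'a mat" where
  "std_mat n k f = y_word n (std_word k) (map f (word_roots (std_word k)))"

lemma std_mat_0: "std_mat n 0 f = 1\<^sub>m n"
  by (simp add: std_mat_def)

lemma std_mat_carrier [simp]: "std_mat n k f \<in> carrier_mat n n"
  by (simp add: std_mat_def)

lemma std_mat_Suc:
  assumes "k < n" "r < n" "s < n"
  shows "std_mat n (Suc k) f $$ (r, s) = std_mat n k (f \<circ> map_prod Suc Suc) $$ (r, s) +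
    (if 0 < r \<and> r \<le> k then f (0, r) * std_mat n k (f \<circ> map_prod Suc Suc) $$ (r - 1, s) else 0)"
proof -
  have "std_mat n (Suc k) f = y_word n [0..<k] (map (\<lambda>j. f (0, Suc j)) [0..<k]) * std_mat n k (f \<circ> map_prod Suc Suc)"
    unfolding std_mat_def word_roots_std_Suc map_append
    unfolding std_word.simps by (subst y_word_append) (simp_all add: o_def)
  then show ?thesis using assms by (simp add: y_word_upt_mult_index del: index_mult_mat(1))
qed

lemma std_mat_lower_unipotent:
  assumes "k \<le> n" "r < n" "s < n" "r \<le> s"
  shows "std_mat n k f $$ (r, s) = of_bool (r = s)"
  using assms
proof (induction k arbitrary: f r)
  case (Suc k)
  then show ?case by (auto simp: std_mat_Suc)
qed (auto simp: std_mat_0)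

lemma std_mat_row_ge:
  assumes "k \<le> n" "r < n" "s < n" "k \<le> r"
  shows "std_mat n k f $$ (r, s) = of_bool (r = s)"
  using assms by (induction k arbitrary: f) (auto simp: std_mat_0 std_mat_Suc)

text \<open>\<open>tail_entry n f r c s\<close> is an entry, at distance \<open>s\<close> to the left of the diagonal, of the product
  of all but the first \<open>r\<close> blocks \<open>[0..<k]\<close> of \<open>std_word n\<close>. Its row is \<open>n - 1 - c - r\<close>: with this choice
  of \<open>c\<close>, shifting a Toeplitz matrix along its diagonal is \<open>c \<mapsto> Suc c\<close>.\<close>

definition tail_entry :: "nat \<Rightarrow> (nat \<times> nat \<Rightarrow> 'a::comm_ring_1) \<Rightarrow> nat \<Rightarrow> nat \<Rightarrow> nat \<Rightarrow> 'a" where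
  "tail_entry n f r c s = std_mat n (n - r) (f \<circ> map_prod ((+) r) ((+) r)) $$ (n - 1 - c - r, n - 1 - c - r - s)"

section \<open>Toeplitz matrices and their tropical parameters\<close>

text \<open>The recursion of \<open>tail_entry\<close>, with \<open>N = n - 1\<close> and
  \<open>a c r\<close> the parameter at the root \<open>(r, N - c)\<close>: block \<open>r\<close>
  combines two neighbouring rows of the next tail. For \<open>c = 0\<close> one of them is a row of
  the identity, so its term is missing.\<close>

definition bidiag_tails :: "nat \<Rightarrow> (nat \<Rightarrow> nat \<Rightarrow> 'a::comm_ring_1) \<Rightarrow> (nat \<Rightarrow> nat \<Rightarrow> nat \<Rightarrow> 'a) \<Rightarrow> bool" where
  "bidiag_tails N a M \<longleftrightarrow>
    (\<forall>r c. c + r \<le> N \<longrightarrow> M r c 0 = 1) \<and>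
    (\<forall>r s. r + Suc s \<le> N \<longrightarrow> M r 0 (Suc s) = a 0 r * M (Suc r) 0 s) \<and>
    (\<forall>r c s. Suc c + r + Suc s \<le> N \<longrightarrow>
      M r (Suc c) (Suc s) = M (Suc r) c (Suc s) + a (Suc c) r * M (Suc r) (Suc c) s)"

lemma bidiag_tails_std:
  assumes "n \<ge> 1"
  shows "bidiag_tails (n - 1) (\<lambda>c r. f (r, n - 1 - c)) (tail_entry n f)"
proof -
  have shift: "f \<circ> map_prod ((+) r) ((+) r) \<circ> map_prod Suc Suc = f \<circ> map_prod ((+) (Suc r)) ((+) (Suc r))" for r
    by (auto simp: fun_eq_iff)
  have step: "tail_entry n f r c s = std_mat n (n - Suc r) (f \<circ> map_prod ((+) (Suc r)) ((+) (Suc r))) $$ (n - 1 - c - r, n - 1 - c - r - s)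
    + (if c + r < n - 1 then f (r, n - 1 - c) * tail_entry n f (Suc r) c (s - 1) else 0)" if "c + r \<le> n - 1" "r < n" "0 < s" for r c s
  proof -
    have nr: "n - r = Suc (n - Suc r)" using that by simp
    have e: "n - 1 - c - r - 1 = n - 1 - c - Suc r" "n - 1 - c - r - s = n - 1 - c - Suc r - (s - 1)"
      "r + (n - 1 - c - r) = n - 1 - c"
      using that by auto
    show ?thesis unfolding tail_entry_def nr
      by (subst std_mat_Suc) (use that assms e in \<open>auto simp: shift\<close>)
  qed
  show ?thesis unfolding bidiag_tails_def
  proof (intro conjI allI impI)
    fix r c assume "c + r \<le> n - 1"
    then show "tail_entry n f r c 0 = 1"
      unfolding tail_entry_def using assms by (subst std_mat_lower_unipotent) auto
  next
    fix r s assume "r + Suc s \<le> n - 1"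
    then show "tail_entry n f r 0 (Suc s) = f (r, n - 1 - 0) * tail_entry n f (Suc r) 0 s"
      by (subst step) (auto simp: std_mat_row_ge)
  next
    fix r c s assume le: "Suc c + r + Suc s \<le> n - 1"
    then have e: "n - 1 - Suc c - r = n - 1 - c - Suc r" by simp
    show "tail_entry n f r (Suc c) (Suc s) = tail_entry n f (Suc r) c (Suc s)
        + f (r, n - 1 - Suc c) * tail_entry n f (Suc r) (Suc c) s"
      by (subst step) (use le in \<open>auto simp: tail_entry_def e\<close>)
  qed
qed

text \<open>The parameters are read off one by one: at distance 1 from the diagonal the recursion
  isolates \<open>a c r\<close>, because diagonal entries are 1, and dividing by it determines the
  next tail. The induction runs over \<open>r\<close> outside and \<open>c\<close> inside.\<close>

lemma bidiag_tails_inject: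
  fixes a b :: "nat \<Rightarrow> nat \<Rightarrow> 'a::field"
  assumes aM: "bidiag_tails N a M" and bM: "bidiag_tails N b M'"
    and nz: "\<And>c r. c + r < N \<Longrightarrow> a c r \<noteq> 0"
    and eq: "\<And>c s. c + s \<le> N \<Longrightarrow> M 0 c s = M' 0 c s"
    and "c + r < N"
  shows "a c r = b c r"
proof -
  note A = aM[unfolded bidiag_tails_def, THEN conjunct1, rule_format]
    aM[unfolded bidiag_tails_def, THEN conjunct2, THEN conjunct1, rule_format]
    aM[unfolded bidiag_tails_def, THEN conjunct2, THEN conjunct2, rule_format]
  note B = bM[unfolded bidiag_tails_def, THEN conjunct1, rule_format]
    bM[unfolded bidiag_tails_def, THEN conjunct2, THEN conjunct1, rule_format]
    bM[unfolded bidiag_tails_def, THEN conjunct2, THEN conjunct2, rule_format]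
  have step: "(c + r < N \<longrightarrow> a c r = b c r) \<and> (\<forall>s. c + Suc r + s \<le> N \<longrightarrow> M (Suc r) c s = M' (Suc r) c s)"
    if IH: "\<And>c s. c + r + s \<le> N \<Longrightarrow> M r c s = M' r c s" for r c
  proof (induction c)
    case 0
    have e: "a 0 r * M (Suc r) 0 s = b 0 r * M' (Suc r) 0 s" if "r + Suc s \<le> N" for s
      using IH[of 0 "Suc s"] that A(2) B(2) by simp
    have "a 0 r = b 0 r" if "r < N"
      using e[of 0] that A(1)[of 0 "Suc r"] B(1)[of 0 "Suc r"] by simp
    then show ?case using e nz[of 0 r] by auto
  next
    case (Suc c)
    have e: "a (Suc c) r * M (Suc r) (Suc c) s = b (Suc c) r * M' (Suc r) (Suc c) s"
      if "Suc c + r + Suc s \<le> N" for s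
      using IH[of "Suc c" "Suc s"] that A(3)[of c r s] B(3)[of c r s] Suc by simp
    have "a (Suc c) r = b (Suc c) r" if "Suc c + r < N"
      using e[of 0] that A(1)[of "Suc c" "Suc r"] B(1)[of "Suc c" "Suc r"] by simp
    then show ?case using e nz[of "Suc c" r] by auto
  qed
  have "\<forall>c s. c + r + s \<le> N \<longrightarrow> M r c s = M' r c s" for r
    by (induction r) (use eq step in auto)
  with step[of r c] \<open>c + r < N\<close> show ?thesis by blast
qed

text \<open>Comparing the factorisation of a Toeplitz matrix with the one of its shift along the diagonal
  is a step of the discrete Toda flow; the identity below is the resulting T-system for the
  rectangular minors, written in terms of the factorisation parameters.\<close>

lemma toeplitz_T_system:
  fixes a :: "nat \<Rightarrow> nat \<Rightarrow> 'a::field"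
  assumes aM: "bidiag_tails N a M"
    and nz: "\<And>c r. c + r < N \<Longrightarrow> a c r \<noteq> 0"
    and toeplitz: "\<And>c s. Suc c + s \<le> N \<Longrightarrow> M 0 (Suc c) s = M 0 c s"
    and "Suc (c + r) < N"
  shows "(\<Prod>k\<le>r. a (Suc c) k / a c k) + (\<Prod>k\<le>c. a k (Suc r) / a k r) = 1"
proof -
  note A = aM[unfolded bidiag_tails_def, THEN conjunct1, rule_format]
    aM[unfolded bidiag_tails_def, THEN conjunct2, THEN conjunct1, rule_format]
    aM[unfolded bidiag_tails_def, THEN conjunct2, THEN conjunct2, rule_format]
  define v where "v c r = (\<Prod>k\<le>r. a (Suc c) k / a c k)" for c r
  define h where "h c r = (\<Prod>k\<le>c. a k (Suc r) / a k r)" for c r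
  \<comment> \<open>The counterparts of \<open>a\<close> for the matrix shifted along its
    diagonal.\<close>
  define u where "u r c = a c r * v c r" for r c
  have vS: "v c (Suc r) * a c (Suc r) = v c r * a (Suc c) (Suc r)" if "c + Suc r < N" for c r
    using nz[OF that] by (simp add: v_def)
  have uS: "u r c * a (Suc c) (Suc r) = a c r * u (Suc r) c" if "c + Suc r < N" for c r
    using vS[OF that] by (simp add: u_def ac_simps)
  have tail: "\<forall>c s. c + r + Suc (Suc s) \<le> N \<longrightarrow> M r c (Suc s) = M (Suc r) c (Suc s) + u r c * M (Suc r) (Suc c) s" for r
  proof (induction r)
    case 0
    show ?case
    proof (intro allI impI)
      fix c s assume le: "c + 0 + Suc (Suc s) \<le> N"
      have "u 0 c = a (Suc c) 0" using nz[of c 0] le by (simp add: u_def v_def)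
      then show "M 0 c (Suc s) = M (Suc 0) c (Suc s) + u 0 c * M (Suc 0) (Suc c) s"
        using toeplitz[of c "Suc s"] A(3)[of c 0 s] le by simp
    qed
  next
    case (Suc r)
    have IH: "M r c (Suc s) = M (Suc r) c (Suc s) + u r c * M (Suc r) (Suc c) s"
      if "c + r + Suc (Suc s) \<le> N" for c s
      using Suc that by blast
    show ?case
    proof
      fix c
      show "\<forall>s. c + Suc r + Suc (Suc s) \<le> N \<longrightarrow>
        M (Suc r) c (Suc s) = M (Suc (Suc r)) c (Suc s) + u (Suc r) c * M (Suc (Suc r)) (Suc c) s"
      proof (induction c)
        case 0
        show ?case
        proof (intro allI impI)
          fix s assume le: "0 + Suc r + Suc (Suc s) \<le> N"
          have e0: "a 0 r = a 0 (Suc r) + u r 0"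
            using IH[of 0 0] A(2)[of r 0] A(2)[of "Suc r" 0] A(1)[of 0 "Suc r"] A(1)[of 0 "Suc (Suc r)"]
              A(1)[of "Suc 0" "Suc r"] le by simp
          have "a 0 r * M (Suc r) 0 (Suc s) =
              (a 0 (Suc r) + u r 0) * M (Suc (Suc r)) 0 (Suc s) + u r 0 * a (Suc 0) (Suc r) * M (Suc (Suc r)) (Suc 0) s"
            using IH[of 0 "Suc s"] A(2)[of r "Suc s"] A(2)[of "Suc r" "Suc s"] A(3)[of 0 "Suc r" s] le
            by (simp add: algebra_simps)
          also have "\<dots> = a 0 r * (M (Suc (Suc r)) 0 (Suc s) + u (Suc r) 0 * M (Suc (Suc r)) (Suc 0) s)"
            unfolding e0[symmetric] using uS[of 0 r] le by (simp add: algebra_simps)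
          finally show "M (Suc r) 0 (Suc s) = M (Suc (Suc r)) 0 (Suc s) + u (Suc r) 0 * M (Suc (Suc r)) (Suc 0) s"
            using nz[of 0 r] le by simp
        qed
      next
        case (Suc c)
        show ?case
        proof (intro allI impI)
          fix s assume le: "Suc c + Suc r + Suc (Suc s) \<le> N"
          have IHc: "M (Suc r) c (Suc s) = M (Suc (Suc r)) c (Suc s) + u (Suc r) c * M (Suc (Suc r)) (Suc c) s"
            if "c + Suc r + Suc (Suc s) \<le> N" for s
            using Suc that by blast
          have e0: "a (Suc c) r + u (Suc r) c = a (Suc c) (Suc r) + u r (Suc c)"
            using IH[of "Suc c" 0] A(3)[of c r 0] A(3)[of c "Suc r" 0] IHc[of 0]
              A(1)[of "Suc c" "Suc r"] A(1)[of "Suc c" "Suc (Suc r)"] A(1)[of "Suc (Suc c)" "Suc r"] le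
            by (simp add: ac_simps)
          have "M (Suc r) c (Suc (Suc s)) + a (Suc c) r * M (Suc r) (Suc c) (Suc s) =
              M (Suc (Suc r)) c (Suc (Suc s)) + (a (Suc c) (Suc r) + u r (Suc c)) * M (Suc (Suc r)) (Suc c) (Suc s)
              + u r (Suc c) * a (Suc (Suc c)) (Suc r) * M (Suc (Suc r)) (Suc (Suc c)) s"
            using IH[of "Suc c" "Suc s"] A(3)[of c r "Suc s"] A(3)[of c "Suc r" "Suc s"] A(3)[of "Suc c" "Suc r" s] le
            by (simp add: algebra_simps)
          then have "a (Suc c) r * M (Suc r) (Suc c) (Suc s) =
              a (Suc c) r * M (Suc (Suc r)) (Suc c) (Suc s)
              + u r (Suc c) * a (Suc (Suc c)) (Suc r) * M (Suc (Suc r)) (Suc (Suc c)) s"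
            unfolding e0[symmetric] using IHc[of "Suc s"] le by (simp add: algebra_simps)
          also have "\<dots> = a (Suc c) r * (M (Suc (Suc r)) (Suc c) (Suc s) + u (Suc r) (Suc c) * M (Suc (Suc r)) (Suc (Suc c)) s)"
            using uS[of "Suc c" r] le by (simp add: algebra_simps)
          finally show "M (Suc r) (Suc c) (Suc s) =
              M (Suc (Suc r)) (Suc c) (Suc s) + u (Suc r) (Suc c) * M (Suc (Suc r)) (Suc (Suc c)) s"
            using nz[of "Suc c" r] le by simp
        qed
      qed
    qed
  qed
  have tail': "M r c (Suc 0) = M (Suc r) c (Suc 0) + u r c" if "Suc (c + r) < N" for r c
    using tail[of r] A(1)[of "Suc c" "Suc r"] that by simp
  \<comment> \<open>The sum rule \<open>e1\<close> expresses \<open>v (Suc c) r\<close> through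
    \<open>v c r\<close>, hence through \<open>1 - h c r\<close>; the factor it puts before
    \<open>h c r\<close> is the one that makes \<open>h (Suc c) r\<close>.\<close>
  have "v c r + h c r = 1" if "Suc (c + r) < N" for c
    using that
  proof (induction c)
    case 0
    have "a 0 r = a 0 (Suc r) + u r 0"
      using tail'[of 0 r] A(2)[of r 0] A(2)[of "Suc r" 0] A(1)[of 0 "Suc r"] A(1)[of 0 "Suc (Suc r)"] 0 by simp
    then show ?case using nz[of 0 r] 0 by (simp add: u_def h_def field_simps)
  next
    case (Suc c)
    have e1: "a (Suc c) r + u (Suc r) c = a (Suc c) (Suc r) + u r (Suc c)"
      using tail'[of "Suc c" r] tail'[of c "Suc r"] A(3)[of c r 0] A(3)[of c "Suc r" 0]
        A(1)[of "Suc c" "Suc r"] A(1)[of "Suc c" "Suc (Suc r)"] Suc.prems by (simp add: ac_simps)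
    have e2: "u (Suc r) c = a (Suc c) (Suc r) * v c r"
      using vS[of c r] Suc.prems by (simp add: u_def mult.commute)
    have e3: "v c r = 1 - h c r" using Suc by (simp add: eq_diff_eq)
    have "a (Suc c) r * v (Suc c) r = a (Suc c) r - a (Suc c) (Suc r) * h c r"
      using e1 unfolding e2 e3 by (simp add: u_def algebra_simps)
    then show ?case using nz[of "Suc c" r] Suc.prems by (simp add: h_def field_simps)
  qed
  with \<open>Suc (c + r) < N\<close> show ?thesis by (simp add: v_def h_def)
qed

text \<open>Let \<open>V\<close> and \<open>H\<close> be the two sums without their last terms. Each
  is zero, or positive with a positive last term (\<open>V1\<close>, \<open>H1\<close>). As the
  minimum of the full sums is 0, the minimum of the two last terms is then 0 as well.\<close>

lemma tropical_T_system:
  fixes D :: "nat \<Rightarrow> nat \<Rightarrow> real"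
  assumes T: "\<And>c r. Suc (c + r) < N \<Longrightarrow>
      min (\<Sum>k\<le>r. D (Suc c) k - D c k) (\<Sum>k\<le>c. D k (Suc r) - D k r) = 0"
    and "Suc (c + r) < N"
  shows "D c r = min (D (Suc c) r) (D c (Suc r))"
  using assms(2)
proof (induction "c + r" arbitrary: c r rule: less_induct)
  case less
  define V where "V c r = (\<Sum>k<r. D (Suc c) k - D c k)" for c r
  define H where "H c r = (\<Sum>k<c. D k (Suc r) - D k r)" for c r
  have T: "min (V c (Suc r)) (H (Suc c) r) = 0" if "Suc (c + r) < N" for c r
    using T[OF that] by (simp add: V_def H_def lessThan_Suc_atMost)
  have IH: "D c' r' = min (D (Suc c') r') (D c' (Suc r'))" if "c' + r' < c + r" for c' r'
    using less.hyps[of c' r'] that less.prems by simp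
  have VS: "V c (Suc r) = V c r + (D (Suc c) r - D c r)" for c r by (simp add: V_def)
  have HS: "H (Suc c) r = H c r + (D c (Suc r) - D c r)" for c r by (simp add: H_def)
  \<comment> \<open>Agreement of \<open>D c\<close> and \<open>D (Suc c)\<close> at
    \<open>r'\<close> propagates to all smaller indices by the induction hypothesis for both, so
    every difference in \<open>V c r\<close> vanishes.\<close>
  have V0: "V c r = 0" if Vr: "r = Suc r'" "D c r' = D (Suc c) r'" for r'
  proof -
    have "D c (r' - k) = D (Suc c) (r' - k)" for k
    proof (induction k)
      case (Suc k)
      show ?case
      proof (cases "k < r'")
        case True
        then have e: "r' - k = Suc (r' - Suc k)" by simp
        have "D c (r' - Suc k) = min (D (Suc c) (r' - Suc k)) (D c (r' - k))"
          unfolding e by (rule IH) (use Vr True in simp)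
        moreover have "D (Suc c) (r' - Suc k) = min (D (Suc (Suc c)) (r' - Suc k)) (D (Suc c) (r' - k))"
          unfolding e by (rule IH) (use Vr True in simp)
        ultimately show ?thesis using Suc by simp
      qed (use Suc in simp)
    qed (use Vr in simp)
    then have "D c k = D (Suc c) k" if "k \<le> r'" for k
      using that by (metis diff_diff_cancel)
    then show ?thesis unfolding V_def Vr(1) by (intro sum.neutral) auto
  qed
  have H0: "H c r = 0" if Hc: "c = Suc c'" "D c' r = D c' (Suc r)" for c'
  proof -
    have "D (c' - k) r = D (c' - k) (Suc r)" for k
    proof (induction k)
      case (Suc k)
      show ?case
      proof (cases "k < c'")
        case True
        then have e: "c' - k = Suc (c' - Suc k)" by simp
        have "D (c' - Suc k) r = min (D (c' - k) r) (D (c' - Suc k) (Suc r))"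
          unfolding e by (rule IH) (use Hc True in simp)
        moreover have "D (c' - Suc k) (Suc r) = min (D (c' - k) (Suc r)) (D (c' - Suc k) (Suc (Suc r)))"
          unfolding e by (rule IH) (use Hc True in simp)
        ultimately show ?thesis using Suc by simp
      qed (use Suc in simp)
    qed (use Hc in simp)
    then have "D k r = D k (Suc r)" if "k \<le> c'" for k
      using that by (metis diff_diff_cancel)
    then show ?thesis unfolding H_def Hc(1) by (intro sum.neutral) auto
  qed
  have V1: "V c r = 0 \<or> (0 < V c r \<and> D c r < D (Suc c) r)"
  proof (cases r)
    case 0
    then show ?thesis by (simp add: V_def)
  next
    case (Suc r')
    have d: "D c r' = min (D (Suc c) r') (D c r)"
      using IH[of c r'] Suc by simp
    have t: "min (V c r) (H (Suc c) r') = 0" "min (V (Suc c) r) (H (Suc (Suc c)) r') = 0"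
      using T[of c r'] T[of "Suc c" r'] less.prems Suc by auto
    show ?thesis
    proof (cases "D c r' = D (Suc c) r'")
      case True
      then show ?thesis using V0 Suc by blast
    next
      case False
      then have "D c r < D (Suc c) r'" using d by (auto simp: min_def split: if_splits)
      \<comment> \<open>If \<open>V c r\<close> is positive, then \<open>H (Suc c) r'\<close> is 0
        by the first part of \<open>t\<close>. As \<open>H (Suc (Suc c)) r'\<close> is nonnegative
        by the second, \<open>D (Suc c) r\<close> is at least \<open>D (Suc c) r'\<close>, which
        exceeds \<open>D c r\<close>.\<close>
      then show ?thesis using t HS[of "Suc c" r'] Suc by (auto simp: min_def split: if_splits)
    qed
  qed
  have H1: "H c r = 0 \<or> (0 < H c r \<and> D c r < D c (Suc r))"
  proof (cases c)
    case 0
    then show ?thesis by (simp add: H_def)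
  next
    case (Suc c')
    have d: "D c' r = min (D c r) (D c' (Suc r))"
      using IH[of c' r] Suc by simp
    have t: "min (V c' (Suc r)) (H c r) = 0" "min (V c' (Suc (Suc r))) (H c (Suc r)) = 0"
      using T[of c' r] T[of c' "Suc r"] less.prems Suc by auto
    show ?thesis
    proof (cases "D c' r = D c' (Suc r)")
      case True
      then show ?thesis using H0 Suc by blast
    next
      case False
      then have "D c r < D c' (Suc r)" using d by (auto simp: min_def split: if_splits)
      then show ?thesis using t VS[of c' "Suc r"] Suc by (auto simp: min_def split: if_splits)
    qed
  qed
  show ?case
    using T[OF less.prems] V1 H1 VS[of c r] HS[of c r] by (auto simp: min_def split: if_splits)
qed

section \<open>Uniqueness of the factorisation\<close>

lemma GL_iff: "A \<in> GL n \<longleftrightarrow> A \<in> carrier_mat n n \<and> (\<exists>V \<in> carrier_mat n n. A * V = 1\<^sub>m n \<and> V * A = 1\<^sub>m n)"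
proof
  assume "A \<in> GL n"
  then obtain V where A: "A \<in> carrier_mat n n" and V: "A * V = 1\<^sub>m n" "V * A = 1\<^sub>m (dim_row V)"
    by (auto simp: GL_def invertible_mat_def inverts_mat_def)
  have "dim_col V = n" using V(1) by (metis index_mult_mat(3) index_one_mat(3))
  moreover have "dim_row V = n" using V(2) A by (metis carrier_matD(2) index_mult_mat(3) index_one_mat(3))
  ultimately show "A \<in> carrier_mat n n \<and> (\<exists>V \<in> carrier_mat n n. A * V = 1\<^sub>m n \<and> V * A = 1\<^sub>m n)"
    using A V by (auto intro!: bexI[of _ V])
qed (auto simp: GL_def invertible_mat_def inverts_mat_def square_mat.simps)

lemma GL_carrier: "A \<in> GL n \<Longrightarrow> A \<in> carrier_mat n n"
  by (simp add: GL_iff)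

lemma GL_mult:
  assumes "A \<in> GL n" "B \<in> GL n"
  shows "A * B \<in> GL n"
proof -
  note ass = assoc_mult_mat[of _ n n _ n _ n] and mc = mult_carrier_mat[of _ n n _ n]
  obtain V W where *: "A \<in> carrier_mat n n" "B \<in> carrier_mat n n" "V \<in> carrier_mat n n" "W \<in> carrier_mat n n"
    "A * V = 1\<^sub>m n" "V * A = 1\<^sub>m n" "B * W = 1\<^sub>m n" "W * B = 1\<^sub>m n"
    using assms by (auto simp: GL_iff)
  have "A * B * (W * V) = A * (B * W * V)" "W * V * (A * B) = W * (V * A * B)"
    using *(1-4) by (simp_all only: ass mc)
  then have "A * B * (W * V) = 1\<^sub>m n" "W * V * (A * B) = 1\<^sub>m n"
    using * by simp_all
  with * show ?thesis unfolding GL_iff by (intro conjI bexI[of _ "W * V"] mc)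
qed

lemma upper_triangular_mult_index:
  assumes "A \<in> carrier_mat n n" "B \<in> carrier_mat n n" "upper_triangular A" "upper_triangular B"
    and "i < n" "j < n" "j \<le> i"
  shows "(A * B) $$ (i, j) = (if i = j then A $$ (i, i) * B $$ (i, i) else 0)"
proof -
  have "A $$ (i, k) * B $$ (k, j) = 0" if "k < n" "k \<noteq> i \<or> i \<noteq> j" for k
  proof -
    have "k < i \<or> j < k" using that assms by linarith
    then show ?thesis using assms that upper_triangularD[OF assms(3), of k i] upper_triangularD[OF assms(4), of j k]
      by auto
  qed
  then have "A $$ (i, k) * B $$ (k, j) = (if k = i then if i = j then A $$ (i, i) * B $$ (i, i) else 0 else 0)"
    if "k < n" for k using that by auto
  then have "(\<Sum>k<n. A $$ (i, k) * B $$ (k, j)) = (\<Sum>k<n. if k = i then if i = j then A $$ (i, i) * B $$ (i, i) else 0 else 0)"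
    by (intro sum.cong) auto
  then show ?thesis using assms(5) by (simp add: mult_mat_index[OF assms(1,2,5,6)])
qed

lemma upper_triangular_mult:
  "A \<in> carrier_mat n n \<Longrightarrow> B \<in> carrier_mat n n \<Longrightarrow> upper_triangular A \<Longrightarrow> upper_triangular B \<Longrightarrow>
    upper_triangular (A * B)"
  by (intro upper_triangularI) (auto simp: upper_triangular_mult_index simp del: index_mult_mat(1))

lemma mult_unit_cancel: "x * y = 0 \<Longrightarrow> y dvd 1 \<Longrightarrow> x = (0::'a::comm_ring_1)"
  by (elim dvdE) (metis mult.assoc mult.right_neutral mult_zero_left)

text \<open>Column by column: once the earlier columns of \<open>V\<close> vanish below the
  diagonal, an entry of \<open>V * A\<close> on or below it reduces to one product with a diagonal
  entry of \<open>A\<close>, which is a unit. This argument also covers the dual numbers.\<close>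

lemma upper_triangular_inverse:
  fixes A :: "'a::comm_ring_1 mat"
  assumes A: "A \<in> carrier_mat n n" "upper_triangular A" and V: "V \<in> carrier_mat n n"
    and inv: "V * A = 1\<^sub>m n"
  shows "upper_triangular V"
proof -
  have "\<forall>i. j < i \<and> i < n \<longrightarrow> V $$ (i, j) = 0" if "j < n" for j
    using that
  proof (induction j rule: less_induct)
    case (less j)
    have VA: "V $$ (i, j) * A $$ (j, j) = of_bool (i = j)" if i: "i < n" "j \<le> i" for i
    proof -
      have "V $$ (i, k) * A $$ (k, j) = (if k = j then V $$ (i, j) * A $$ (j, j) else 0)" if k: "k < n" for k
        using less.IH[of k] less.prems upper_triangularD[OF A(2), of j k] A(1) k i
        by (cases k j rule: linorder_cases) auto
      then have "(\<Sum>k<n. V $$ (i, k) * A $$ (k, j)) = (\<Sum>k<n. if k = j then V $$ (i, j) * A $$ (j, j) else 0)"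
        by (intro sum.cong) auto
      then have "V $$ (i, j) * A $$ (j, j) = (V * A) $$ (i, j)"
        using less.prems i by (simp add: mult_mat_index[OF V A(1)])
      then show ?thesis using less.prems inv i by simp
    qed
    have "V $$ (j, j) * A $$ (j, j) = 1" using VA[of j] less.prems by simp
    then have unit: "A $$ (j, j) dvd 1" by (metis dvd_triv_right)
    show ?case
    proof (intro allI impI)
      fix i assume "j < i \<and> i < n"
      then have "V $$ (i, j) * A $$ (j, j) = 0" using VA[of i] by simp
      then show "V $$ (i, j) = 0" using unit by (rule mult_unit_cancel)
    qed
  qed
  then show ?thesis using V by (intro upper_triangularI) auto
qed

lemma unipotent_up_iff: "u \<in> unipotent_up n \<longleftrightarrow> u \<in> GL n \<and> upper_triangular u \<and> (\<forall>i<n. u $$ (i, i) = 1)"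
  by (auto simp: unipotent_up_def borel_up_def)

lemma unipotent_up_carrier: "u \<in> unipotent_up n \<Longrightarrow> u \<in> carrier_mat n n"
  by (simp add: unipotent_up_iff GL_carrier)

lemma unipotent_up_mult: "u \<in> unipotent_up n \<Longrightarrow> v \<in> unipotent_up n \<Longrightarrow> u * v \<in> unipotent_up n"
  using upper_triangular_mult[of u n v] upper_triangular_mult_index[of u n v]
  by (auto simp: unipotent_up_iff GL_mult GL_carrier)

lemma unipotent_up_inverse:
  assumes "u \<in> unipotent_up n"
  obtains v where "v \<in> unipotent_up n" "u * v = 1\<^sub>m n" "v * u = 1\<^sub>m n"
proof -
  from assms obtain v where v: "v \<in> carrier_mat n n" "u * v = 1\<^sub>m n" "v * u = 1\<^sub>m n"
    by (auto simp: unipotent_up_iff GL_iff)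
  note u = unipotent_up_carrier[OF assms]
  have up: "upper_triangular u" using assms by (simp add: unipotent_up_iff)
  have upv: "upper_triangular v" using upper_triangular_inverse[OF u up v(1,3)] .
  have "v $$ (i, i) = 1" if "i < n" for i
    using upper_triangular_mult_index[OF u v(1) up upv that that] assms that
    by (simp add: v unipotent_up_iff)
  then have "v \<in> unipotent_up n" using upv u v unfolding unipotent_up_iff GL_iff by blast
  then show ?thesis using v that by blast
qed

section \<open>Antidiagonal matrices and the lift of the longest element\<close>

definition antidiag :: "nat \<Rightarrow> (nat \<Rightarrow> 'a::comm_ring_1) \<Rightarrow> 'a mat" where
  "antidiag n c = mat n n (\<lambda>(r, s). if s = n - 1 - r then c r else 0)"

lemma antidiag_carrier [simp]: "antidiag n c \<in> carrier_mat n n"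
  by (simp add: antidiag_def)

lemma antidiag_mult_left:
  assumes "A \<in> carrier_mat n n" "r < n" "s < n"
  shows "(antidiag n c * A) $$ (r, s) = c r * A $$ (n - 1 - r, s)"
proof -
  have "(\<Sum>k<n. antidiag n c $$ (r, k) * A $$ (k, s)) = (\<Sum>k<n. if k = n - 1 - r then c r * A $$ (n - 1 - r, s) else 0)"
    using assms by (intro sum.cong) (auto simp: antidiag_def)
  then show ?thesis using assms by (simp add: mult_mat_index[OF antidiag_carrier assms])
qed

lemma antidiag_mult_right:
  assumes "A \<in> carrier_mat n n" "r < n" "s < n"
  shows "(A * antidiag n c) $$ (r, s) = A $$ (r, n - 1 - s) * c (n - 1 - s)"
proof -
  have "(\<Sum>k<n. A $$ (r, k) * antidiag n c $$ (k, s)) = (\<Sum>k<n. if k = n - 1 - s then A $$ (r, n - 1 - s) * c (n - 1 - s) else 0)"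
    using assms by (intro sum.cong) (auto simp: antidiag_def)
  then show ?thesis using assms by (simp add: mult_mat_index[OF assms(1) antidiag_carrier assms(2,3)])
qed

lemma antidiag_inverse:
  assumes "\<And>r. r < n \<Longrightarrow> c r * c' (n - 1 - r) = 1"
  shows "antidiag n c * antidiag n c' = 1\<^sub>m n"
proof (rule eq_matI)
  fix i j assume ij: "i < dim_row (1\<^sub>m n)" "j < dim_col (1\<^sub>m n)"
  then show "(antidiag n c * antidiag n c') $$ (i, j) = 1\<^sub>m n $$ (i, j)"
    using assms[of i] by (subst antidiag_mult_left) (auto simp: antidiag_def)
qed (auto simp: antidiag_def)

lemma s_bar_carrier [simp]: "s_bar n i \<in> carrier_mat n n"
  by (simp add: s_bar_def sl2_embed_def)

lemma s_bar_index:
  "r < n \<Longrightarrow> s < n \<Longrightarrow> s_bar n i $$ (r, s) =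
    (if s = sw i r then if r = i then - 1 else 1 else 0)"
  by (auto simp: s_bar_def sl2_embed_def mat_of_rows_list_def transpose_def)

lemma s_bar_mult_index:
  assumes "Suc i < n" "A \<in> carrier_mat n n" "r < n" "s < n"
  shows "(s_bar n i * A) $$ (r, s) = (if r = i then - 1 else 1) * A $$ (sw i r, s)"
proof -
  have "(\<Sum>k<n. s_bar n i $$ (r, k) * A $$ (k, s)) = (\<Sum>k<n. if k = sw i r then (if r = i then - 1 else 1) * A $$ (sw i r, s) else 0)"
    using assms by (intro sum.cong) (auto simp: s_bar_index)
  moreover have "sw i r < n" using assms by (auto simp: transpose_def)
  ultimately show ?thesis by (simp add: mult_mat_index[OF s_bar_carrier assms(2-4)])
qed

lemma mat_prod_Nil [simp]: "mat_prod n [] = 1\<^sub>m n"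
  and mat_prod_Cons [simp]: "mat_prod n (A # As) = A * mat_prod n As"
  by (simp_all add: mat_prod_def)

lemma mat_prod_carrier: "set As \<subseteq> carrier_mat n n \<Longrightarrow> mat_prod n As \<in> carrier_mat n n"
  by (induction As) auto

text \<open>Each \<open>s_bar\<close> permutes rows up to sign, so the product is a monomial matrix.
  A sign is recorded as an element with square 1, which makes sense over any ring.\<close>

lemma s_bar_word_index:
  assumes "simple_word n iw"
  shows "\<exists>e :: nat \<Rightarrow> 'a::comm_ring_1. (\<forall>r<n. e r * e r = 1) \<and>
    (\<forall>r<n. \<forall>s<n. mat_prod n (map (s_bar n) iw) $$ (r, s) = (if r = word_perm iw s then e r else 0))"
  using assms
proof (induction iw)
  case Nil
  then show ?case by (intro exI[of _ "\<lambda>_. 1"]) auto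
next
  case (Cons i iw)
  then obtain e :: "nat \<Rightarrow> 'a" where e: "\<And>r. r < n \<Longrightarrow> e r * e r = 1"
    "\<And>r s. r < n \<Longrightarrow> s < n \<Longrightarrow> mat_prod n (map (s_bar n) iw) $$ (r, s) = (if r = word_perm iw s then e r else 0)"
    by auto
  have i: "Suc i < n" and C: "mat_prod n (map (s_bar n) iw :: 'a mat list) \<in> carrier_mat n n"
    using Cons.prems by (auto intro!: mat_prod_carrier)
  have lt: "sw i r < n" if "r < n" for r using i that by (auto simp: transpose_def)
  show ?case
  proof (intro exI[of _ "\<lambda>r. (if r = i then - 1 else 1) * e (sw i r)"] conjI allI impI)
    fix r assume "r < n"
    then show "(if r = i then - 1 else 1) * e (sw i r) * ((if r = i then - 1 else 1) * e (sw i r)) = 1"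
      using e(1)[OF lt, of r] by (cases "r = i") auto
  next
    fix r s assume rs: "r < n" "s < n"
    have "sw i r = word_perm iw s \<longleftrightarrow> r = word_perm (i # iw) s"
      by (metis comp_apply transpose_involutory word_perm_Cons)
    then show "mat_prod n (map (s_bar n) (i # iw)) $$ (r, s) =
        (if r = word_perm (i # iw) s then (if r = i then - 1 else 1) * e (sw i r) else 0)"
      using rs by (simp add: s_bar_mult_index[OF i C rs] e(2) lt del: index_mult_mat(1) word_perm_Cons)
  qed
qed

text \<open>The word \<open>iw\<close> witnesses that the choice in \<open>w0_bar\<close> selects a
  reduced word of the longest element.\<close>

lemma w0_bar_antidiag:
  assumes "reduced_w0 n iw"
  obtains e :: "nat \<Rightarrow> 'a::comm_ring_1" where "\<And>r. r < n \<Longrightarrow> e r * e r = 1" "w0_bar n = antidiag n e"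
proof -
  define kw where "kw = (SOME iw. reduced_w0 n iw)"
  have kw: "reduced_w0 n kw" unfolding kw_def using assms by (rule someI)
  then have "simple_word n kw" by (simp add: reduced_w0_def reduced_word_simple)
  from s_bar_word_index[OF this] obtain e :: "nat \<Rightarrow> 'a" where e: "\<And>r. r < n \<Longrightarrow> e r * e r = 1"
    "\<And>r s. r < n \<Longrightarrow> s < n \<Longrightarrow> mat_prod n (map (s_bar n) kw) $$ (r, s) = (if r = word_perm kw s then e r else 0)"
    by blast
  have "word_perm kw = longest_perm n" using kw by (simp add: reduced_w0_def)
  moreover have "mat_prod n (map (s_bar n) kw :: 'a mat list) \<in> carrier_mat n n"
    by (rule mat_prod_carrier) auto
  ultimately have "w0_bar n = antidiag n e"
    unfolding w0_bar_def kw_def[symmetric]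
    by (intro eq_matI) (auto simp: e(2) antidiag_def longest_perm_def)
  with e(1) that show ?thesis by blast
qed

lemma torus_iff:
  "d \<in> torus n \<longleftrightarrow> d \<in> carrier_mat n n \<and> diagonal_mat d \<and> (\<forall>i<n. d $$ (i, i) dvd 1)" (is "_ \<longleftrightarrow> ?R")
proof
  assume d: "d \<in> torus n"
  then obtain V where V: "d \<in> carrier_mat n n" "diagonal_mat d" "V \<in> carrier_mat n n" "d * V = 1\<^sub>m n"
    by (auto simp: torus_def GL_iff)
  have "d $$ (i, i) dvd 1" if "i < n" for i
  proof -
    have "(\<Sum>k<n. d $$ (i, k) * V $$ (k, i)) = (\<Sum>k<n. if k = i then d $$ (i, i) * V $$ (i, i) else 0)"
      using V that by (intro sum.cong) (auto simp: diagonal_mat_def)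
    then have "(d * V) $$ (i, i) = d $$ (i, i) * V $$ (i, i)"
      using that by (simp add: mult_mat_index[OF V(1,3)])
    then show ?thesis using V(4) that by (metis dvd_triv_left index_one_mat(1))
  qed
  with V show ?R by blast
next
  assume R: ?R
  then obtain z where z: "\<And>i. i < n \<Longrightarrow> d $$ (i, i) * z i = 1"
    unfolding dvd_def by metis
  have d: "d = mat_diag n (\<lambda>i. d $$ (i, i))"
    using R by (intro eq_matI) (auto simp: mat_diag_def diagonal_mat_def)
  have "mat_diag n (\<lambda>i. d $$ (i, i)) * mat_diag n z = 1\<^sub>m n" "mat_diag n z * mat_diag n (\<lambda>i. d $$ (i, i)) = 1\<^sub>m n"
    unfolding mat_diag_diag using z by (auto simp: mat_diag_def mult.commute)
  then have "d * mat_diag n z = 1\<^sub>m n" "mat_diag n z * d = 1\<^sub>m n"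
    using d by simp_all
  with R show "d \<in> torus n" by (auto simp: torus_def GL_iff intro!: bexI[of _ "mat_diag n z"])
qed

lemma torus_mult_antidiag:
  assumes "d \<in> torus n"
  shows "d * antidiag n e = antidiag n (\<lambda>r. d $$ (r, r) * e r)"
proof (rule eq_matI)
  fix r s assume "r < dim_row (antidiag n (\<lambda>r. d $$ (r, r) * e r))" "s < dim_col (antidiag n (\<lambda>r. d $$ (r, r) * e r))"
  then show "(d * antidiag n e) $$ (r, s) = antidiag n (\<lambda>r. d $$ (r, r) * e r) $$ (r, s)"
    using assms by (subst antidiag_mult_right) (auto simp: torus_iff antidiag_def diagonal_mat_def)
qed (use assms in \<open>auto simp: torus_iff antidiag_def\<close>)

text \<open>Uniqueness in the Bruhat factorisation: the quotients \<open>A\<close> and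
  \<open>B\<close> of the unipotent factors satisfy \<open>A * C = C' * B\<close> with antidiagonal
  \<open>C\<close> and \<open>C'\<close>. These exchange upper and lower triangular, so
  \<open>A\<close> and \<open>B\<close> are the identity. This justifies the definite descriptions
  in \<open>hw\<close> and \<open>superpotential\<close>, over a field and over its dual
  numbers.\<close>

lemma Z_factors_unique:
  fixes b :: "'a::comm_ring_1 mat"
  assumes w0: "reduced_w0 n iw"
    and "Z_factors n b u1 d u2" "Z_factors n b u1' d' u2'"
  shows "u1 = u1' \<and> d = d' \<and> u2 = u2'"
proof -
  note ass = assoc_mult_mat[of _ n n _ n _ n] and mc = mult_carrier_mat[of _ n n _ n]
  obtain e :: "nat \<Rightarrow> 'a" where e: "\<And>r. r < n \<Longrightarrow> e r * e r = 1" "w0_bar n = antidiag n e"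
    by (rule w0_bar_antidiag[OF w0, where 'a = 'a]) blast
  from assms(2,3) have u: "u1 \<in> unipotent_up n" "u2 \<in> unipotent_up n" "u1' \<in> unipotent_up n" "u2' \<in> unipotent_up n"
    and d: "d \<in> torus n" "d' \<in> torus n"
    and b: "b = u1 * d * w0_bar n * u2" "b = u1' * d' * w0_bar n * u2'"
    by (simp_all only: Z_factors_def)
  define C C' where "C = antidiag n (\<lambda>r. d $$ (r, r) * e r)" and "C' = antidiag n (\<lambda>r. d' $$ (r, r) * e r)"
  have Cc: "C \<in> carrier_mat n n" "C' \<in> carrier_mat n n" by (simp_all add: C_def C'_def)
  obtain v1 where v1: "v1 \<in> unipotent_up n" "u1' * v1 = 1\<^sub>m n" "v1 * u1' = 1\<^sub>m n" using unipotent_up_inverse[OF u(3)] .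
  obtain v2 where v2: "v2 \<in> unipotent_up n" "u2 * v2 = 1\<^sub>m n" "v2 * u2 = 1\<^sub>m n" using unipotent_up_inverse[OF u(2)] .
  define A B where "A = v1 * u1" and "B = u2' * v2"
  have A: "A \<in> unipotent_up n" and B: "B \<in> unipotent_up n"
    using u v1 v2 by (auto simp: A_def B_def unipotent_up_mult)
  note cs = u[THEN unipotent_up_carrier] v1(1)[THEN unipotent_up_carrier] v2(1)[THEN unipotent_up_carrier]
    A[THEN unipotent_up_carrier] B[THEN unipotent_up_carrier] Cc
  have dc: "d \<in> carrier_mat n n" "d' \<in> carrier_mat n n" using d by (auto simp: torus_iff)
  have W: "(w0_bar n :: 'a mat) \<in> carrier_mat n n" unfolding e(2) by simp
  have dC: "d * w0_bar n = C" "d' * w0_bar n = C'"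
    by (simp_all only: C_def C'_def e(2) torus_mult_antidiag[OF d(1)] torus_mult_antidiag[OF d(2)])
  have bC: "b = u1 * C * u2" "b = u1' * C' * u2'"
    unfolding dC[symmetric] ass[OF cs(1) dc(1) W, symmetric] ass[OF cs(3) dc(2) W, symmetric] by fact+
  have "v1 * (u1 * C * u2) * v2 = A * C * (u2 * v2)" "v1 * (u1' * C' * u2') * v2 = v1 * u1' * C' * B"
    unfolding A_def B_def using cs by (simp_all only: ass mc)
  then have AC: "A * C = C' * B"
    unfolding bC[symmetric] using v1(3) v2(2) cs by simp
  have ent: "A $$ (r, n - 1 - s) * (d $$ (n - 1 - s, n - 1 - s) * e (n - 1 - s)) = d' $$ (r, r) * e r * B $$ (n - 1 - r, s)"
    if "r < n" "s < n" for r s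
    using arg_cong[OF AC, of "\<lambda>M. M $$ (r, s)"] that cs
    by (simp add: C_def C'_def antidiag_mult_left antidiag_mult_right del: index_mult_mat(1))
  have un: "d $$ (r, r) * e r dvd 1" "d' $$ (r, r) * e r dvd 1" if "r < n" for r
  proof -
    have "e r dvd 1" using e(1)[OF that] by (metis dvd_triv_left)
    then show "d $$ (r, r) * e r dvd 1" "d' $$ (r, r) * e r dvd 1"
      using d that mult_dvd_mono[of _ 1 "e r" 1] unfolding torus_iff by simp_all
  qed
  have A1: "A = 1\<^sub>m n"
  proof (rule eq_matI)
    fix i j assume ij: "i < dim_row (1\<^sub>m n)" "j < dim_col (1\<^sub>m n)"
    then have ij: "i < n" "j < n" by auto
    consider "i = j" | "j < i" | "i < j" by linarith
    then show "A $$ (i, j) = 1\<^sub>m n $$ (i, j)"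
    proof cases
      case 3
      have "B $$ (n - 1 - i, n - 1 - j) = 0"
        using B ij 3 cs by (intro upper_triangularD) (auto simp: unipotent_up_iff)
      with ent[of i "n - 1 - j"] ij have "A $$ (i, j) * (d $$ (j, j) * e j) = 0" by simp
      then have "A $$ (i, j) = 0" using un(1)[OF ij(2)] by (rule mult_unit_cancel)
      then show ?thesis using ij 3 by simp
    qed (use A ij cs in \<open>auto simp: unipotent_up_iff\<close>)
  qed (use cs in auto)
  have B1: "B = 1\<^sub>m n"
  proof (rule eq_matI)
    fix i j assume ij: "i < dim_row (1\<^sub>m n)" "j < dim_col (1\<^sub>m n)"
    then have ij: "i < n" "j < n" by auto
    consider "i = j" | "j < i" | "i < j" by linarith
    then show "B $$ (i, j) = 1\<^sub>m n $$ (i, j)"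
    proof cases
      case 3
      then have e1: "n - Suc i \<noteq> n - Suc j" using ij by linarith
      have "d' $$ (n - 1 - i, n - 1 - i) * e (n - 1 - i) * B $$ (i, j) = 0"
        using ent[of "n - 1 - i" j] ij 3 e1 by (simp add: A1)
      then have "B $$ (i, j) * (d' $$ (n - 1 - i, n - 1 - i) * e (n - 1 - i)) = 0" by (simp add: mult.commute)
      moreover have "d' $$ (n - 1 - i, n - 1 - i) * e (n - 1 - i) dvd 1"
        by (rule un(2)) (use ij in simp)
      ultimately have "B $$ (i, j) = 0" by (rule mult_unit_cancel)
      then show ?thesis using ij 3 by simp
    qed (use B ij cs in \<open>auto simp: unipotent_up_iff\<close>)
  qed (use cs in auto)
  have "u1' * v1 * u1 = u1' * A" unfolding A_def using cs by (simp only: ass)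
  then have u1: "u1 = u1'" using A1 v1 cs by simp
  have "u2' * (v2 * u2) = B * u2" unfolding B_def using cs by (simp only: ass)
  then have u2: "u2 = u2'" using B1 v2 cs by simp
  have "d = d'"
  proof (rule eq_matI)
    fix i j assume "i < dim_row d'" "j < dim_col d'"
    then have ij: "i < n" "j < n" using dc by auto
    show "d $$ (i, j) = d' $$ (i, j)"
    proof (cases "i = j")
      case True
      have "d $$ (i, i) * e i = d' $$ (i, i) * e i"
        using ent[of i "n - 1 - i"] ij by (simp add: A1 B1)
      then have "d $$ (i, i) * (e i * e i) = d' $$ (i, i) * (e i * e i)"
        by (simp only: mult.assoc[symmetric])
      then show ?thesis using e(1)[OF ij(1)] True by simp
    qed (use d ij in \<open>auto simp: torus_iff diagonal_mat_def\<close>)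
  qed (use dc in auto)
  with u1 u2 show ?thesis by simp
qed

section \<open>Critical points commute with the shift matrix\<close>

definition dual_mat :: "'a::comm_ring_1 mat \<Rightarrow> 'a mat \<Rightarrow> 'a dual_num mat" where
  "dual_mat P Q = mat (dim_row P) (dim_col P) (\<lambda>ij. Dual (P $$ ij) (Q $$ ij))"

lemma dual_mat_carrier [simp]: "P \<in> carrier_mat n m \<Longrightarrow> dual_mat P Q \<in> carrier_mat n m"
  by (auto simp: dual_mat_def)

lemma dual_mat_index [simp]:
  "P \<in> carrier_mat n m \<Longrightarrow> i < n \<Longrightarrow> j < m \<Longrightarrow> dual_mat P Q $$ (i, j) = Dual (P $$ (i, j)) (Q $$ (i, j))"
  by (auto simp: dual_mat_def)

lemma sum_Dual: "(\<Sum>k\<in>I. Dual (f k) (g k)) = Dual (sum f I) (sum g I)"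
  by (induction I rule: infinite_finite_induct) (auto simp: zero_dual_num_def plus_dual_num_def)

lemma dual_mat_mult:
  assumes "P \<in> carrier_mat n n" "Q \<in> carrier_mat n n" "P' \<in> carrier_mat n n" "Q' \<in> carrier_mat n n"
  shows "dual_mat P Q * dual_mat P' Q' = dual_mat (P * P') (P * Q' + Q * P')"
proof (rule eq_matI)
  fix i j assume "i < dim_row (dual_mat (P * P') (P * Q' + Q * P'))" "j < dim_col (dual_mat (P * P') (P * Q' + Q * P'))"
  then have ij: "i < n" "j < n" using assms by (auto simp: dual_mat_def)
  have m: "P * P' \<in> carrier_mat n n" using assms by simp
  have "(dual_mat P Q * dual_mat P' Q') $$ (i, j) =
      (\<Sum>k<n. Dual (P $$ (i, k) * P' $$ (k, j)) (P $$ (i, k) * Q' $$ (k, j) + Q $$ (i, k) * P' $$ (k, j)))"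
    using assms ij by (subst mult_mat_index[of _ n n _ n]) (auto simp: times_dual_num_def intro!: sum.cong)
  also have "\<dots> = Dual ((P * P') $$ (i, j)) ((P * Q') $$ (i, j) + (Q * P') $$ (i, j))"
    unfolding sum_Dual sum.distrib using assms ij by (simp add: mult_mat_index[of _ n n _ n] del: index_mult_mat(1))
  also have "\<dots> = dual_mat (P * P') (P * Q' + Q * P') $$ (i, j)"
    using assms ij by (simp add: dual_mat_index[OF m ij] del: index_mult_mat(1))
  finally show "(dual_mat P Q * dual_mat P' Q') $$ (i, j) = dual_mat (P * P') (P * Q' + Q * P') $$ (i, j)" .
qed (use assms in \<open>auto simp: dual_mat_def\<close>)

lemma dual_mat_one: "dual_mat (1\<^sub>m n) (0\<^sub>m n n) = 1\<^sub>m n"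
  by (rule eq_matI) (auto simp: dual_mat_def one_dual_num_def zero_dual_num_def)

text \<open>If \<open>V\<close> is inverse to \<open>P\<close>, then
  \<open>V - \<epsilon> V Q V\<close> is inverse to \<open>P + \<epsilon> Q\<close>.\<close>

lemma dual_mat_GL:
  assumes "P \<in> GL n" and Q: "Q \<in> carrier_mat n n"
  shows "dual_mat P Q \<in> GL n"
proof -
  note ass = assoc_mult_mat[of _ n n _ n _ n]
  obtain V where V: "P \<in> carrier_mat n n" "V \<in> carrier_mat n n" "P * V = 1\<^sub>m n" "V * P = 1\<^sub>m n"
    using assms by (auto simp: GL_iff)
  let ?R = "- (V * (Q * V))"
  have R: "?R \<in> carrier_mat n n" using V Q by simp
  have QV: "Q * V \<in> carrier_mat n n" "V * Q \<in> carrier_mat n n" using V Q by auto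
  have "P * (V * (Q * V)) = P * V * (Q * V)" using V(1,2) Q by (simp only: ass mult_carrier_mat[of _ n n _ n])
  then have "P * ?R = - (Q * V)" unfolding V(3) left_mult_one_mat[OF QV(1)] using V Q by simp
  then have 1: "P * ?R + Q * V = 0\<^sub>m n n" using uminus_l_inv_mat[OF QV(1)] by simp
  have "V * (Q * V) * P = V * Q * (V * P)" using V(1,2) Q by (simp only: ass mult_carrier_mat[of _ n n _ n])
  then have "?R * P = - (V * Q)" unfolding V(4) right_mult_one_mat[OF QV(2)] using V Q by simp
  moreover have "M + - M = 0\<^sub>m n n" if "M \<in> carrier_mat n n" for M :: "'a mat"
    by (rule eq_matI) (use that in auto)
  ultimately have 2: "V * Q + ?R * P = 0\<^sub>m n n" using QV by simp
  have "dual_mat P Q * dual_mat V ?R = 1\<^sub>m n" "dual_mat V ?R * dual_mat P Q = 1\<^sub>m n"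
    using V by (simp_all only: dual_mat_mult[OF V(1) Q V(2) R] dual_mat_mult[OF V(2) R V(1) Q] 1 2 dual_mat_one)
  then show ?thesis unfolding GL_iff using V by (intro conjI bexI[of _ "dual_mat V ?R"]) auto
qed

lemma dual_mat_upper_triangular:
  assumes "P \<in> carrier_mat n n" "Q \<in> carrier_mat n n" "upper_triangular P" "upper_triangular Q"
  shows "upper_triangular (dual_mat P Q)"
  using assms by (intro upper_triangularI) (auto simp: dual_mat_def zero_dual_num_def)

lemma dual_mat_unipotent_up:
  assumes "u \<in> unipotent_up n" "A \<in> carrier_mat n n" "upper_triangular A" "\<And>i. i < n \<Longrightarrow> A $$ (i, i) = 0"
  shows "dual_mat u A \<in> unipotent_up n"
  using assms unfolding unipotent_up_iff
  by (auto intro!: dual_mat_GL dual_mat_upper_triangular[of _ n] simp: dual_mat_index[of _ n n] GL_carrier[of u] one_dual_num_def)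

lemma dual_mat_s_bar: "dual_mat (s_bar n i) (0\<^sub>m n n) = s_bar n i"
proof (rule eq_matI)
  fix r s assume "r < dim_row (s_bar n i :: 'a dual_num mat)" "s < dim_col (s_bar n i :: 'a dual_num mat)"
  then have "r < n" "s < n" using s_bar_carrier[of n i, where 'a = "'a dual_num"] by auto
  then show "dual_mat (s_bar n i) (0\<^sub>m n n) $$ (r, s) = (s_bar n i :: 'a dual_num mat) $$ (r, s)"
    by (simp add: dual_mat_index[OF s_bar_carrier] s_bar_index zero_dual_num_def one_dual_num_def uminus_dual_num_def)
qed (auto simp: dual_mat_def s_bar_def sl2_embed_def)

text \<open>The word chosen in \<open>w0_bar\<close> does not depend on the ring, and every
  \<open>s_bar\<close> has constant entries.\<close>

lemma dual_mat_w0_bar: "dual_mat (w0_bar n) (0\<^sub>m n n) = w0_bar n"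
proof -
  have C: "mat_prod n (map (s_bar n) iw :: 'a mat list) \<in> carrier_mat n n" for iw
    by (rule mat_prod_carrier) auto
  have "dual_mat (mat_prod n (map (s_bar n) iw :: 'a mat list)) (0\<^sub>m n n) = mat_prod n (map (s_bar n) iw)" for iw
  proof (induction iw)
    case (Cons i iw)
    show ?case
      using C[of iw] s_bar_carrier[of n i, where 'a = 'a]
      by (simp add: Cons[symmetric] dual_mat_s_bar[of n i, symmetric] dual_mat_mult[of _ n] right_mult_zero_mat[of _ n n] left_mult_zero_mat[of _ n n])
  qed (simp add: dual_mat_one)
  then show ?thesis by (simp add: w0_bar_def)
qed

text \<open>First-order deformation of the factorisation: \<open>u1\<close> is multiplied by
  \<open>1 + \<epsilon> A\<close> on the right and \<open>u2\<close> by
  \<open>1 + \<epsilon> B\<close> on the left, while the torus part, and with it the highest weight,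
  stays fixed.\<close>

lemma Z_factors_dual_mat:
  fixes u1 d u2 A B :: "'a::comm_ring_1 mat"
  assumes Z: "Z_factors n p u1 d u2" and C: "C = d * w0_bar n"
    and "(w0_bar n :: 'a mat) \<in> carrier_mat n n"
    and A: "A \<in> carrier_mat n n" "upper_triangular A" "\<And>i. i < n \<Longrightarrow> A $$ (i, i) = 0"
    and B: "B \<in> carrier_mat n n" "upper_triangular B" "\<And>i. i < n \<Longrightarrow> B $$ (i, i) = 0"
  shows "Z_factors n (dual_mat p (u1 * (A * C + C * B) * u2)) (dual_mat u1 (u1 * A))
    (map_mat (\<lambda>x. Dual x 0) d) (dual_mat u2 (B * u2))"
proof -
  note ass = assoc_mult_mat[of _ n n _ n _ n]
  from Z have u: "u1 \<in> unipotent_up n" "u2 \<in> unipotent_up n" and d: "d \<in> torus n"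
    and p: "p = u1 * d * w0_bar n * u2" by (simp_all only: Z_factors_def)
  note uc = u[THEN unipotent_up_carrier]
  have dc: "d \<in> carrier_mat n n" using d by (simp add: torus_iff)
  have Cc: "C \<in> carrier_mat n n" using C dc assms(3) by simp
  have up: "upper_triangular u1" "upper_triangular u2" using u by (auto simp: unipotent_up_iff)
  have dd: "map_mat (\<lambda>x. Dual x 0) d = dual_mat d (0\<^sub>m n n)"
    by (rule eq_matI) (use dc in \<open>auto simp: dual_mat_def\<close>)
  have "dual_mat d (0\<^sub>m n n) \<in> torus n"
    using d dc dual_mat_GL[of d n "0\<^sub>m n n"] unfolding torus_def
    by (auto simp: diagonal_mat_def zero_dual_num_def dual_mat_index[of _ n n] carrier_matD[OF dual_mat_carrier[OF dc]])
  moreover have "dual_mat u1 (u1 * A) \<in> unipotent_up n"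
    using A up u uc upper_triangular_mult[OF uc(1) A(1) up(1) A(2)] upper_triangular_mult_index[OF uc(1) A(1) up(1) A(2)]
    by (intro dual_mat_unipotent_up) (auto simp del: index_mult_mat(1))
  moreover have "dual_mat u2 (B * u2) \<in> unipotent_up n"
    using B up u uc upper_triangular_mult[OF B(1) uc(2) B(2) up(2)] upper_triangular_mult_index[OF B(1) uc(2) B(2) up(2)]
    by (intro dual_mat_unipotent_up) (auto simp del: index_mult_mat(1))
  moreover have "dual_mat u1 (u1 * A) * dual_mat d (0\<^sub>m n n) * w0_bar n * dual_mat u2 (B * u2) =
      dual_mat p (u1 * (A * C + C * B) * u2)"
  proof -
    have e: "u1 * C * (B * u2) + u1 * A * C * u2 = u1 * (A * C + C * B) * u2"
    proof -
      have "u1 * (A * C + C * B) * u2 = u1 * (A * C) * u2 + u1 * (C * B) * u2"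
        using A B uc Cc by (simp add: mult_add_distrib_mat[of _ n n _ n] add_mult_distrib_mat[of _ n n _ _ n])
      also have "\<dots> = u1 * (C * B) * u2 + u1 * (A * C) * u2"
        using A B uc Cc by (intro comm_add_mat[of _ n n]) auto
      finally show ?thesis using A B uc Cc by (simp add: ass)
    qed
    have p': "p = u1 * C * u2" unfolding p C using uc dc assms(3) by (simp add: ass)
    have "dual_mat u1 (u1 * A) * dual_mat d (0\<^sub>m n n) * w0_bar n * dual_mat u2 (B * u2)
        = dual_mat u1 (u1 * A) * (dual_mat d (0\<^sub>m n n) * dual_mat (w0_bar n) (0\<^sub>m n n)) * dual_mat u2 (B * u2)"
      unfolding dual_mat_w0_bar[symmetric] using A B uc dc assms(3) by (simp add: ass)
    also have "dual_mat d (0\<^sub>m n n) * dual_mat (w0_bar n) (0\<^sub>m n n) = dual_mat C (0\<^sub>m n n)"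
      using dc assms(3) by (simp add: dual_mat_mult[of _ n] C)
    also have "dual_mat u1 (u1 * A) * dual_mat C (0\<^sub>m n n) * dual_mat u2 (B * u2) =
        dual_mat (u1 * C * u2) (u1 * C * (B * u2) + u1 * A * C * u2)"
      using A B uc Cc by (simp add: dual_mat_mult[of _ n])
    finally show ?thesis unfolding e p' .
  qed
  ultimately show ?thesis using dd by (simp add: Z_factors_def)
qed

section \<open>The trace pairing and the shift matrix\<close>

definition mat_trace :: "nat \<Rightarrow> 'a::comm_ring_1 mat \<Rightarrow> 'a" where
  "mat_trace n A = (\<Sum>i<n. A $$ (i, i))"

lemma mat_trace_mult:
  assumes "A \<in> carrier_mat n n" "B \<in> carrier_mat n n"
  shows "mat_trace n (A * B) = (\<Sum>i<n. \<Sum>k<n. A $$ (i, k) * B $$ (k, i))"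
  unfolding mat_trace_def using assms by (intro sum.cong) (simp_all add: mult_mat_index[of _ n n _ n] del: index_mult_mat(1))

lemma mat_trace_mult_commute:
  assumes "A \<in> carrier_mat n n" "B \<in> carrier_mat n n"
  shows "mat_trace n (A * B) = mat_trace n (B * A)"
  unfolding mat_trace_mult[OF assms] mat_trace_mult[OF assms(2,1)]
  by (subst sum.swap) (simp add: mult.commute)

definition shift_mat :: "nat \<Rightarrow> 'a::comm_ring_1 mat" where
  "shift_mat n = mat n n (\<lambda>(r, s). of_bool (r = Suc s))"

lemma shift_mat_carrier [simp]: "shift_mat n \<in> carrier_mat n n"
  by (simp add: shift_mat_def)

lemma shift_mat_mult_index:
  assumes "A \<in> carrier_mat n n" "r < n" "s < n"
  shows "(shift_mat n * A) $$ (r, s) = (if r = 0 then 0 else A $$ (r - 1, s))"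
proof -
  have "(\<Sum>k<n. shift_mat n $$ (r, k) * A $$ (k, s)) = (\<Sum>k<n. if k = r - 1 then (if r = 0 then 0 else A $$ (r - 1, s)) else 0)"
    using assms by (intro sum.cong) (auto simp: shift_mat_def)
  then show ?thesis using assms by (simp add: mult_mat_index[OF shift_mat_carrier assms])
qed

lemma mult_shift_mat_index:
  assumes "A \<in> carrier_mat n n" "r < n" "Suc s < n"
  shows "(A * shift_mat n) $$ (r, s) = A $$ (r, Suc s)"
proof -
  have "(\<Sum>k<n. A $$ (r, k) * shift_mat n $$ (k, s)) = (\<Sum>k<n. if k = Suc s then A $$ (r, Suc s) else 0)"
    using assms by (intro sum.cong) (auto simp: shift_mat_def)
  then show ?thesis using assms by (simp add: mult_mat_index[OF assms(1) shift_mat_carrier assms(2)])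
qed

text \<open>This turns the superpotential into a trace pairing, to which cyclicity applies.\<close>

lemma mat_trace_shift_mat:
  assumes "A \<in> carrier_mat n n"
  shows "mat_trace n (shift_mat n * A) = superchar n A"
proof (cases n)
  case (Suc k)
  have "mat_trace n (shift_mat n * A) = (\<Sum>i<Suc k. if i = 0 then 0 else A $$ (i - 1, i))"
    unfolding mat_trace_def Suc[symmetric] using assms
    by (intro sum.cong) (auto simp: shift_mat_mult_index simp del: index_mult_mat(1))
  also have "\<dots> = (\<Sum>i<k. A $$ (i, Suc i))" unfolding sum.lessThan_Suc_shift by simp
  finally show ?thesis by (simp add: superchar_def Suc)
qed (simp add: mat_trace_def superchar_def)

text \<open>The term \<open>k\<close> of the sum can be nonzero only if \<open>i \<le> k\<close> and
  \<open>k - 1 \<le> j\<close>. With \<open>j < i\<close> this leaves \<open>k = i = Suc j\<close>,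
  where both diagonal entries are 1.\<close>

lemma unipotent_shift_unipotent_index:
  assumes u: "u \<in> unipotent_up n" and v: "v \<in> unipotent_up n" and ij: "j < i" "i < n"
  shows "(u * shift_mat n * v) $$ (i, j) = of_bool (i = Suc j)"
proof -
  note c = u[THEN unipotent_up_carrier] v[THEN unipotent_up_carrier]
  have up: "upper_triangular u" "upper_triangular v" "u $$ (i, i) = 1" "v $$ (j, j) = 1"
    using u v ij by (auto simp: unipotent_up_iff)
  have m: "shift_mat n * v \<in> carrier_mat n n" using c by (intro mult_carrier_mat[of _ n n _ n]) auto
  have "(u * shift_mat n * v) $$ (i, j) = (\<Sum>k<n. u $$ (i, k) * (shift_mat n * v) $$ (k, j))"
    using c ij m by (simp add: assoc_mult_mat[of _ n n _ n _ n] mult_mat_index[of _ n n _ n] del: index_mult_mat(1))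
  also have "\<dots> = (\<Sum>k<n. if k = i then of_bool (i = Suc j) else 0)"
  proof (rule sum.cong[OF HOL.refl])
    fix k assume "k \<in> {..<n}"
    then have k: "k < n" by simp
    consider "k < i" | "k = i" | "i < k" by linarith
    then show "u $$ (i, k) * (shift_mat n * v) $$ (k, j) = (if k = i then of_bool (i = Suc j) else 0)"
      by cases (use c up ij k upper_triangularD[OF up(1), of k i] upper_triangularD[OF up(2), of j "k - 1"]
          in \<open>cases "i = Suc j"; auto simp: shift_mat_mult_index simp del: index_mult_mat(1)\<close>)+
  qed
  also have "\<dots> = of_bool (i = Suc j)" using ij by simp
  finally show ?thesis .
qed

lemma antidiag_conj_index:
  assumes "A \<in> carrier_mat n n" "r < n" "s < n"
  shows "(antidiag n c * A * antidiag n c') $$ (r, s) = c r * A $$ (n - 1 - r, n - 1 - s) * c' (n - 1 - s)"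
  using assms mult_carrier_mat[OF antidiag_carrier assms(1), of c]
  by (simp add: antidiag_mult_right antidiag_mult_left del: index_mult_mat(1))

lemma upper_triangular_antidiag_conj:
  assumes "A \<in> carrier_mat n n" "\<And>i j. i < j \<Longrightarrow> j < n \<Longrightarrow> A $$ (i, j) = 0"
  shows "upper_triangular (antidiag n c * A * antidiag n c')"
proof (rule upper_triangularI)
  fix i j assume "j < i" "i < dim_row (antidiag n c * A * antidiag n c')"
  then show "(antidiag n c * A * antidiag n c') $$ (i, j) = 0"
    using assms(2)[of "n - 1 - i" "n - 1 - j"]
    by (subst antidiag_conj_index[OF assms(1)]) (auto simp: carrier_matD[OF antidiag_carrier])
qed

lemma upper_triangular_conj:
  assumes "A \<in> carrier_mat n n" "B \<in> carrier_mat n n" "D \<in> carrier_mat n n"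
    and "upper_triangular A" "upper_triangular B" "upper_triangular D"
  shows "upper_triangular (A * B * D)"
    and "i < n \<Longrightarrow> (A * B * D) $$ (i, i) = A $$ (i, i) * B $$ (i, i) * D $$ (i, i)"
  using assms upper_triangular_mult[OF assms(1,2,4,5)] mult_carrier_mat[OF assms(1,2)]
  by (auto simp: upper_triangular_mult upper_triangular_mult_index[of _ n] mult.assoc simp del: index_mult_mat(1))

lemma mult_inverse_cancel_left:
  fixes A :: "'a::comm_ring_1 mat"
  assumes "A * B = 1\<^sub>m n" "A \<in> carrier_mat n n" "B \<in> carrier_mat n n" "X \<in> carrier_mat n n"
  shows "A * (B * X) = X"
  using assms by (simp only: assoc_mult_mat[of A n n B n X n, symmetric] left_mult_one_mat[of X n n])

text \<open>The assumption \<open>stat\<close> says that the superpotential is stationary along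
  first-order deformations of \<open>p\<close> that stay lower triangular. Testing it on
  deformations \<open>p * X'\<close> with \<open>X'\<close> lower triangular determines the part of
  \<open>K\<close> above the diagonal.\<close>

lemma stationary_imp_commutes_shift:
  fixes u1 u2 p :: "'a::field mat"
  assumes u: "u1 \<in> unipotent_up n" "u2 \<in> unipotent_up n"
    and c: "\<And>r. r < n \<Longrightarrow> c r \<noteq> 0" and p: "p = u1 * antidiag n c * u2"
    and low: "p \<in> borel_low n"
    and stat: "\<And>A B. A \<in> carrier_mat n n \<Longrightarrow> upper_triangular A \<Longrightarrow> (\<And>i. i < n \<Longrightarrow> A $$ (i, i) = 0) \<Longrightarrow>
      B \<in> carrier_mat n n \<Longrightarrow> upper_triangular B \<Longrightarrow> (\<And>i. i < n \<Longrightarrow> B $$ (i, i) = 0) \<Longrightarrow>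
      upper_triangular (transpose_mat (u1 * (A * antidiag n c + antidiag n c * B) * u2)) \<Longrightarrow>
      superchar n A + superchar n B = 0"
  shows "p * shift_mat n = shift_mat n * p"
proof -
  note ass = assoc_mult_mat[of _ n n _ n _ n] and mc = mult_carrier_mat[of _ n n _ n]
  note dist = mult_add_distrib_mat[of _ n n _ n] add_mult_distrib_mat[of _ n n _ _ n]
  note [simp] = minus_carrier_mat
  define C where "C = antidiag n c"
  define c' where "c' r = inverse (c (n - 1 - r))" for r
  define C' where "C' = antidiag n c'"
  define S where "S = (shift_mat n :: 'a mat)"
  obtain v1 where v1: "v1 \<in> unipotent_up n" "u1 * v1 = 1\<^sub>m n" "v1 * u1 = 1\<^sub>m n" using unipotent_up_inverse[OF u(1)] .
  obtain v2 where v2: "v2 \<in> unipotent_up n" "u2 * v2 = 1\<^sub>m n" "v2 * u2 = 1\<^sub>m n" using unipotent_up_inverse[OF u(2)] .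
  have CC: "C * C' = 1\<^sub>m n" "C' * C = 1\<^sub>m n"
    unfolding C_def C'_def by (auto intro!: antidiag_inverse simp: c'_def c)
  have cs: "u1 \<in> carrier_mat n n" "u2 \<in> carrier_mat n n" "v1 \<in> carrier_mat n n" "v2 \<in> carrier_mat n n"
    "C \<in> carrier_mat n n" "C' \<in> carrier_mat n n" "S \<in> carrier_mat n n"
    using u v1 v2 by (auto simp: unipotent_up_carrier C_def C'_def S_def)
  have up: "upper_triangular u1" "upper_triangular u2" "upper_triangular v1" "upper_triangular v2"
    and one: "\<And>i. i < n \<Longrightarrow> u1 $$ (i, i) = 1" "\<And>i. i < n \<Longrightarrow> u2 $$ (i, i) = 1" "\<And>i. i < n \<Longrightarrow> v1 $$ (i, i) = 1" "\<And>i. i < n \<Longrightarrow> v2 $$ (i, i) = 1"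
    using u v1 v2 by (auto simp: unipotent_up_iff)
  have pC: "p = u1 * C * u2" by (simp add: p C_def)
  have pc: "p \<in> carrier_mat n n" unfolding pC using cs by simp
  have plow: "upper_triangular (transpose_mat p)" using low by (simp add: borel_low_def)
  \<comment> \<open>Under the trace pairing \<open>G\<close> represents the functional that sends
    \<open>Y\<close> to the sum of the characters of \<open>Y\<close> and
    \<open>C * Y * C'\<close>.\<close>
  define G where "G = S + C' * S * C"
  have Gc: "G \<in> carrier_mat n n" using cs by (simp add: G_def)
  define K where "K = v2 * G * u2"
  have Kc: "K \<in> carrier_mat n n" using cs Gc by (simp add: K_def)
  define H where "H = mat_diag n (\<lambda>i. K $$ (i, i))"
  have Hc: "H \<in> carrier_mat n n" by (simp add: H_def)
  have Hup: "upper_triangular H" by (auto simp: H_def mat_diag_def)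
  define J where "J = v2 * H * u2"
  have Jc: "J \<in> carrier_mat n n" using cs Hc by (simp add: J_def)
  \<comment> \<open>A strictly lower \<open>X\<close> becomes an admissible direction only after a
    diagonal correction \<open>D\<close>; the trace of \<open>K * D\<close> is what \<open>J\<close>
    accounts for.\<close>
  have tr: "mat_trace n (K * X) = mat_trace n (J * X)"
    if Xc: "X \<in> carrier_mat n n" and X0: "\<And>i j. i \<le> j \<Longrightarrow> j < n \<Longrightarrow> X $$ (i, j) = 0" for X
  proof -
    define E where "E = u2 * X * v2"
    have Ec: "E \<in> carrier_mat n n" using cs Xc by (simp add: E_def)
    define D where "D = mat_diag n (\<lambda>i. E $$ (i, i))"
    have Dc: "D \<in> carrier_mat n n" by (simp add: D_def)
    have Dup: "upper_triangular D" by (auto simp: D_def mat_diag_def)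
    \<comment> \<open>\<open>D\<close> is chosen so that \<open>Y\<close>, the conjugate of
      \<open>X'\<close> by \<open>u2\<close>, has zero diagonal; conjugation by the unipotent
      \<open>u2\<close> does not change the diagonal of \<open>D\<close>.\<close>
    define X' where "X' = X - D"
    have X'c: "X' \<in> carrier_mat n n" unfolding X'_def by (rule minus_carrier_mat[OF Dc])
    define Y where "Y = u2 * X' * v2"
    have Yc: "Y \<in> carrier_mat n n" using cs X'c by (simp add: Y_def)
    have YE: "Y = E - u2 * D * v2" unfolding Y_def X'_def E_def using cs Xc Dc
      by (simp add: mult_minus_distrib_mat[of _ n n _ n] minus_mult_distrib_mat[of _ n n _ _ n])
    have Y0: "Y $$ (i, i) = 0" if "i < n" for i
    proof -
      have "(u2 * D * v2) $$ (i, i) = E $$ (i, i)"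
        using upper_triangular_conj(2)[OF cs(2) Dc cs(4) up(2) Dup up(4) that] that one by (simp add: D_def mat_diag_def)
      then show ?thesis unfolding YE using that cs Dc Ec by (simp del: index_mult_mat(1))
    qed
    \<comment> \<open>The strictly upper part of \<open>Y\<close> is \<open>B\<close>; the strictly
      lower part becomes strictly upper after conjugation by \<open>C\<close>. As \<open>Y\<close>
      has zero diagonal, nothing of it is lost.\<close>
    define A where "A = mat n n (\<lambda>(r, s). if r < s then (C * Y * C') $$ (r, s) else 0)"
    define B where "B = mat n n (\<lambda>(r, s). if r < s then Y $$ (r, s) else 0)"
    have AB: "A \<in> carrier_mat n n" "upper_triangular A" "\<And>i. i < n \<Longrightarrow> A $$ (i, i) = 0"
      "B \<in> carrier_mat n n" "upper_triangular B" "\<And>i. i < n \<Longrightarrow> B $$ (i, i) = 0"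
      by (auto simp: A_def B_def)
    have CYC: "(C * Y * C') $$ (r, s) = c r * Y $$ (n - 1 - r, n - 1 - s) * inverse (c s)" if "r < n" "s < n" for r s
      using antidiag_conj_index[OF Yc that, of c c'] that by (simp add: C_def C'_def c'_def)
    have "A * C + C * B = C * Y"
    proof (rule eq_matI)
      fix r s assume "r < dim_row (C * Y)" "s < dim_col (C * Y)"
      then have rs: "r < n" "s < n" using cs Yc by auto
      have "(A * C + C * B) $$ (r, s) = A $$ (r, n - 1 - s) * c (n - 1 - s) + c r * B $$ (n - 1 - r, s)"
        using rs AB cs by (simp add: C_def antidiag_mult_left antidiag_mult_right carrier_matD[OF antidiag_carrier] del: index_mult_mat(1))
      also have "\<dots> = c r * Y $$ (n - 1 - r, s)"
      proof -
        consider "r < n - 1 - s" "\<not> n - 1 - r < s" | "s = n - 1 - r" "\<not> r < n - 1 - s" "\<not> n - 1 - r < s"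
          | "\<not> r < n - 1 - s" "n - 1 - r < s" using rs by linarith
        then show ?thesis
        proof cases
          case 1
          then show ?thesis using rs c[of "n - 1 - s"] CYC[of r "n - 1 - s"] by (simp add: A_def B_def)
        next
          case 2
          then show ?thesis using rs Y0[of "n - 1 - r"] by (simp add: A_def B_def)
        next
          case 3
          then show ?thesis using rs by (simp add: A_def B_def)
        qed
      qed
      also have "\<dots> = (C * Y) $$ (r, s)" using rs Yc by (simp add: C_def antidiag_mult_left del: index_mult_mat(1))
      finally show "(A * C + C * B) $$ (r, s) = (C * Y) $$ (r, s)" .
    qed (use cs AB Yc in auto)
    moreover have "u1 * (C * Y) * u2 = p * X'"
      unfolding Y_def pC using cs X'c by (simp add: ass v2(3))
    moreover have "upper_triangular (transpose_mat (p * X'))"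
    proof -
      have "upper_triangular (transpose_mat X')"
        using X0 Xc Dc by (intro upper_triangularI) (auto simp: X'_def D_def mat_diag_def)
      then show ?thesis using pc plow X'c
        by (auto simp: transpose_mult[of _ n n _ n] intro!: upper_triangular_mult)
    qed
    ultimately have "superchar n A + superchar n B = 0"
      by (intro stat AB) (simp_all add: C_def)
    moreover have "superchar n A = superchar n (C * Y * C')" "superchar n B = superchar n Y"
      unfolding superchar_def by (auto intro!: sum.cong simp: A_def B_def simp del: index_mult_mat(1))
    moreover have "superchar n (C * Y * C') = mat_trace n (C' * S * C * Y)"
    proof -
      have "superchar n (C * Y * C') = mat_trace n (S * (C * Y * C'))"
        using cs Yc by (simp add: S_def mat_trace_shift_mat)
      also have "\<dots> = mat_trace n ((S * C * Y) * C')" using cs Yc by (simp add: ass)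
      also have "\<dots> = mat_trace n (C' * (S * C * Y))" using cs Yc by (intro mat_trace_mult_commute) auto
      finally show ?thesis using cs Yc by (simp add: ass)
    qed
    moreover have "superchar n Y = mat_trace n (S * Y)" using Yc by (simp add: S_def mat_trace_shift_mat)
    moreover have "mat_trace n (G * Y) = mat_trace n (S * Y) + mat_trace n (C' * S * C * Y)"
      unfolding G_def using cs Yc by (simp add: dist mat_trace_def sum.distrib)
    ultimately have "mat_trace n (G * Y) = 0" by (simp add: add.commute)
    moreover have "mat_trace n (G * Y) = mat_trace n (K * X')"
    proof -
      have "mat_trace n (G * Y) = mat_trace n ((G * u2 * X') * v2)" unfolding Y_def using cs Gc X'c by (simp add: ass)
      also have "\<dots> = mat_trace n (v2 * (G * u2 * X'))" using cs Gc X'c by (intro mat_trace_mult_commute) auto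
      finally show ?thesis unfolding K_def using cs Gc X'c by (simp add: ass)
    qed
    moreover have "mat_trace n (K * X') = mat_trace n (K * X) - mat_trace n (K * D)"
      unfolding X'_def using Kc Xc Dc by (simp add: mult_minus_distrib_mat[of _ n n _ n] mat_trace_def sum_subtractf)
    moreover have "mat_trace n (K * D) = mat_trace n (H * E)"
    proof -
      have "mat_trace n (K * D) = (\<Sum>i<n. \<Sum>k<n. if k = i then K $$ (i, i) * E $$ (i, i) else 0)"
        unfolding mat_trace_mult[OF Kc Dc] by (intro sum.cong) (auto simp: D_def mat_diag_def)
      moreover have "mat_trace n (H * E) = (\<Sum>i<n. \<Sum>k<n. if k = i then K $$ (i, i) * E $$ (i, i) else 0)"
        unfolding mat_trace_mult[OF Hc Ec] by (intro sum.cong) (auto simp: H_def mat_diag_def)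
      ultimately show ?thesis by simp
    qed
    moreover have "mat_trace n (H * E) = mat_trace n (J * X)"
    proof -
      have "mat_trace n (H * E) = mat_trace n ((H * u2 * X) * v2)" unfolding E_def using cs Hc Xc by (simp add: ass)
      also have "\<dots> = mat_trace n (v2 * (H * u2 * X))" using cs Hc Xc by (intro mat_trace_mult_commute) auto
      finally show ?thesis unfolding J_def using cs Hc Xc by (simp add: ass)
    qed
    ultimately show ?thesis by simp
  qed
  have upper: "K $$ (i, j) = J $$ (i, j)" if "i < j" "j < n" for i j
  proof -
    define X where "X = mat n n (\<lambda>(r, s). of_bool (r = j \<and> s = i) :: 'a)"
    have Xc: "X \<in> carrier_mat n n" by (simp add: X_def)
    have "mat_trace n (M * X) = M $$ (i, j)" if M: "M \<in> carrier_mat n n" for M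
    proof -
      have "mat_trace n (M * X) = (\<Sum>r<n. \<Sum>k<n. if k = j then if r = i then M $$ (i, j) else 0 else 0)"
        unfolding mat_trace_mult[OF M Xc] by (intro sum.cong) (auto simp: X_def)
      then show ?thesis using \<open>i < j\<close> \<open>j < n\<close> by simp
    qed
    moreover have "mat_trace n (K * X) = mat_trace n (J * X)"
      by (rule tr[OF Xc]) (use that in \<open>auto simp: X_def\<close>)
    ultimately show ?thesis using Kc Jc by simp
  qed
  have Jup: "upper_triangular J" and Jd: "\<And>i. i < n \<Longrightarrow> J $$ (i, i) = K $$ (i, i)"
    unfolding J_def using upper_triangular_conj[OF cs(4) Hc cs(2) up(4) Hup up(2)] one
    by (simp_all add: H_def mat_diag_def)
  have CSC: "upper_triangular (C' * S * C)" "upper_triangular (C * S * C')"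
    unfolding C_def C'_def by (auto intro!: upper_triangular_antidiag_conj simp: S_def shift_mat_def)
  \<comment> \<open>Above the diagonal this is \<open>upper\<close>, and on it the choice of
    \<open>H\<close>. Below it \<open>C' * S * C\<close> contributes nothing, being the antidiagonal
    conjugate of a lower triangular matrix.\<close>
  have KJ: "K = S + J"
  proof (rule eq_matI)
    fix i j assume "i < dim_row (S + J)" "j < dim_col (S + J)"
    then have ij: "i < n" "j < n" using Jc by auto
    consider "i < j" | "i = j" | "j < i" by linarith
    then show "K $$ (i, j) = (S + J) $$ (i, j)"
    proof cases
      case 1
      then show ?thesis using ij upper Jc by (simp add: S_def shift_mat_def)
    next
      case 2
      then show ?thesis using ij Jd Jc by (simp add: S_def shift_mat_def)
    next
      case 3
      have C3: "C' * S * C \<in> carrier_mat n n" using cs by simp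
      have "K = v2 * S * u2 + v2 * (C' * S * C) * u2"
        unfolding K_def G_def using cs by (simp add: dist)
      moreover have "(v2 * S * u2) $$ (i, j) = S $$ (i, j)"
        using unipotent_shift_unipotent_index[OF v2(1) u(2) 3 ij(1)] ij by (simp add: S_def shift_mat_def)
      moreover have "(v2 * (C' * S * C) * u2) $$ (i, j) = 0"
        using upper_triangularD[OF upper_triangular_conj(1)[OF cs(4) C3 cs(2) up(4) CSC(1) up(2)] 3] ij cs by simp
      moreover have "J $$ (i, j) = 0" using upper_triangularD[OF Jup 3] ij Jc by simp
      ultimately show ?thesis using ij Jc cs by (simp del: index_mult_mat(1))
    qed
  qed (use Kc Jc in auto)
  have "u2 * K = G * u2" "u2 * (S + J) = u2 * S + H * u2"
    unfolding K_def J_def using cs Gc Hc by (simp_all add: dist mult_inverse_cancel_left[OF v2(2)] ass)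
  then have GH: "u2 * S + H * u2 = G * u2" unfolding KJ by simp
  obtain q where q: "q \<in> carrier_mat n n" "p * q = 1\<^sub>m n" "q * p = 1\<^sub>m n"
    using low by (auto simp: borel_low_def GL_iff)
  have uq: "u2 * q = C' * v1"
  proof -
    have "C' * (v1 * (p * q)) = u2 * q" unfolding pC using cs q(1)
      by (simp add: ass mult_inverse_cancel_left[OF v1(3)] mult_inverse_cancel_left[OF CC(2)])
    then show ?thesis using cs q by simp
  qed
  \<comment> \<open>Multiplying \<open>GH\<close> by \<open>u1 * C\<close> on the left and by
    \<open>q\<close> on the right gives an identity for the conjugate of \<open>S\<close> by
    \<open>p\<close>.\<close>
  have eq: "p * S * q + u1 * (C * H * C') * v1 = u1 * (C * S * C') * v1 + u1 * S * v1"
  proof -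
    have "u1 * (C * ((u2 * S + H * u2) * q)) = p * S * q + u1 * (C * H * C') * v1"
      unfolding pC using cs q(1) Hc by (simp add: dist ass uq)
    moreover have "u1 * (C * (G * u2 * q)) = u1 * (C * S * C') * v1 + u1 * S * v1"
      unfolding G_def using cs q(1) by (simp add: dist ass uq mult_inverse_cancel_left[OF CC(1)])
    ultimately show ?thesis by (simp add: GH)
  qed
  have CH: "upper_triangular (C * H * C')"
    unfolding C_def C'_def by (auto intro!: upper_triangular_antidiag_conj simp: H_def mat_diag_def)
  have qlow: "upper_triangular (transpose_mat q)"
  proof (rule upper_triangular_inverse[of "transpose_mat p"])
    show "transpose_mat q * transpose_mat p = 1\<^sub>m n"
      using transpose_mult[of p n n q n] pc q by simp
  qed (use pc plow q in auto)
  \<comment> \<open>Below the diagonal \<open>eq\<close> leaves only \<open>u1 * S * v1\<close>,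
    which agrees with \<open>S\<close> there. On and above it both sides vanish, since
    \<open>p\<close> and \<open>q\<close> are lower triangular.\<close>
  have "p * S * q = S"
  proof (rule eq_matI)
    fix i j assume "i < dim_row S" "j < dim_col S"
    then have ij: "i < n" "j < n" using cs by auto
    show "(p * S * q) $$ (i, j) = S $$ (i, j)"
    proof (cases "j < i")
      case True
      have C3: "C * H * C' \<in> carrier_mat n n" "C * S * C' \<in> carrier_mat n n" using cs Hc by auto
      have "(u1 * (C * H * C') * v1) $$ (i, j) = 0" "(u1 * (C * S * C') * v1) $$ (i, j) = 0"
        using upper_triangularD[OF upper_triangular_conj(1)[OF cs(1) C3(1) cs(3) up(1) CH up(3)] True]
          upper_triangularD[OF upper_triangular_conj(1)[OF cs(1) C3(2) cs(3) up(1) CSC(2) up(3)] True] ij cs by simp_all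
      moreover have "(u1 * S * v1) $$ (i, j) = S $$ (i, j)"
        using unipotent_shift_unipotent_index[OF u(1) v1(1) True ij(1)] ij by (simp add: S_def shift_mat_def)
      ultimately show ?thesis
        using arg_cong[OF eq, of "\<lambda>M. M $$ (i, j)"] ij cs pc q by (simp del: index_mult_mat(1))
    next
      case False
      have "S * q \<in> carrier_mat n n" using cs q by simp
      then have "(p * S * q) $$ (i, j) = (\<Sum>k<n. p $$ (i, k) * (if k = 0 then 0 else q $$ (k - 1, j)))"
        using ij q mult_mat_index[OF pc, of "S * q" n i j] cs pc
        by (simp add: ass shift_mat_mult_index S_def del: index_mult_mat(1))
      also have "\<dots> = 0"
      proof (rule sum.neutral, rule ballI)
        fix k assume "k \<in> {..<n}"
        then show "p $$ (i, k) * (if k = 0 then 0 else q $$ (k - 1, j)) = 0"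
          using False ij pc q upper_triangularD[OF plow, of i k] upper_triangularD[OF qlow, of "k - 1" j]
          by (cases "k \<le> i") auto
      qed
      finally show ?thesis using False ij by (simp add: S_def shift_mat_def)
    qed
  qed (use pc q cs in auto)
  moreover have "p * S * q * p = p * S" using pc q cs by (simp add: ass)
  ultimately show ?thesis by (simp add: S_def)
qed

section \<open>Critical points of the superpotential\<close>

lemma superpotential_eq:
  assumes "reduced_w0 n iw" "Z_factors n b u1 d u2"
  shows "superpotential n b = superchar n u1 + superchar n u2"
  unfolding superpotential_def using assms Z_factors_unique[OF assms(1)]
  by (intro the_equality) blast+

lemma hw_eq:
  assumes "reduced_w0 n iw" "Z_factors n b u1 d u2"
  shows "hw n b = d"
  unfolding hw_def using assms Z_factors_unique[OF assms(1)]
  by (intro the_equality) blast+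

lemma borel_up_diag_nonzero:
  fixes x :: "'a::field mat"
  assumes "x \<in> borel_up n" "i < n"
  shows "x $$ (i, i) \<noteq> 0"
proof -
  from assms obtain V where V: "x \<in> carrier_mat n n" "upper_triangular x" "V \<in> carrier_mat n n"
    "x * V = 1\<^sub>m n" "V * x = 1\<^sub>m n"
    by (auto simp: borel_up_def GL_iff)
  have "upper_triangular V" by (rule upper_triangular_inverse[OF V(1-3,5)])
  from upper_triangular_mult_index[OF V(1,3,2) this assms(2) assms(2)] V(4) assms(2) show ?thesis by auto
qed

lemma mat_diag_mult_index:
  assumes "A \<in> carrier_mat n n" "i < n" "j < n"
  shows "(mat_diag n f * A) $$ (i, j) = f i * A $$ (i, j)" "(A * mat_diag n f) $$ (i, j) = A $$ (i, j) * f j"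
proof -
  show "(mat_diag n f * A) $$ (i, j) = f i * A $$ (i, j)"
    using assms by (simp add: mat_diag_mult_left[of _ n n])
  show "(A * mat_diag n f) $$ (i, j) = A $$ (i, j) * f j"
    using assms by (simp add: mat_diag_mult_right[of _ n n])
qed

lemma mat_diag_torus: "(\<And>i. i < n \<Longrightarrow> f i \<noteq> (0::'a::field)) \<Longrightarrow> mat_diag n f \<in> torus n"
  by (auto simp: torus_iff diagonal_mat_def mat_diag_def dvd_field_iff)

lemma torus_borel_up: "d \<in> torus n \<Longrightarrow> d \<in> borel_up n"
  by (auto simp: torus_def borel_up_def diagonal_mat_def dest: GL_carrier intro!: upper_triangularI)

lemma borel_up_mult: "x \<in> borel_up n \<Longrightarrow> y \<in> borel_up n \<Longrightarrow> x * y \<in> borel_up n"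
  by (auto simp: borel_up_def GL_mult GL_carrier intro!: upper_triangular_mult[of _ n])

text \<open>The diagonals of the two Borel factors are split off and merged into one torus element;
  moving that of \<open>y\<close> across \<open>w0_bar\<close> reverses its order, whence the
  formula for \<open>f\<close>.\<close>

lemma Z_var_factors:
  fixes b :: "'a::field mat"
  assumes w0: "reduced_w0 n iw" and b: "b \<in> Z_var n"
  obtains u1 d u2 where "Z_factors n b u1 d u2"
proof -
  note ass = assoc_mult_mat[of _ n n _ n _ n]
  obtain e :: "nat \<Rightarrow> 'a" where e: "\<And>r. r < n \<Longrightarrow> e r * e r = 1" "w0_bar n = antidiag n e"
    by (rule w0_bar_antidiag[OF w0, where 'a = 'a]) blast
  from b obtain x y where xy: "b = x * w0_bar n * y" "x \<in> borel_up n" "y \<in> borel_up n"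
    by (auto simp: Z_var_def)
  note nz = borel_up_diag_nonzero[OF xy(2)] borel_up_diag_nonzero[OF xy(3)]
  have c: "x \<in> carrier_mat n n" "y \<in> carrier_mat n n" and up: "upper_triangular x" "upper_triangular y"
    using xy by (auto simp: borel_up_def GL_carrier)
  have D: "mat_diag n f \<in> carrier_mat n n" for f :: "nat \<Rightarrow> 'a" by simp
  define u1 where "u1 = x * mat_diag n (\<lambda>i. inverse (x $$ (i, i)))"
  define u2 where "u2 = mat_diag n (\<lambda>i. inverse (y $$ (i, i))) * y"
  define f where "f i = x $$ (i, i) * y $$ (n - 1 - i, n - 1 - i)" for i
  have uc: "u1 \<in> carrier_mat n n" "u2 \<in> carrier_mat n n" unfolding u1_def u2_def using c D by (auto intro: mult_carrier_mat[of _ n n _ n])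
  have "u1 \<in> unipotent_up n" "u2 \<in> unipotent_up n"
    using c nz xy mat_diag_torus[of n "\<lambda>i. inverse (x $$ (i, i))"] mat_diag_torus[of n "\<lambda>i. inverse (y $$ (i, i))"]
    unfolding u1_def u2_def unipotent_up_def
    by (auto intro: borel_up_mult torus_borel_up simp: mat_diag_mult_index simp del: index_mult_mat(1))
  moreover have "mat_diag n f \<in> torus n"
    using nz by (intro mat_diag_torus) (simp add: f_def)
  moreover have "b = u1 * mat_diag n f * w0_bar n * u2"
  proof -
    have W: "antidiag n e \<in> carrier_mat n n" by simp
    have one: "mat_diag n (\<lambda>i. inverse (x $$ (i, i)) * x $$ (i, i)) = 1\<^sub>m n"
      "mat_diag n (\<lambda>i. y $$ (i, i) * inverse (y $$ (i, i))) = 1\<^sub>m n"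
      using nz by (auto simp: mat_diag_def intro!: eq_matI)
    have x: "x = u1 * mat_diag n (\<lambda>i. x $$ (i, i))"
      unfolding u1_def using c by (simp add: ass[OF c(1) D D] mat_diag_diag one)
    have y: "y = mat_diag n (\<lambda>i. y $$ (i, i)) * u2"
      unfolding u2_def using c by (simp add: ass[OF D D c(2), symmetric] mat_diag_diag one)
    have "mat_diag n (\<lambda>i. x $$ (i, i)) * (antidiag n e * mat_diag n (\<lambda>i. y $$ (i, i))) = mat_diag n f * antidiag n e"
    proof (rule eq_matI)
      fix i j assume "i < dim_row (mat_diag n f * antidiag n e)" "j < dim_col (mat_diag n f * antidiag n e)"
      then have ij: "i < n" "j < n" by (auto simp: carrier_matD[OF W] carrier_matD[OF D])
      show "(mat_diag n (\<lambda>i. x $$ (i, i)) * (antidiag n e * mat_diag n (\<lambda>i. y $$ (i, i)))) $$ (i, j) = (mat_diag n f * antidiag n e) $$ (i, j)"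
        using ij mult_carrier_mat[OF W D]
        by (auto simp: mat_diag_mult_index f_def antidiag_def simp del: index_mult_mat(1))
    qed (auto simp: carrier_matD[OF W] carrier_matD[OF D])
    moreover have "u1 * X * A * (Y * u2) = u1 * (X * (A * Y)) * u2"
      if "X \<in> carrier_mat n n" "A \<in> carrier_mat n n" "Y \<in> carrier_mat n n" for X A Y
      using that uc by (simp add: ass)
    ultimately have "u1 * mat_diag n (\<lambda>i. x $$ (i, i)) * antidiag n e * (mat_diag n (\<lambda>i. y $$ (i, i)) * u2) =
        u1 * (mat_diag n f * antidiag n e) * u2" by simp
    also have "\<dots> = u1 * mat_diag n f * antidiag n e * u2" using ass[OF uc(1) D W] by simp
    finally have "u1 * mat_diag n (\<lambda>i. x $$ (i, i)) * antidiag n e * (mat_diag n (\<lambda>i. y $$ (i, i)) * u2) =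
        u1 * mat_diag n f * antidiag n e * u2" .
    then show ?thesis unfolding xy(1) e(2) x[symmetric] y[symmetric] .
  qed
  ultimately show ?thesis using that unfolding Z_factors_def by blast
qed

lemma superchar_mult_strict_upper:
  assumes "u \<in> unipotent_up n" "A \<in> carrier_mat n n" "upper_triangular A" "\<And>i. i < n \<Longrightarrow> A $$ (i, i) = 0"
  shows "superchar n (u * A) = superchar n A" "superchar n (A * u) = superchar n A"
proof -
  have u: "u \<in> carrier_mat n n" "upper_triangular u" "\<And>i. i < n \<Longrightarrow> u $$ (i, i) = 1"
    using assms(1) by (auto simp: unipotent_up_iff GL_carrier)
  have A0: "A $$ (i, j) = 0" if "j \<le> i" "i < n" for i j
    using that assms upper_triangularD[OF assms(3), of j i] by (cases "i = j") auto
  have u0: "u $$ (i, j) = 0" if "j < i" "i < n" for i j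
    using that u upper_triangularD[OF u(2), of j i] by auto
  have "(u * A) $$ (i, Suc i) = A $$ (i, Suc i)" "(A * u) $$ (i, Suc i) = A $$ (i, Suc i)" if "Suc i < n" for i
  proof -
    have "(\<Sum>k<n. u $$ (i, k) * A $$ (k, Suc i)) = (\<Sum>k<n. if k = i then A $$ (i, Suc i) else 0)"
    proof (intro sum.cong)
      fix k assume "k \<in> {..<n}"
      then consider "k < i" | "k = i" | "k = Suc i" | "Suc i < k" "k < n" by force
      then show "u $$ (i, k) * A $$ (k, Suc i) = (if k = i then A $$ (i, Suc i) else 0)"
        using that by cases (simp_all add: u u0 A0)
    qed simp
    then show "(u * A) $$ (i, Suc i) = A $$ (i, Suc i)"
      using that assms(2) u by (simp add: mult_mat_index[OF u(1) assms(2)] del: index_mult_mat(1))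
    have "(\<Sum>k<n. A $$ (i, k) * u $$ (k, Suc i)) = (\<Sum>k<n. if k = Suc i then A $$ (i, Suc i) else 0)"
    proof (intro sum.cong)
      fix k assume "k \<in> {..<n}"
      then consider "k < i" | "k = i" | "k = Suc i" | "Suc i < k" "k < n" by force
      then show "A $$ (i, k) * u $$ (k, Suc i) = (if k = Suc i then A $$ (i, Suc i) else 0)"
        using that by cases (simp_all add: u u0 A0)
    qed simp
    then show "(A * u) $$ (i, Suc i) = A $$ (i, Suc i)"
      using that assms(2) u by (simp add: mult_mat_index[OF assms(2) u(1)] del: index_mult_mat(1))
  qed
  then show "superchar n (u * A) = superchar n A" "superchar n (A * u) = superchar n A"
    unfolding superchar_def by (auto intro!: sum.cong simp del: index_mult_mat(1))
qed

lemma superchar_dual_mat: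
  "P \<in> carrier_mat n n \<Longrightarrow> superchar n (dual_mat P Q) = Dual (superchar n P) (superchar n Q)"
  by (simp add: superchar_def sum_Dual[symmetric])

text \<open>Every admissible pair \<open>A\<close>, \<open>B\<close> yields a tangent vector
  \<open>dual_mat p Q\<close> of the fibre, along which the superpotential has derivative
  \<open>superchar n A + superchar n B\<close>. Criticality thus gives the stationarity required
  above.\<close>

lemma critical_point_commutes_shift:
  fixes p :: "'a::field mat"
  assumes w0: "reduced_w0 n iw" and p: "p \<in> critical_points n d"
  shows "p * shift_mat n = shift_mat n * p"
proof -
  note ass = assoc_mult_mat[of _ n n _ n _ n]
  have pZ: "p \<in> Z_var n" and hw: "hw n p = d"
    and crit: "\<And>b'. b' \<in> tangent_vectors n d p \<Longrightarrow> dual_eps (superpotential n b') = 0"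
    using p by (auto simp: critical_points_def Z_fibre_def)
  obtain u1 d' u2 where "Z_factors n p u1 d' u2" using Z_var_factors[OF w0 pZ] .
  then have Z: "Z_factors n p u1 d u2" using hw_eq[OF w0] hw by blast
  then have u: "u1 \<in> unipotent_up n" "u2 \<in> unipotent_up n" and d: "d \<in> torus n"
    and pe: "p = u1 * d * w0_bar n * u2" by (simp_all only: Z_factors_def)
  obtain e :: "nat \<Rightarrow> 'a" where e: "\<And>r. r < n \<Longrightarrow> e r * e r = 1" "w0_bar n = antidiag n e"
    by (rule w0_bar_antidiag[OF w0, where 'a = 'a]) blast
  have W: "(w0_bar n :: 'a mat) \<in> carrier_mat n n" by (simp add: e(2))
  have dc: "d \<in> carrier_mat n n" using d by (simp add: torus_iff)
  note uc = u[THEN unipotent_up_carrier]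
  define c where "c r = d $$ (r, r) * e r" for r
  have C: "antidiag n c = d * w0_bar n" unfolding e(2) torus_mult_antidiag[OF d] c_def ..
  have low: "p \<in> borel_low n" using pZ by (simp add: Z_var_def)
  show ?thesis
  proof (rule stationary_imp_commutes_shift[OF u _ _ low])
    show "c r \<noteq> 0" if "r < n" for r
      using d e(1)[OF that] that by (auto simp: c_def torus_iff)
    show "p = u1 * antidiag n c * u2" unfolding pe C using uc dc W by (simp add: ass)
  next
    fix A B :: "'a mat"
    assume A: "A \<in> carrier_mat n n" "upper_triangular A" "\<And>i. i < n \<Longrightarrow> A $$ (i, i) = 0"
      and B: "B \<in> carrier_mat n n" "upper_triangular B" "\<And>i. i < n \<Longrightarrow> B $$ (i, i) = 0"
      and Qlow: "upper_triangular (transpose_mat (u1 * (A * antidiag n c + antidiag n c * B) * u2))"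
    define Q where "Q = u1 * (A * antidiag n c + antidiag n c * B) * u2"
    have Qc: "Q \<in> carrier_mat n n" unfolding Q_def
      by (intro mult_carrier_mat[of _ n n _ n] add_carrier_mat A B uc antidiag_carrier)
    have pc: "p \<in> carrier_mat n n" using low by (simp add: borel_low_def GL_carrier)
    define d'' where "d'' = map_mat (\<lambda>x. Dual x 0) d"
    have Z': "Z_factors n (dual_mat p Q) (dual_mat u1 (u1 * A)) d'' (dual_mat u2 (B * u2))"
      unfolding Q_def d''_def by (rule Z_factors_dual_mat[OF Z C W A B])
    then have u': "dual_mat u1 (u1 * A) \<in> unipotent_up n" "dual_mat u2 (B * u2) \<in> unipotent_up n"
      and d'': "d'' \<in> torus n" and eq: "dual_mat p Q = dual_mat u1 (u1 * A) * d'' * w0_bar n * dual_mat u2 (B * u2)"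
      by (simp_all only: Z_factors_def)
    have "dual_mat u1 (u1 * A) * d'' \<in> borel_up n"
      using u'(1) d'' by (auto simp: unipotent_up_def intro: borel_up_mult torus_borel_up)
    moreover have "dual_mat u2 (B * u2) \<in> borel_up n" using u'(2) by (simp add: unipotent_up_def)
    moreover have "dual_mat p Q \<in> borel_low n"
    proof -
      have "upper_triangular (transpose_mat (dual_mat p Q))"
      proof (rule upper_triangularI)
        fix i j assume "j < i" "i < dim_row (transpose_mat (dual_mat p Q))"
        then have ij: "j < i" "i < n" using carrier_matD[OF dual_mat_carrier[OF pc]] by auto
        have "p $$ (j, i) = 0" "Q $$ (j, i) = 0"
          using ij low Qlow[folded Q_def] pc Qc upper_triangularD[of "transpose_mat p" j i]
            upper_triangularD[of "transpose_mat Q" j i] by (auto simp: borel_low_def)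
        then show "transpose_mat (dual_mat p Q) $$ (i, j) = 0"
          using ij pc carrier_matD[OF dual_mat_carrier[OF pc]] by (simp add: zero_dual_num_def)
      qed
      then show ?thesis using low Qc by (simp add: borel_low_def dual_mat_GL)
    qed
    ultimately have "dual_mat p Q \<in> Z_var n" unfolding Z_var_def using eq by blast
    moreover have "map_mat dual_re (dual_mat p Q) = p"
      by (rule eq_matI) (auto simp: dual_mat_def)
    ultimately have "dual_mat p Q \<in> tangent_vectors n d p"
      using hw_eq[OF w0 Z'] by (simp add: tangent_vectors_def Z_fibre_def d''_def)
    from crit[OF this] have "superchar n (u1 * A) + superchar n (B * u2) = 0"
      unfolding superpotential_eq[OF w0 Z'] superchar_dual_mat[OF uc(1)] superchar_dual_mat[OF uc(2)]
      by (simp add: plus_dual_num_def)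
    then show "superchar n A + superchar n B = 0"
      using superchar_mult_strict_upper[OF u(1) A] superchar_mult_strict_upper[OF u(2) B] by simp
  qed
qed


section \<open>Independence of the reduced expression\<close>

text \<open>The local rule makes \<open>g (i, j)\<close> the minimum of \<open>g\<close> over the
  simple roots between \<open>i\<close> and \<open>j\<close>, and the interval of
  \<open>(x, z)\<close> is the union of those of \<open>(x, y)\<close> and
  \<open>(y, z)\<close>.\<close>

lemma min_closed_on_pos_roots:
  assumes "\<And>i j. Suc i < j \<Longrightarrow> j < n \<Longrightarrow> g (i, j) = min (g (i, j - 1)) (g (Suc i, j))"
  shows "min_closed_on (pos_roots n) g"
proof -
  have Min: "g (i, j) = Min ((\<lambda>k. g (k, Suc k)) ` {i..<j})" if "i < j" "j < n" for i j
    using that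
  proof (induction "j - i" arbitrary: i j rule: less_induct)
    case less
    show ?case
    proof (cases "j = Suc i")
      case False
      with less.prems have ij: "Suc i < j" by simp
      have "g (i, j) = min (Min ((\<lambda>k. g (k, Suc k)) ` {i..<j - 1})) (Min ((\<lambda>k. g (k, Suc k)) ` {Suc i..<j}))"
        using assms[OF ij less.prems(2)] less.hyps[of "j - 1" i] less.hyps[of j "Suc i"] ij less.prems by simp
      also have "\<dots> = Min ((\<lambda>k. g (k, Suc k)) ` {i..<j - 1} \<union> (\<lambda>k. g (k, Suc k)) ` {Suc i..<j})"
        using ij by (intro Min_Un[symmetric]) auto
      also have "{i..<j} = {i..<j - 1} \<union> {Suc i..<j}" using ij by auto
      then have "(\<lambda>k. g (k, Suc k)) ` {i..<j - 1} \<union> (\<lambda>k. g (k, Suc k)) ` {Suc i..<j} = (\<lambda>k. g (k, Suc k)) ` {i..<j}"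
        by (simp only: image_Un)
      finally show ?thesis .
    qed simp
  qed
  show ?thesis unfolding min_closed_on_def
  proof (intro allI impI)
    fix x y z assume *: "(x, y) \<in> pos_roots n" "(y, z) \<in> pos_roots n" "(x, z) \<in> pos_roots n"
    then have "{x..<z} = {x..<y} \<union> {y..<z}" by (auto simp: pos_roots_def)
    then have "(\<lambda>k. g (k, Suc k)) ` {x..<z} = (\<lambda>k. g (k, Suc k)) ` {x..<y} \<union> (\<lambda>k. g (k, Suc k)) ` {y..<z}"
      by (simp only: image_Un)
    then show "g (x, z) = min (g (x, y)) (g (y, z))"
      using * Min[of x z] Min[of x y] Min[of y z] by (simp add: Min_Un pos_roots_def)
  qed
qed

lemma ideal_chart_y_word:
  "ideal_chart n iw d m = y_word n iw (map (\<lambda>\<alpha>. 1 / m \<alpha>) (word_roots iw)) * t_R n d m"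
proof -
  have "map (\<lambda>k. y_mat n (iw ! k) (1 / m (word_root iw k))) [0..<length iw] =
      map2 (y_mat n) iw (map (\<lambda>\<alpha>. 1 / m \<alpha>) (word_roots iw))"
    by (rule nth_equalityI) (auto simp: word_root_eq_nth)
  then show ?thesis by (simp add: ideal_chart_def y_word_def)
qed

text \<open>Braid moves bring the chart to the standard word, where the Toeplitz condition can be
  analysed. The last conclusion travels back to \<open>iw\<close>; its sign is due to the inverted
  coordinates in the chart.\<close>

lemma ideal_chart_std:
  assumes w0: "reduced_w0 n iw" and m: "\<And>\<alpha>. \<alpha> \<in> pos_roots n \<Longrightarrow> m \<alpha> \<in> puiseux_pos"
  obtains f where "\<And>\<alpha>. \<alpha> \<in> pos_roots n \<Longrightarrow> f \<alpha> \<in> puiseux_pos"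
    "ideal_chart n iw d m = std_mat n n f * t_R n d m"
    "min_closed_on (pos_roots n) (puiseux_val \<circ> f) \<Longrightarrow>
      (\<forall>\<alpha>\<in>pos_roots n. puiseux_val (f \<alpha>) = - puiseux_val (m \<alpha>))"
proof -
  have b: "braid_eq iw (std_word n)"
    using w0 reduced_w0_std[of n] by (intro reduced_words_braid_eq[of n]) (auto simp: reduced_w0_def)
  have roots: "set (word_roots iw) = pos_roots n"
    using braid_eq_roots[OF b] by (simp add: set_word_roots_std)
  define as where "as = map (\<lambda>\<alpha>. 1 / m \<alpha>) (word_roots iw)"
  have as: "simple_word n iw" "length as = length iw" "set as \<subseteq> puiseux_pos"
    using w0 m roots by (auto simp: as_def reduced_w0_def reduced_word_simple puiseux_pos_divide puiseux_pos_one)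
  from braid_transport[OF b as] roots obtain bs where bs: "length bs = length (std_word n)" "set bs \<subseteq> puiseux_pos"
    "y_word n iw as = y_word n (std_word n) bs"
    "\<And>g. min_closed_on (pos_roots n) g \<Longrightarrow>
      (map puiseux_val as = map g (word_roots iw) \<longleftrightarrow> map puiseux_val bs = map g (word_roots (std_word n)))"
    by auto
  \<comment> \<open>The roots of the standard word are distinct, so its parameters define a function
    of the root.\<close>
  define f where "f = the \<circ> map_of (zip (word_roots (std_word n)) bs)"
  have bf: "bs = map f (word_roots (std_word n))"
  proof (rule nth_equalityI)
    fix k assume "k < length bs"
    then show "bs ! k = map f (word_roots (std_word n)) ! k"
      using bs(1) map_of_zip_nth[of "word_roots (std_word n)" bs k] distinct_word_roots_std[of n] by (simp add: f_def)
  qed (simp add: bs)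
  show thesis
  proof (rule that)
    show "f \<alpha> \<in> puiseux_pos" if "\<alpha> \<in> pos_roots n" for \<alpha>
      using bs(2) that unfolding bf by (auto simp: set_word_roots_std)
    show "ideal_chart n iw d m = std_mat n n f * t_R n d m"
      unfolding ideal_chart_y_word as_def[symmetric] bs(3) std_mat_def bf ..
    show "\<forall>\<alpha>\<in>pos_roots n. puiseux_val (f \<alpha>) = - puiseux_val (m \<alpha>)"
      if "min_closed_on (pos_roots n) (puiseux_val \<circ> f)"
    proof
      fix \<alpha> assume \<alpha>: "\<alpha> \<in> pos_roots n"
      have "map puiseux_val as = map (puiseux_val \<circ> f) (word_roots iw)"
        unfolding bs(4)[OF that] by (simp add: bf)
      then have "puiseux_val (1 / m \<alpha>) = puiseux_val (f \<alpha>)"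
        using \<alpha> by (simp add: as_def roots)
      then show "puiseux_val (f \<alpha>) = - puiseux_val (m \<alpha>)"
        using m[OF \<alpha>] by (simp add: puiseux_val_divide puiseux_pos_nonzero)
    qed
  qed
qed

text \<open>By \<open>toeplitz_T_system\<close> two positive series add up to 1, so the minimum of
  their valuations is 0, as \<open>tropical_T_system\<close> requires.\<close>

lemma std_mat_toeplitz_min_closed:
  assumes f: "\<And>\<alpha>. \<alpha> \<in> pos_roots n \<Longrightarrow> f \<alpha> \<in> puiseux_pos"
    and T: "\<And>i j. Suc i < n \<Longrightarrow> Suc j < n \<Longrightarrow> std_mat n n f $$ (Suc i, Suc j) = std_mat n n f $$ (i, j)"
  shows "min_closed_on (pos_roots n) (puiseux_val \<circ> f)"
proof (rule min_closed_on_pos_roots)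
  fix i j assume ij: "Suc i < j" "j < n"
  define a where "a c r = f (r, n - 1 - c)" for c r
  define D where "D c r = puiseux_val (a c r)" for c r
  have pos: "a c r \<in> puiseux_pos" if "c + r < n - 1" for c r
    unfolding a_def using that by (intro f) (auto simp: pos_roots_def)
  have bid: "bidiag_tails (n - 1) a (tail_entry n f)"
    unfolding a_def using ij by (intro bidiag_tails_std) simp
  have "min (\<Sum>k\<le>r. D (Suc c) k - D c k) (\<Sum>k\<le>c. D k (Suc r) - D k r) = 0" if cr: "Suc (c + r) < n - 1" for c r
  proof -
    have toeplitz: "tail_entry n f 0 (Suc c) s = tail_entry n f 0 c s" if "Suc c + s \<le> n - 1" for c s
    proof -
      have e: "n - 1 - c = Suc (n - 1 - Suc c)" "Suc (n - 1 - Suc c) - s = Suc (n - 1 - Suc c - s)"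
        using that by auto
      have f0: "f \<circ> map_prod ((+) 0) ((+) 0) = f" by (auto simp: fun_eq_iff)
      show ?thesis unfolding tail_entry_def diff_zero e f0
        by (rule T[symmetric]) (use ij that in auto)
    qed
    have v: "(\<Prod>k\<le>r. a (Suc c) k / a c k) \<in> puiseux_pos" "(\<Prod>k\<le>c. a k (Suc r) / a k r) \<in> puiseux_pos"
      using cr by (auto intro!: puiseux_pos_prod puiseux_pos_divide pos)
    have "puiseux_val (\<Prod>k\<le>r. a (Suc c) k / a c k) = (\<Sum>k\<le>r. D (Suc c) k - D c k)"
      using cr by (subst puiseux_val_prod) (auto simp: D_def puiseux_val_divide puiseux_pos_nonzero pos puiseux_pos_divide intro!: sum.cong)
    moreover have "puiseux_val (\<Prod>k\<le>c. a k (Suc r) / a k r) = (\<Sum>k\<le>c. D k (Suc r) - D k r)"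
      using cr by (subst puiseux_val_prod) (auto simp: D_def puiseux_val_divide puiseux_pos_nonzero pos puiseux_pos_divide intro!: sum.cong)
    ultimately show ?thesis
      using puiseux_val_add_pos[OF v] toeplitz_T_system[OF bid _ toeplitz cr] pos puiseux_pos_nonzero by simp
  qed
  \<comment> \<open>Indices \<open>c\<close>, \<open>r\<close> belong to the root
    \<open>(r, n - 1 - c)\<close>: raising \<open>c\<close> lowers its second index, and raising
    \<open>r\<close> raises its first.\<close>
  from tropical_T_system[of "n - 1" D "n - 1 - j" i, OF this] ij
  have "D (n - 1 - j) i = min (D (Suc (n - 1 - j)) i) (D (n - 1 - j) (Suc i))" by simp
  moreover have "n - 1 - (n - 1 - j) = j" "n - 1 - Suc (n - 1 - j) = j - 1" using ij by auto
  ultimately show "(puiseux_val \<circ> f) (i, j) = min ((puiseux_val \<circ> f) (i, j - 1)) ((puiseux_val \<circ> f) (Suc i, j))"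
    by (simp add: D_def a_def)
qed

lemma std_mat_inject:
  fixes f f' :: "nat \<times> nat \<Rightarrow> 'a::field"
  assumes "std_mat n n f = std_mat n n f'" and nz: "\<And>\<alpha>. \<alpha> \<in> pos_roots n \<Longrightarrow> f \<alpha> \<noteq> 0"
    and "\<alpha> \<in> pos_roots n"
  shows "f \<alpha> = f' \<alpha>"
proof -
  obtain i j where ij: "\<alpha> = (i, j)" "i < j" "j < n" using assms(3) by (auto simp: pos_roots_def)
  have shift: "g \<circ> map_prod ((+) 0) ((+) 0) = g" for g :: "nat \<times> nat \<Rightarrow> 'a" by (auto simp: fun_eq_iff)
  have "f (i, n - 1 - (n - 1 - j)) = f' (i, n - 1 - (n - 1 - j))"
    using ij by (intro bidiag_tails_inject[OF bidiag_tails_std[of n f] bidiag_tails_std[of n f']] nz)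
      (auto simp: pos_roots_def tail_entry_def shift assms(1))
  then show ?thesis using ij by simp
qed

lemma borel_low_diag_nonzero:
  fixes p :: "'a::field mat"
  assumes "p \<in> borel_low n" "i < n"
  shows "p $$ (i, i) \<noteq> 0"
proof -
  from assms obtain V where V: "p \<in> carrier_mat n n" "V \<in> carrier_mat n n" "p * V = 1\<^sub>m n" "V * p = 1\<^sub>m n"
    by (auto simp: borel_low_def GL_iff)
  have "transpose_mat V * transpose_mat p = 1\<^sub>m n" "transpose_mat p * transpose_mat V = 1\<^sub>m n"
    unfolding transpose_mult[OF V(1,2), symmetric] transpose_mult[OF V(2,1), symmetric] V(3,4) by simp_all
  then have "transpose_mat p \<in> borel_up n"
    using assms(1) V by (auto simp: borel_low_def borel_up_def GL_iff intro!: bexI[of _ "transpose_mat V"])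
  from borel_up_diag_nonzero[OF this assms(2)] show ?thesis using V assms(2) by simp
qed

text \<open>\<open>t_R\<close> scales columns and \<open>std_mat\<close> has unit diagonal, so
  normalising the columns of \<open>p\<close> removes \<open>t_R\<close> whatever the coordinates
  are.\<close>

lemma std_mat_of_ideal_chart:
  assumes p: "p \<in> borel_low n" "p = std_mat n n f * t_R n d m" and rs: "r < n" "s < n"
  shows "std_mat n n f $$ (r, s) = p $$ (r, s) / p $$ (s, s)"
proof -
  obtain g where g: "t_R n d m = mat_diag n g" unfolding t_R_def by blast
  have "p $$ (r, s) = std_mat n n f $$ (r, s) * g s" if "r < n" for r
    unfolding p(2) g using that rs by (simp add: mat_diag_mult_index del: index_mult_mat(1))
  from this[OF rs(1)] this[OF rs(2)] borel_low_diag_nonzero[OF p(1) rs(2)] show ?thesis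
    using rs by (simp add: std_mat_lower_unipotent)
qed

theorem proposition5p5p6:
  fixes n :: nat and lam :: "nat \<Rightarrow> real" and p :: "puiseux mat"
    and iw jw :: "nat list" and m m' :: "nat \<times> nat \<Rightarrow> puiseux"
  assumes "n \<ge> 2"
    and dominant: "\<And>i j. i \<le> j \<Longrightarrow> j < n \<Longrightarrow> lam j \<le> lam i"
    and p_pos: "p \<in> Z_pos n lam"
    and p_crit: "p \<in> critical_points n (t_pow n lam)"
    and "reduced_w0 n iw" and "m \<in> pos_roots n \<rightarrow>\<^sub>E puiseux_pos"
    and "ideal_chart n iw (t_pow n lam) m = p"
    and "reduced_w0 n jw" and "m' \<in> pos_roots n \<rightarrow>\<^sub>E puiseux_pos"
    and "ideal_chart n jw (t_pow n lam) m' = p"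
  shows "trop_point n m = trop_point n m'"
proof -
  have low: "p \<in> borel_low n" using p_crit by (simp add: critical_points_def Z_fibre_def Z_var_def)
  then have pc: "p \<in> carrier_mat n n" by (simp add: borel_low_def GL_carrier)
  have comm: "p * shift_mat n = shift_mat n * p"
    using critical_point_commutes_shift[OF \<open>reduced_w0 n iw\<close> p_crit] .
  have toeplitz: "p $$ (Suc i, Suc j) = p $$ (i, j)" if "Suc i < n" "Suc j < n" for i j
    using arg_cong[OF comm, of "\<lambda>M. M $$ (Suc i, j)"] that
    by (simp add: mult_shift_mat_index[OF pc] shift_mat_mult_index[OF pc] del: index_mult_mat(1))
  have m: "m \<alpha> \<in> puiseux_pos" "m' \<alpha> \<in> puiseux_pos" if "\<alpha> \<in> pos_roots n" for \<alpha>
    using assms(6,9) that by auto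
  obtain f where f: "\<And>\<alpha>. \<alpha> \<in> pos_roots n \<Longrightarrow> f \<alpha> \<in> puiseux_pos"
    "p = std_mat n n f * t_R n (t_pow n lam) m"
    "min_closed_on (pos_roots n) (puiseux_val \<circ> f) \<Longrightarrow>
      (\<forall>\<alpha>\<in>pos_roots n. puiseux_val (f \<alpha>) = - puiseux_val (m \<alpha>))"
    using ideal_chart_std[of n iw m "t_pow n lam" thesis, OF \<open>reduced_w0 n iw\<close>, unfolded assms(7)] m(1) by blast
  obtain f' where f': "\<And>\<alpha>. \<alpha> \<in> pos_roots n \<Longrightarrow> f' \<alpha> \<in> puiseux_pos"
    "p = std_mat n n f' * t_R n (t_pow n lam) m'"
    "min_closed_on (pos_roots n) (puiseux_val \<circ> f') \<Longrightarrow>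
      (\<forall>\<alpha>\<in>pos_roots n. puiseux_val (f' \<alpha>) = - puiseux_val (m' \<alpha>))"
    using ideal_chart_std[of n jw m' "t_pow n lam" thesis, OF \<open>reduced_w0 n jw\<close>, unfolded assms(10)] m(2) by blast
  \<comment> \<open>The standard factor is determined by \<open>p\<close> alone, so both charts lead
    to the same standard parameters.\<close>
  note L = std_mat_of_ideal_chart[OF low f(2)] and L' = std_mat_of_ideal_chart[OF low f'(2)]
  have "std_mat n n f = std_mat n n f'"
    by (rule eq_matI) (auto simp: L L' carrier_matD[OF std_mat_carrier])
  then have ff: "f \<alpha> = f' \<alpha>" if "\<alpha> \<in> pos_roots n" for \<alpha>
    using std_mat_inject[of n f f' \<alpha>] f(1) puiseux_pos_nonzero that by blast
  \<comment> \<open>\<open>p\<close> is constant along diagonals, and so is its column-normalised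
    form.\<close>
  have "min_closed_on (pos_roots n) (puiseux_val \<circ> f)"
    by (rule std_mat_toeplitz_min_closed[OF f(1)]) (simp_all add: L toeplitz)
  moreover have "min_closed_on (pos_roots n) (puiseux_val \<circ> f')"
    by (rule std_mat_toeplitz_min_closed[OF f'(1)]) (simp_all add: L' toeplitz)
  ultimately have "puiseux_val (m \<alpha>) = puiseux_val (m' \<alpha>)" if "\<alpha> \<in> pos_roots n" for \<alpha>
    using f(3) f'(3) ff[OF that] that by fastforce
  then show ?thesis by (auto simp: trop_point_def intro!: restrict_ext)
qed

end
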